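(* There is an algorithm which, given a strongly connected Eulerian ribbon digraph $G$, a vertex $r$, two spanning in-arborescences $T_1,T_2\in{\rm Arb}(G,r)$ and a divisor $x\in{\rm Div}^0(G)$, decides in time polynomial in the size of the input whether $x_r(T_1)=T_2$.
   Context: A digraph here is strongly connected, may have multiple edges, and has no loops; Eulerian means in-degree equals out-degree at every vertex. ${\rm Div}^0(G)$ is the set of $x\in\mathbb{Z}^{V(G)}$ with $\sum_v x(v)=0$; with the Laplacian $L_G$ ($L_G(v,v)=-d^+(v)$, $L_G(u,v)=$ multiplicity of $\overrightarrow{vu}$ for $u\ne v$), divisors $x,y$ are linearly equivalent if $y-x\in L_G\mathbb{Z}^{V(G)}$. A ribbon digraph has, for each $v$, a fixed cyclic ordering of the edges leaving $v$ (part of the input); $e^+$ is the edge after $e$. A rotor configuration $\varrho$ assigns to each $v$ an edge $\varrho(v)$ with tail $v$. Routing at $v$ from $(x,\varrho)$ sets $\varrho(v)$ to $\varrho(v)^+$ and replaces $x$ by $x-\mathbf{1}_v+\mathbf{1}_{v'}$ where $v'$ is the head of $\varrho(v)^+$; it is legal if $x(v)>0$. ${\rm Arb}(G,r)$ is the set of spanning in-arborescences rooted at $r$ (subdigraphs in which each $v\ne r$ has out-degree one, with underlying graph a spanning tree); for $T\in{\rm Arb}(G,r)$ and an out-edge $\overrightarrow{rw}$, $T\cup\overrightarrow{rw}$ is the rotor configuration equal to the edge of $T$ leaving $v$ for $v\ne r$ and to $\overrightarrow{rw}$ at $r$. The rotor-router action (Holroyd et al.): for $x\in{\rm Div}^0(G)$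 and $T\in{\rm Arb}(G,r)$, choose a divisor $x'$ linearly equivalent to $x$ with $x'(v)\ge0$ for all $v\ne r$ and an out-edge $\overrightarrow{rw}$; from $(x',T\cup\overrightarrow{rw})$ play legal routings, never routing $r$, until all chips are at $r$; this terminates in $(\mathbf{0},\varrho'')$ with $\{\varrho''(v):v\ne r\}\in{\rm Arb}(G,r)$, and for Eulerian $G$ this arborescence, denoted $x_r(T)$, is independent of the choices. *)

theory Defs
  imports
    "Graph_Theory.Graph_Theory"
    "HOL-Library.Log_Nat"
    "HOL-Computational_Algebra.Polynomial"
begin

section \<open>Ribbon digraphs, divisors and arborescences\<close>

definition eulerian_digraph :: "('v, 'e) pre_digraph \<Rightarrow> bool" where
  "eulerian_digraph G \<longleftrightarrow> (\<forall>v \<in> verts G. in_degree G v = out_degree G v)"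

text \<open>The map \<open>nxt\<close> is \<open>e \<mapsto> e\<^sup>+\<close>. A vertex without leaving arcs can only occur
  in the strongly connected loopless digraph with a single vertex.\<close>

definition ribbon_structure :: "('v, 'e) pre_digraph \<Rightarrow> ('e \<Rightarrow> 'e) \<Rightarrow> bool" where
  "ribbon_structure G nxt \<longleftrightarrow>
     (\<forall>v \<in> verts G. out_arcs G v \<noteq> {} \<longrightarrow> cyclic_on nxt (out_arcs G v))"

text \<open>Elements of \<open>\<int>\<^bsup>V(G)\<^esup>\<close> are functions that vanish outside of the vertex set.\<close>

definition divisors :: "('v, 'e) pre_digraph \<Rightarrow> ('v \<Rightarrow> int) set" where
  "divisors G = {x. \<forall>v. v \<notin> verts G \<longrightarrow> x v = 0}"

definition divisors0 :: "('v, 'e) pre_digraph \<Rightarrow> ('v \<Rightarrow> int) set" where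
  "divisors0 G = {x \<in> divisors G. (\<Sum>v \<in> verts G. x v) = 0}"

definition laplacian :: "('v, 'e) pre_digraph \<Rightarrow> 'v \<Rightarrow> 'v \<Rightarrow> int" where
  "laplacian G u v =
     (if u = v then - int (out_degree G v)
      else int (card {e \<in> arcs G. tail G e = v \<and> head G e = u}))"

definition lin_equiv :: "('v, 'e) pre_digraph \<Rightarrow> ('v \<Rightarrow> int) \<Rightarrow> ('v \<Rightarrow> int) \<Rightarrow> bool" where
  "lin_equiv G x y \<longleftrightarrow>
     (\<exists>f :: 'v \<Rightarrow> int. \<forall>u \<in> verts G. y u - x u = (\<Sum>v \<in> verts G. laplacian G u v * f v))"

text \<open>Every arc of \<open>G\<close> together with its reversal. An undirected cycle of the underlying
  multigraph is a cycle here that uses no arc of \<open>G\<close> twice. The library's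
  \<^const>\<open>forest\<close> only excludes directed cycles.\<close>

definition bidirect :: "('v, 'e) pre_digraph \<Rightarrow> ('v, 'e \<times> bool) pre_digraph" where
  "bidirect G = \<lparr> verts = verts G, arcs = arcs G \<times> UNIV,
     tail = (\<lambda>(e, b). if b then tail G e else head G e),
     head = (\<lambda>(e, b). if b then head G e else tail G e) \<rparr>"

definition underlying_tree :: "('v, 'e) pre_digraph \<Rightarrow> bool" where
  "underlying_tree G \<longleftrightarrow> Digraph_Component.connected G \<and>
     \<not> (\<exists>p. pre_digraph.cycle (bidirect G) p \<and> distinct (map fst p))"

text \<open>A spanning subdigraph is given by its set of arcs.\<close>

definition Arb :: "('v, 'e) pre_digraph \<Rightarrow> 'v \<Rightarrow> 'e set set" where
  "Arb G r = {T. T \<subseteq> arcs G \<and>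
     (\<forall>v \<in> verts G - {r}. out_degree (G\<lparr>arcs := T\<rparr>) v = 1) \<and>
     underlying_tree (G\<lparr>arcs := T\<rparr>)}"

section \<open>The rotor-router action\<close>

definition route :: "('v, 'e) pre_digraph \<Rightarrow> ('e \<Rightarrow> 'e) \<Rightarrow> 'v \<Rightarrow>
    ('v \<Rightarrow> int) \<times> ('v \<Rightarrow> 'e) \<Rightarrow> ('v \<Rightarrow> int) \<times> ('v \<Rightarrow> 'e)" where
  "route G nxt v = (\<lambda>(x, \<rho>).
     (\<lambda>u. x u - of_bool (u = v) + of_bool (u = head G (nxt (\<rho> v))),
      \<rho>(v := nxt (\<rho> v))))"

definition legal_routing_off :: "('v, 'e) pre_digraph \<Rightarrow> ('e \<Rightarrow> 'e) \<Rightarrow> 'v \<Rightarrow>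
    ('v \<Rightarrow> int) \<times> ('v \<Rightarrow> 'e) \<Rightarrow> ('v \<Rightarrow> int) \<times> ('v \<Rightarrow> 'e) \<Rightarrow> bool" where
  "legal_routing_off G nxt r c c' \<longleftrightarrow>
     (\<exists>v \<in> verts G - {r}. fst c v > 0 \<and> c' = route G nxt v c)"

definition tree_rotor :: "('v, 'e) pre_digraph \<Rightarrow> 'v \<Rightarrow> 'e set \<Rightarrow> 'e \<Rightarrow> 'v \<Rightarrow> 'e" where
  "tree_rotor G r T e = (\<lambda>v. if v = r then e else (THE a. a \<in> T \<and> tail G a = v))"

text \<open>\<open>T'\<close> is the outcome for one choice of the representative \<open>x'\<close>, of the arc \<open>e\<close> leaving
  the root, and of the order of the routings. If no arc leaves the root (single vertex), then
  \<open>e\<close> is a dummy; it is never used.\<close>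

definition rotor_router_outcome :: "('v, 'e) pre_digraph \<Rightarrow> ('e \<Rightarrow> 'e) \<Rightarrow> 'v \<Rightarrow>
    ('v \<Rightarrow> int) \<Rightarrow> 'e set \<Rightarrow> 'e set \<Rightarrow> bool" where
  "rotor_router_outcome G nxt r x T T' \<longleftrightarrow>
     (\<exists>x' e \<rho>. x' \<in> divisors G \<and> lin_equiv G x x' \<and> (\<forall>v \<in> verts G - {r}. x' v \<ge> 0) \<and>
        (out_arcs G r \<noteq> {} \<longrightarrow> e \<in> out_arcs G r) \<and>
        (legal_routing_off G nxt r)\<^sup>*\<^sup>* (x', tree_rotor G r T e) (\<lambda>_. 0, \<rho>) \<and>
        T' = \<rho> ` (verts G - {r}))"

definition rotor_router_action :: "('v, 'e) pre_digraph \<Rightarrow> ('e \<Rightarrow> 'e) \<Rightarrow> 'v \<Rightarrow>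
    ('v \<Rightarrow> int) \<Rightarrow> 'e set \<Rightarrow> 'e set" where
  "rotor_router_action G nxt r x T = (THE T'. rotor_router_outcome G nxt r x T T')"

section \<open>Random access machines with logarithmic cost\<close>

text \<open>The computation model is a structured random access machine over the integers, with
  finitely many registers and arrays per program. Every operation is charged by the bit lengths
  of its operands (multiplication and division by their product), and every memory access also
  by the bit length of the address, so that polynomial time agrees with polynomial time on
  Turing machines.\<close>

datatype aexp =
    Const int
  | Reg nat
  | Arr nat aexp
  | Add aexp aexp
  | Sub aexp aexp
  | Mul aexp aexp
  | Div aexp aexp
  | Mod aexp aexp

datatype bexp = Less aexp aexp | Equal aexp aexp

datatype com =
    Skip
  | Assign nat aexp
  | Store nat aexp aexp
  | Seq com com
  | If bexp com com
  | While bexp com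

record ram =
  regs :: "nat \<Rightarrow> int"
  arrs :: "nat \<Rightarrow> int \<Rightarrow> int"

definition int_size :: "int \<Rightarrow> nat" where
  "int_size k = 1 + floorlog 2 (nat \<bar>k\<bar>)"

primrec aval :: "aexp \<Rightarrow> ram \<Rightarrow> int" where
  "aval (Const k) s = k"
| "aval (Reg i) s = regs s i"
| "aval (Arr a i) s = arrs s a (aval i s)"
| "aval (Add a b) s = aval a s + aval b s"
| "aval (Sub a b) s = aval a s - aval b s"
| "aval (Mul a b) s = aval a s * aval b s"
| "aval (Div a b) s = aval a s div aval b s"
| "aval (Mod a b) s = aval a s mod aval b s"

primrec acost :: "aexp \<Rightarrow> ram \<Rightarrow> nat" where
  "acost (Const k) s = int_size k"
| "acost (Reg i) s = int_size (regs s i)"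
| "acost (Arr a i) s =
     acost i s + int_size (aval i s) + int_size (arrs s a (aval i s))"
| "acost (Add a b) s = acost a s + acost b s + (int_size (aval a s) + int_size (aval b s))"
| "acost (Sub a b) s = acost a s + acost b s + (int_size (aval a s) + int_size (aval b s))"
| "acost (Mul a b) s = acost a s + acost b s + int_size (aval a s) * int_size (aval b s)"
| "acost (Div a b) s = acost a s + acost b s + int_size (aval a s) * int_size (aval b s)"
| "acost (Mod a b) s = acost a s + acost b s + int_size (aval a s) * int_size (aval b s)"

primrec bval :: "bexp \<Rightarrow> ram \<Rightarrow> bool" where
  "bval (Less a b) s \<longleftrightarrow> aval a s < aval b s"
| "bval (Equal a b) s \<longleftrightarrow> aval a s = aval b s"

primrec bcost :: "bexp \<Rightarrow> ram \<Rightarrow> nat" where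
  "bcost (Less a b) s = acost a s + acost b s + (int_size (aval a s) + int_size (aval b s))"
| "bcost (Equal a b) s = acost a s + acost b s + (int_size (aval a s) + int_size (aval b s))"

text \<open>\<open>exec c s t s'\<close>: started in state \<open>s\<close>, the program \<open>c\<close> halts in state \<open>s'\<close> after
  time \<open>t\<close>.\<close>

inductive exec :: "com \<Rightarrow> ram \<Rightarrow> nat \<Rightarrow> ram \<Rightarrow> bool" where
  exec_Skip: "exec Skip s 1 s"
| exec_Assign: "exec (Assign i a) s (1 + acost a s + int_size (aval a s))
    (s\<lparr>regs := (regs s)(i := aval a s)\<rparr>)"
| exec_Store: "exec (Store k i a) s
    (1 + acost i s + acost a s + int_size (aval i s) + int_size (aval a s))
    (s\<lparr>arrs := (arrs s)(k := (arrs s k)(aval i s := aval a s))\<rparr>)"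
| exec_Seq: "exec c s t s' \<Longrightarrow> exec d s' t' s'' \<Longrightarrow> exec (Seq c d) s (t + t') s''"
| exec_IfTrue: "bval b s \<Longrightarrow> exec c s t s' \<Longrightarrow> exec (If b c d) s (1 + bcost b s + t) s'"
| exec_IfFalse: "\<not> bval b s \<Longrightarrow> exec d s t s' \<Longrightarrow> exec (If b c d) s (1 + bcost b s + t) s'"
| exec_WhileFalse: "\<not> bval b s \<Longrightarrow> exec (While b c) s (1 + bcost b s) s"
| exec_WhileTrue: "bval b s \<Longrightarrow> exec c s t s' \<Longrightarrow> exec (While b c) s' t' s'' \<Longrightarrow>
    exec (While b c) s (1 + bcost b s + t + t') s''"

inductive_cases exec_SkipE: "exec Skip s t s'"
  and exec_AssignE: "exec (Assign i a) s t s'"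
  and exec_StoreE: "exec (Store k i a) s t s'"
  and exec_SeqE: "exec (Seq c d) s t s'"
  and exec_IfE: "exec (If b c d) s t s'"
  and exec_WhileE: "exec (While b c) s t s'"

lemma exec_deterministic: "exec c s t s' \<Longrightarrow> exec c s u s'' \<Longrightarrow> u = t \<and> s'' = s'"
proof (induction arbitrary: u s'' rule: exec.induct)
  case exec_Skip
  then show ?case by (auto elim: exec_SkipE)
next
  case exec_Assign
  then show ?case by (auto elim: exec_AssignE)
next
  case exec_Store
  then show ?case by (auto elim: exec_StoreE)
next
  case exec_Seq
  from exec_Seq.prems show ?case
    by (rule exec_SeqE) (auto dest!: exec_Seq.IH)
next
  case exec_IfTrue
  from exec_IfTrue.prems show ?case
    by (rule exec_IfE) (auto simp: exec_IfTrue.hyps dest!: exec_IfTrue.IH)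
next
  case exec_IfFalse
  from exec_IfFalse.prems show ?case
    by (rule exec_IfE) (auto simp: exec_IfFalse.hyps dest!: exec_IfFalse.IH)
next
  case exec_WhileFalse
  from exec_WhileFalse.prems show ?case
    by (rule exec_WhileE) (auto simp: exec_WhileFalse.hyps)
next
  case exec_WhileTrue
  from exec_WhileTrue.prems show ?case
    by (rule exec_WhileE) (auto simp: exec_WhileTrue.hyps dest!: exec_WhileTrue.IH)
qed

text \<open>The input is placed in array \<open>0\<close>; all other memory is \<open>0\<close>. The answer is read off
  register \<open>0\<close>.\<close>

definition input_state :: "int list \<Rightarrow> ram" where
  "input_state xs = \<lparr> regs = (\<lambda>_. 0),
     arrs = (\<lambda>a i. if a = 0 \<and> 0 \<le> i \<and> i < int (length xs) then xs ! nat i else 0) \<rparr>"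

definition input_size :: "int list \<Rightarrow> nat" where
  "input_size xs = sum_list (map int_size xs)"

definition decides_within :: "com \<Rightarrow> int list \<Rightarrow> nat \<Rightarrow> bool \<Rightarrow> bool" where
  "decides_within c xs t b \<longleftrightarrow>
     (\<exists>t' s. exec c (input_state xs) t' s \<and> t' \<le> t \<and> regs s 0 = (if b then 1 else 0))"

section \<open>Instances and their encoding\<close>

text \<open>Vertices and arcs are numbered consecutively from \<open>0\<close>; arcs, hence also parallel arcs,
  are listed one by one, and sets of arcs are given by their characteristic vectors.\<close>

definition numbered :: "(nat, nat) pre_digraph \<Rightarrow> bool" where
  "numbered G \<longleftrightarrow> verts G = {..<card (verts G)} \<and> arcs G = {..<card (arcs G)}"

definition encode :: "(nat, nat) pre_digraph \<Rightarrow> (nat \<Rightarrow> nat) \<Rightarrow> nat \<Rightarrow> nat set \<Rightarrow> nat set \<Rightarrow>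
    (nat \<Rightarrow> int) \<Rightarrow> int list" where
  "encode G nxt r T\<^sub>1 T\<^sub>2 x =
    (let n = card (verts G); m = card (arcs G) in
     [int n, int m, int r] @
     map (\<lambda>e. int (tail G e)) [0..<m] @
     map (\<lambda>e. int (head G e)) [0..<m] @
     map (\<lambda>e. int (nxt e)) [0..<m] @
     map (\<lambda>e. of_bool (e \<in> T\<^sub>1)) [0..<m] @
     map (\<lambda>e. of_bool (e \<in> T\<^sub>2)) [0..<m] @
     map x [0..<n])"

end

theory Submission
  imports Defs
begin

text \<open>
  Let \<open>I\<close> be the set of arcs passed when every rotor of \<open>T\<^sub>1\<close> is turned to that of \<open>T\<^sub>2\<close>, and let \<open>y\<close>
  be \<open>x\<close> plus one chip moved along each arc of \<open>I\<close>. Then \<open>x\<^sub>r(T\<^sub>1) = T\<^sub>2\<close> iff \<open>y\<close> is linearly equivalent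
  to \<open>0\<close>: a routing sequence amounts to an arc flow that is constant on the out-arcs of each vertex
  up to the arcs passed in the last, partial turn, and two outcomes differ by a circulation. Cutting
  this circulation along the set where it is positive, and following the final rotors out of that
  set, shows that it vanishes.

  It remains to decide whether \<open>L g = - y\<close> has an integral solution with \<open>g(r) = 0\<close>. The walk that
  follows the arcs backwards and is killed at \<open>r\<close> has expected life time at most \<open>W = 2n\<^sup>2m\<close>: in an
  Eulerian digraph the quadratic form of the Laplacian is half the sum of the squared
  differences along the arcs. Hence Jacobi iteration halves the error every \<open>2W + 1\<close> sweeps, and
  rounding each sweep to integers costs at most \<open>W\<close> in total. Applied to \<open>M y\<close> with \<open>M = 2W + 3\<close>, it yields
  \<open>M g\<close> up to an error below \<open>M/2\<close> after polynomially many sweeps; then \<open>g\<close> is found by rounding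
  and checked exactly.
\<close>

text \<open>Routings move chips one at a time while \<open>x\<close> is written in binary, so
  step-by-step simulation gives no polynomial bound. The reformulation by linear equivalence reduces
  the question to a linear system over the integers. Only integral solutions matter, so an
  approximation with error below one half determines the sole candidate; elimination, fractions and
  determinant bounds are avoided, and all intermediate integers stay below one fixed bound
  \<open>B\<close>. If there is no integral solution, the candidate is meaningless, but then the
  exact check rejects it. The action is a definite description, so an outcome must also be shown to
  exist: a representative that is nonnegative off the root, and termination of legal play. The life
  time estimate serves here again. It gives the representative
  (\<open>nonneg_representative\<close>), an a priori bound on solutions
  (\<open>fixed_bound\<close>), which limits both the number of routings and the initial error of
  the iteration, and the convergence rate (\<open>surv_power\<close>). The root is never routed, so
  its rotor does not matter; this is why an arbitrary \<open>e\<close> appears in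
  \<open>tree_rotor\<close> throughout.\<close>

locale rooted_eulerian_digraph = fin_digraph G for G :: "('v, 'e) pre_digraph" (structure) +
  fixes r :: 'v
  assumes loopfree: "loopfree_digraph G"
    and strong: "strongly_connected G"
    and eulerian: "eulerian_digraph G"
    and root: "r \<in> verts G"
begin

section \<open>Laplacian, arc flows and circulations\<close>

definition lap :: "('v \<Rightarrow> 'a::comm_ring_1) \<Rightarrow> 'v \<Rightarrow> 'a" where
  "lap f u = (\<Sum>e\<in>in_arcs G u. f (tail G e)) - of_nat (out_degree G u) * f u"

text \<open>With \<open>a e\<close> read as the number of chips sent along \<open>e\<close>, this is
  the resulting change of the divisor. By \<open>excess_tail\<close>, a flow that is constant on the
  out-arcs of each vertex changes it by a Laplacian image.\<close>

definition excess :: "('e \<Rightarrow> 'a::comm_ring_1) \<Rightarrow> 'v \<Rightarrow> 'a" where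
  "excess a u = (\<Sum>e\<in>in_arcs G u. a e) - (\<Sum>e\<in>out_arcs G u. a e)"

lemma mult_of_bool_eq: "of_bool P * (a::int) = (if P then a else 0)"
  by simp

lemma no_loop: "e \<in> arcs G \<Longrightarrow> tail G e \<noteq> head G e"
  using loopfree by (simp add: loopfree_digraph.no_loops)

lemma card_in_arcs: "v \<in> verts G \<Longrightarrow> card (in_arcs G v) = out_degree G v"
  using eulerian by (simp add: eulerian_digraph_def in_degree_def)

lemma sum_in_arcs: "(\<Sum>v\<in>verts G. \<Sum>e\<in>in_arcs G v. f e) = (\<Sum>e\<in>arcs G. f e)"
proof -
  have "(\<Sum>e\<in>arcs G. f e) = (\<Sum>v\<in>verts G. sum f {e \<in> arcs G. head G e = v})"
    by (rule sum.group[symmetric]) auto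
  then show ?thesis by (simp add: in_arcs_def)
qed

lemma sum_out_arcs: "(\<Sum>v\<in>verts G. \<Sum>e\<in>out_arcs G v. f e) = (\<Sum>e\<in>arcs G. f e)"
proof -
  have "(\<Sum>e\<in>arcs G. f e) = (\<Sum>v\<in>verts G. sum f {e \<in> arcs G. tail G e = v})"
    by (rule sum.group[symmetric]) auto
  then show ?thesis by (simp add: out_arcs_def)
qed

lemma sum_out_arcs_tail:
  "(\<Sum>e\<in>out_arcs G v. f (tail G e)) = of_nat (out_degree G v) * (f v :: 'a::comm_ring_1)"
proof -
  have "(\<Sum>e\<in>out_arcs G v. f (tail G e)) = (\<Sum>e\<in>out_arcs G v. f v)"
    by (rule sum.cong) auto
  then show ?thesis by (simp add: out_degree_def)
qed

lemma sum_in_arcs_head: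
  "v \<in> verts G \<Longrightarrow> (\<Sum>e\<in>in_arcs G v. f (head G e)) = of_nat (out_degree G v) * (f v :: 'a::comm_ring_1)"
proof -
  assume v: "v \<in> verts G"
  have "(\<Sum>e\<in>in_arcs G v. f (head G e)) = (\<Sum>e\<in>in_arcs G v. f v)"
    by (rule sum.cong) auto
  then show ?thesis by (simp add: card_in_arcs v)
qed

lemma excess_tail: "excess (\<lambda>e. f (tail G e)) u = lap f u"
  unfolding excess_def lap_def sum_out_arcs_tail ..

text \<open>The row sum of the Laplacian at \<open>u\<close> is in-degree minus out-degree, hence
  zero in the Eulerian case. This allows potentials to be normalised to vanish at
  \<open>r\<close>.\<close>

lemma lap_add_const: "u \<in> verts G \<Longrightarrow> lap (\<lambda>v. f v + c) u = lap f u"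
  by (simp add: lap_def sum.distrib card_in_arcs algebra_simps)

lemma excess_add: "excess (\<lambda>e. a e + b e) u = excess a u + excess b u"
  by (simp add: excess_def sum.distrib algebra_simps)

lemma excess_diff: "excess (\<lambda>e. a e - b e) u = excess a u - excess b u"
  by (simp add: excess_def sum_subtractf algebra_simps)

lemma lap_add: "lap (\<lambda>e. a e + b e) u = lap a u + lap b u"
  by (simp add: lap_def sum.distrib algebra_simps)

lemma lap_diff: "lap (\<lambda>e. a e - b e) u = lap a u - lap b u"
  by (simp add: lap_def sum_subtractf algebra_simps)

lemma sum_excess: "(\<Sum>u\<in>verts G. excess a u) = 0"
  by (simp add: excess_def sum_subtractf sum_in_arcs sum_out_arcs)

lemma sum_lap: "(\<Sum>u\<in>verts G. lap f u) = 0"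
  using sum_excess[of "\<lambda>e. f (tail G e)"] by (simp add: excess_tail)

lemma laplacian_sum:
  assumes u: "u \<in> verts G"
  shows "(\<Sum>v\<in>verts G. laplacian G u v * f v) = lap f u"
proof -
  have fin: "finite (in_arcs G u)" by blast
  have in_eq: "(\<Sum>e\<in>in_arcs G u. f (tail G e)) =
      (\<Sum>v\<in>verts G - {u}. int (card {e \<in> arcs G. tail G e = v \<and> head G e = u}) * f v)"
  proof -
    have "(\<Sum>e\<in>in_arcs G u. f (tail G e)) =
        (\<Sum>v\<in>verts G - {u}. sum (\<lambda>e. f (tail G e)) {e \<in> in_arcs G u. tail G e = v})"
      \<comment> \<open>Without loops, the tail of an arc into \<open>u\<close> differs from
        \<open>u\<close>, so grouping by tails misses nothing.\<close>
      by (intro sum.group[symmetric]) (auto dest: no_loop[symmetric])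
    also have "\<dots> = (\<Sum>v\<in>verts G - {u}. int (card {e \<in> arcs G. tail G e = v \<and> head G e = u}) * f v)"
    proof (rule sum.cong[OF refl])
      fix v
      have "sum (\<lambda>e. f (tail G e)) {e \<in> in_arcs G u. tail G e = v} = sum (\<lambda>e. f v) {e \<in> in_arcs G u. tail G e = v}"
        by (rule sum.cong) auto
      moreover have "{e \<in> in_arcs G u. tail G e = v} = {e \<in> arcs G. tail G e = v \<and> head G e = u}"
        by auto
      ultimately show "sum (\<lambda>e. f (tail G e)) {e \<in> in_arcs G u. tail G e = v} =
          int (card {e \<in> arcs G. tail G e = v \<and> head G e = u}) * f v" by simp
    qed
    finally show ?thesis .
  qed
  have "(\<Sum>v\<in>verts G. laplacian G u v * f v) =
      laplacian G u u * f u + (\<Sum>v\<in>verts G - {u}. laplacian G u v * f v)"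
    using u by (simp add: sum.remove)
  also have "(\<Sum>v\<in>verts G - {u}. laplacian G u v * f v) =
      (\<Sum>v\<in>verts G - {u}. int (card {e \<in> arcs G. tail G e = v \<and> head G e = u}) * f v)"
    by (rule sum.cong) (auto simp: laplacian_def)
  finally show ?thesis by (simp add: lap_def in_eq laplacian_def)
qed

lemma lin_equiv_iff: "lin_equiv G x y \<longleftrightarrow> (\<exists>f. \<forall>u\<in>verts G. y u = x u + lap f u)"
proof -
  have "(y u - x u = (\<Sum>v\<in>verts G. laplacian G u v * f v)) = (y u = x u + lap f u)"
    if "u \<in> verts G" for f u
    using laplacian_sum[OF that, of f] by (auto simp: algebra_simps)
  then show ?thesis by (simp add: lin_equiv_def)
qed

text \<open>Summing the zero excess over \<open>S\<close> leaves the net outflow of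
  \<open>S\<close>. Leaving arcs contribute \<open>a e\<close>, which is nonnegative, and entering
  arcs contribute \<open>- a e\<close>, again nonnegative, so each contribution vanishes.\<close>

lemma circulation_no_escape:
  fixes a :: "'e \<Rightarrow> int"
  assumes circ: "\<And>u. u \<in> verts G \<Longrightarrow> excess a u = 0"
    and S: "S \<subseteq> verts G"
    and out: "\<And>e. e \<in> arcs G \<Longrightarrow> tail G e \<in> S \<Longrightarrow> a e \<ge> 0"
    and inn: "\<And>e. e \<in> arcs G \<Longrightarrow> tail G e \<notin> S \<Longrightarrow> a e \<le> 0"
    and e: "e \<in> arcs G" "tail G e \<in> S" "head G e \<notin> S"
  shows "a e = 0"
proof -
  let ?t = "\<lambda>e. (of_bool (tail G e \<in> S) - of_bool (head G e \<in> S)) * a e"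
  have fS: "finite S" by (rule finite_subset[OF S finite_verts])
  have o: "(\<Sum>u\<in>S. \<Sum>e\<in>out_arcs G u. a e) = (\<Sum>e\<in>arcs G. of_bool (tail G e \<in> S) * a e)"
  proof -
    have "(\<Sum>e\<in>arcs G. of_bool (tail G e \<in> S) * a e) = sum a {e \<in> arcs G. tail G e \<in> S}"
      by (simp add: sum.inter_filter mult_of_bool_eq)
    also have "\<dots> = (\<Sum>u\<in>S. sum a {e \<in> {e \<in> arcs G. tail G e \<in> S}. tail G e = u})"
      using fS by (intro sum.group[symmetric]) auto
    also have "\<dots> = (\<Sum>u\<in>S. \<Sum>e\<in>out_arcs G u. a e)"
      by (intro sum.cong) auto
    finally show ?thesis by simp
  qed
  have i: "(\<Sum>u\<in>S. \<Sum>e\<in>in_arcs G u. a e) = (\<Sum>e\<in>arcs G. of_bool (head G e \<in> S) * a e)"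
  proof -
    have "(\<Sum>e\<in>arcs G. of_bool (head G e \<in> S) * a e) = sum a {e \<in> arcs G. head G e \<in> S}"
      by (simp add: sum.inter_filter mult_of_bool_eq)
    also have "\<dots> = (\<Sum>u\<in>S. sum a {e \<in> {e \<in> arcs G. head G e \<in> S}. head G e = u})"
      using fS by (intro sum.group[symmetric]) auto
    also have "\<dots> = (\<Sum>u\<in>S. \<Sum>e\<in>in_arcs G u. a e)"
      by (intro sum.cong) auto
    finally show ?thesis by simp
  qed
  have "(\<Sum>u\<in>S. excess a u) = 0" using circ S by (intro sum.neutral) auto
  then have z: "(\<Sum>e\<in>arcs G. ?t e) = 0"
    using o i by (simp add: excess_def sum_subtractf algebra_simps)
  have "?t e \<ge> 0" if "e \<in> arcs G" for e
    using out[OF that] inn[OF that] by (auto simp: of_bool_def)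
  then have "?t e = 0" using z e(1) by (metis (no_types, lifting) finite_arcs sum_nonneg_eq_0_iff)
  then show ?thesis using e by simp
qed

lemma out_degree_pos:
  assumes "v \<in> verts G - {r}" shows "out_degree G v > 0"
proof -
  have "v \<rightarrow>\<^sup>*\<^bsub>G\<^esub> r" using strong assms root by (auto simp: strongly_connected_def)
  then obtain p where p: "awalk v p r" by (auto simp: reachable_awalk)
  then obtain e es where "p = e # es" using assms by (cases p) (auto simp: awalk_Nil_iff)
  then have "e \<in> out_arcs G v" using p by (auto simp: awalk_Cons_iff)
  then show ?thesis unfolding out_degree_def by (metis card_gt_0_iff empty_iff finite_out_arcs)
qed

subsection \<open>Decay of the walk killed at the root\<close>

text \<open>One step of the backward walk. It is an average over in-arcs although the divisor is the
  out-degree, because the two degrees agree (\<open>avg_const\<close>).\<close>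

definition avg :: "('v \<Rightarrow> real) \<Rightarrow> 'v \<Rightarrow> real" where
  "avg f v = (\<Sum>e\<in>in_arcs G v. f (tail G e)) / real (out_degree G v)"

text \<open>\<open>surv t v\<close> is the probability that the backward walk from \<open>v\<close> survives \<open>t\<close> steps, and \<open>wt t v\<close>
  its expected life time, truncated at \<open>t\<close>.\<close>

primrec wt :: "nat \<Rightarrow> 'v \<Rightarrow> real" where
  "wt 0 = (\<lambda>_. 0)"
| "wt (Suc t) = (\<lambda>v. if v \<in> verts G - {r} then avg (wt t) v + 1 else 0)"

definition surv :: "nat \<Rightarrow> 'v \<Rightarrow> real" where
  "surv t v = wt (Suc t) v - wt t v"

lemma avg_mono: "(\<And>u. u \<in> verts G \<Longrightarrow> f u \<le> g u) \<Longrightarrow> avg f v \<le> avg g v"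
  unfolding avg_def by (intro divide_right_mono sum_mono) auto

lemma avg_const: "v \<in> verts G - {r} \<Longrightarrow> avg (\<lambda>_. c) v = c"
  using out_degree_pos[of v] by (simp add: avg_def card_in_arcs)

lemma avg_add: "avg (\<lambda>u. f u + g u) v = avg f v + avg g v"
  by (simp add: avg_def sum.distrib add_divide_distrib)

lemma avg_diff: "avg (\<lambda>u. f u - g u) v = avg f v - avg g v"
  by (simp add: avg_def sum_subtractf diff_divide_distrib)

lemma avg_mult: "avg (\<lambda>u. c * f u) v = c * avg f v"
  by (simp add: avg_def sum_distrib_left)

lemma surv_0: "surv 0 v = (if v \<in> verts G - {r} then 1 else 0)"
  by (simp add: surv_def avg_def)

lemma surv_Suc: "surv (Suc t) v = (if v \<in> verts G - {r} then avg (surv t) v else 0)"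
proof -
  have "avg (surv t) v = avg (wt (Suc t)) v - avg (wt t) v"
    unfolding surv_def by (rule avg_diff)
  then show ?thesis by (auto simp: surv_def)
qed

lemma surv_nonneg: "surv t v \<ge> 0"
proof (induction t arbitrary: v)
  case (Suc t)
  then show ?case by (auto simp: surv_Suc avg_def intro!: divide_nonneg_nonneg sum_nonneg)
qed (simp add: surv_0)

text \<open>Markov property: to survive \<open>s + t\<close> steps the walk must survive
  \<open>s\<close> of them and then \<open>t\<close> more from wherever it is, which has probability
  at most \<open>c\<close>.\<close>

lemma surv_le_prod:
  assumes "\<And>v. v \<in> verts G \<Longrightarrow> surv t v \<le> c"
  shows "v \<in> verts G \<Longrightarrow> surv (s + t) v \<le> c * surv s v"
proof (induction s arbitrary: v)
  case 0
  have "surv t r = 0" by (cases t) (auto simp: surv_0 surv_Suc)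
  then show ?case using assms[OF 0] 0 by (auto simp: surv_0)
next
  case (Suc s)
  have "avg (surv (s + t)) v \<le> avg (\<lambda>u. c * surv s u) v" by (rule avg_mono) (rule Suc.IH)
  then show ?case by (auto simp: surv_Suc avg_mult)
qed

lemma surv_decreasing: "v \<in> verts G \<Longrightarrow> surv (Suc t) v \<le> surv t v"
proof -
  assume v: "v \<in> verts G"
  have "surv 1 v \<le> 1" if "v \<in> verts G" for v
  proof -
    have "avg (surv 0) v \<le> avg (\<lambda>_. 1) v" by (rule avg_mono) (simp add: surv_0)
    then show ?thesis by (auto simp: surv_Suc avg_const)
  qed
  from surv_le_prod[of 1 1 v t, OF this v] show ?thesis by simp
qed

lemma wt_mono: "wt t v \<le> wt (Suc t) v"
  using surv_nonneg[of t v] by (simp add: surv_def)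

lemma wt_nonneg: "wt t v \<ge> 0"
proof (induction t)
  case (Suc t)
  then show ?case using wt_mono[of t v] by linarith
qed simp

lemma wt_root: "wt t r = 0"
  by (cases t) auto

lemma sum_surv: "(\<Sum>s<t. surv s v) = wt t v"
  by (induction t) (auto simp: surv_def)

text \<open>Unfolding \<open>surv\<close> gives \<open>avg (wt t) v + 1 = wt t v + surv t v\<close>:
  the truncated life time solves the Poisson equation up to the mass that survives.\<close>

lemma lap_wt:
  assumes "v \<in> verts G - {r}"
  shows "- lap (wt t) v = real (out_degree G v) * (1 - surv t v)"
  using assms out_degree_pos[OF assms]
  by (simp add: lap_def surv_def avg_def field_simps)

text \<open>When the squares are expanded, the head terms and the tail terms have the same sum,
  since each vertex is a head as often as a tail; the mixed terms are those of
  \<open>lap\<close>.\<close>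

lemma energy:
  fixes f :: "'v \<Rightarrow> real"
  shows "(\<Sum>v\<in>verts G. f v * - lap f v) = (\<Sum>e\<in>arcs G. (f (head G e) - f (tail G e))\<^sup>2) / 2"
proof -
  have hd: "(\<Sum>e\<in>arcs G. (f (head G e))\<^sup>2) = (\<Sum>v\<in>verts G. real (out_degree G v) * (f v)\<^sup>2)"
    by (subst sum_in_arcs[symmetric], intro sum.cong refl, subst sum_in_arcs_head) auto
  have tl: "(\<Sum>e\<in>arcs G. (f (tail G e))\<^sup>2) = (\<Sum>v\<in>verts G. real (out_degree G v) * (f v)\<^sup>2)"
    by (subst sum_out_arcs[symmetric], intro sum.cong refl, subst sum_out_arcs_tail) auto
  have cr: "(\<Sum>e\<in>arcs G. f (head G e) * f (tail G e)) = (\<Sum>v\<in>verts G. f v * (\<Sum>e\<in>in_arcs G v. f (tail G e)))"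
    by (subst sum_in_arcs[symmetric], intro sum.cong refl) (auto simp: sum_distrib_left)
  have "(\<Sum>e\<in>arcs G. (f (head G e) - f (tail G e))\<^sup>2) =
      (\<Sum>e\<in>arcs G. (f (head G e))\<^sup>2) + (\<Sum>e\<in>arcs G. (f (tail G e))\<^sup>2) - 2 * (\<Sum>e\<in>arcs G. f (head G e) * f (tail G e))"
    by (simp add: power2_diff sum.distrib sum_subtractf sum_distrib_left mult.assoc)
  also have "\<dots> = 2 * (\<Sum>v\<in>verts G. f v * - lap f v)"
    unfolding hd tl cr
    by (simp add: lap_def sum_subtractf sum_negf algebra_simps power2_eq_square)
  finally show ?thesis by simp
qed

section \<open>The life time bound and the rate of decay\<close>

definition hit :: nat where
  "hit = 2 * (card (verts G))\<^sup>2 * card (arcs G)"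

lemma awalk_slope:
  fixes f :: "'v \<Rightarrow> real"
  assumes "\<And>e. e \<in> arcs G \<Longrightarrow> f (head G e) - f (tail G e) \<le> d"
  shows "awalk u p v \<Longrightarrow> f v - f u \<le> real (length p) * d"
proof (induction p arbitrary: u)
  case Nil
  then show ?case by (simp add: awalk_Nil_iff)
next
  case (Cons e p)
  then have "e \<in> arcs G" "u = tail G e" "awalk (head G e) p v" by (auto simp: awalk_Cons_iff)
  with Cons.IH[of "head G e"] assms[of e] show ?case by (simp add: algebra_simps)
qed

text \<open>The potential \<open>wt t\<close> climbs from 0 at \<open>r\<close> to its maximum
  \<open>W\<close> along a path of fewer than \<open>n\<close> arcs, so some arc climbs by at least
  \<open>W / n\<close>. The energy is therefore at least the square of this, up to the factor 2, and
  it is at most \<open>W * m\<close>. Cancelling one \<open>W\<close> yields the constant in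
  \<open>hit\<close>.\<close>

lemma wt_le_hit:
  assumes "v \<in> verts G" shows "wt t v \<le> real hit"
proof -
  define W where "W = Max (wt t ` verts G)"
  define n m where "n = real (card (verts G))" and "m = real (card (arcs G))"
  have fin: "finite (wt t ` verts G)" by simp
  have le: "wt t u \<le> W" if "u \<in> verts G" for u
    unfolding W_def using that by (intro Max_ge) auto
  obtain z where z: "z \<in> verts G" "wt t z = W"
    using Max_in[OF fin] root unfolding W_def by (metis empty_iff image_iff)
  have n: "n \<ge> 1" using root card_gt_0_iff[of "verts G"] unfolding n_def by fastforce
  have Wnn: "W \<ge> 0" using z wt_nonneg by metis
  have "W \<le> 2 * n\<^sup>2 * m"
  proof (cases "W = 0")
    case True
    then show ?thesis by (simp add: n_def m_def)
  next
    case False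
    with Wnn have W: "W > 0" by simp
    have "\<exists>e\<in>arcs G. wt t (head G e) - wt t (tail G e) \<ge> W / n"
    proof (rule ccontr)
      assume "\<not> ?thesis"
      then have lt: "wt t (head G e) - wt t (tail G e) < W / n" if "e \<in> arcs G" for e
        using that by force
      have "r \<rightarrow>\<^sup>*\<^bsub>G\<^esub> z" using strong z root by (auto simp: strongly_connected_def)
      then obtain p where p: "apath r p z" by (auto simp: reachable_apath)
      then have "wt t z - wt t r \<le> real (length p) * (W / n)"
        using lt by (intro awalk_slope) (auto simp: apath_def less_imp_le)
      moreover have "real (length p) < n" using length_apath_less[OF p] by (simp add: n_def)
      then have "real (length p) * (W / n) < n * (W / n)" using W n by (intro mult_strict_right_mono) auto
      ultimately show False using z wt_root n by simp
    qed
    then obtain e where e: "e \<in> arcs G" "wt t (head G e) - wt t (tail G e) \<ge> W / n" by blast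
    have "(W / n)\<^sup>2 \<le> (wt t (head G e) - wt t (tail G e))\<^sup>2"
      using e(2) W n by (intro power_mono) auto
    also have "\<dots> \<le> (\<Sum>e\<in>arcs G. (wt t (head G e) - wt t (tail G e))\<^sup>2)"
      using e(1) by (intro member_le_sum) auto
    also have "\<dots> = 2 * (\<Sum>v\<in>verts G. wt t v * - lap (wt t) v)" unfolding energy by simp
    \<comment> \<open>Away from the root, \<open>lap_wt\<close> bounds \<open>- lap\<close> by the
      degree; at the root, where \<open>lap_wt\<close> says nothing, the factor
      \<open>wt t r\<close> is zero.\<close>
    also have "(\<Sum>v\<in>verts G. wt t v * - lap (wt t) v) \<le> (\<Sum>v\<in>verts G. W * real (out_degree G v))"
    proof (rule sum_mono)
      fix v assume v: "v \<in> verts G"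
      show "wt t v * - lap (wt t) v \<le> W * real (out_degree G v)"
      proof (cases "v = r")
        case True
        then show ?thesis using Wnn by (simp add: wt_root)
      next
        case False
        then have v': "v \<in> verts G - {r}" using v by simp
        have "- lap (wt t) v \<le> real (out_degree G v)"
          unfolding lap_wt[OF v'] using surv_nonneg[of t v] by (simp add: algebra_simps)
        then have "wt t v * - lap (wt t) v \<le> wt t v * real (out_degree G v)"
          using wt_nonneg[of t v] by (intro mult_left_mono)
        also have "\<dots> \<le> W * real (out_degree G v)" using le[OF v] by (intro mult_right_mono) auto
        finally show ?thesis .
      qed
    qed
    also have "\<dots> = W * m"
      using sum_out_arcs[of "\<lambda>_. 1::real"] by (simp add: sum_distrib_left[symmetric] m_def out_degree_def)
    finally have "W * W / n\<^sup>2 \<le> 2 * (W * m)" by (simp add: power_divide power2_eq_square)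
    then have "W * W \<le> W * (2 * n\<^sup>2 * m)" using n by (simp add: field_simps)
    then show ?thesis using W by simp
  qed
  then show ?thesis using le[OF assms] by (simp add: hit_def n_def m_def)
qed

text \<open>The survival probabilities decrease in time and the first \<open>2 * hit + 1\<close> of
  them sum to at most \<open>hit\<close>, so the next one is at most
  \<open>hit / (2 * hit + 1)\<close>.\<close>

lemma surv_half:
  assumes v: "v \<in> verts G" shows "surv (2 * hit + 1) v \<le> 1 / 2"
proof -
  let ?k = "2 * hit + 1"
  have dec: "surv (s + j) v \<le> surv s v" for s j
  proof (induction j)
    case (Suc j)
    then show ?case using surv_decreasing[OF v, of "s + j"] by simp
  qed simp
  have "real ?k * surv ?k v = (\<Sum>s<?k. surv ?k v)" by simp
  also have "\<dots> \<le> (\<Sum>s<?k. surv s v)"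
  proof (rule sum_mono)
    fix s assume "s \<in> {..<?k}"
    then show "surv ?k v \<le> surv s v" using dec[of s "?k - s"] by simp
  qed
  also have "\<dots> \<le> real hit" unfolding sum_surv by (rule wt_le_hit[OF v])
  finally have "surv ?k v \<le> real hit / real ?k" by (simp add: field_simps)
  also have "\<dots> \<le> 1 / 2" by (simp add: field_simps)
  finally show ?thesis .
qed

lemma surv_power:
  assumes v: "v \<in> verts G" shows "surv ((2 * hit + 1) * l) v \<le> (1 / 2) ^ l"
  using v
proof (induction l arbitrary: v)
  case 0
  then show ?case by (simp add: surv_0)
next
  case (Suc l)
  have "surv ((2 * hit + 1) + (2 * hit + 1) * l) v \<le> (1 / 2) ^ l * surv (2 * hit + 1) v"
    by (rule surv_le_prod) (use Suc in auto)
  also have "\<dots> \<le> (1 / 2) ^ l * (1 / 2)" by (intro mult_left_mono surv_half Suc.prems) simp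
  also have "(2 * hit + 1) + (2 * hit + 1) * l = (2 * hit + 1) * Suc l" by simp
  finally show ?case by (simp add: mult.commute del: mult_Suc_right)
qed

text \<open>The right-hand side obeys the recursion that \<open>step\<close> imposes on the left.
  The term with \<open>surv\<close> is the decaying initial error; the term with \<open>wt\<close>
  collects the errors \<open>c\<close> committed in each step.\<close>

lemma averaging_bound:
  fixes f :: "nat \<Rightarrow> 'v \<Rightarrow> real"
  assumes root0: "\<And>t. f t r = 0"
    and init: "\<And>v. v \<in> verts G \<Longrightarrow> \<bar>f 0 v\<bar> \<le> E"
    and step: "\<And>t v. v \<in> verts G - {r} \<Longrightarrow> \<bar>f (Suc t) v\<bar> \<le> avg (\<lambda>u. \<bar>f t u\<bar>) v + c"
  shows "v \<in> verts G \<Longrightarrow> \<bar>f t v\<bar> \<le> E * surv t v + c * wt t v"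
proof (induction t arbitrary: v)
  case 0
  then show ?case using init[OF 0] root0[of 0] by (cases "v = r") (auto simp: surv_0)
next
  case (Suc t)
  show ?case
  proof (cases "v = r")
    case True
    then show ?thesis using root0 by (simp add: surv_Suc)
  next
    case False
    then have v: "v \<in> verts G - {r}" using Suc.prems by simp
    have "\<bar>f (Suc t) v\<bar> \<le> avg (\<lambda>u. \<bar>f t u\<bar>) v + c" by (rule step[OF v])
    also have "avg (\<lambda>u. \<bar>f t u\<bar>) v \<le> avg (\<lambda>u. E * surv t u + c * wt t u) v"
      by (rule avg_mono) (rule Suc.IH)
    finally show ?thesis using v by (simp add: surv_Suc avg_add avg_mult algebra_simps)
  qed
qed

text \<open>\<open>averaging_bound\<close> for the constant sequence at time
  \<open>2 * hit + 1\<close>: the maximum \<open>E\<close> satisfies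
  \<open>E <= E / 2 + c * hit\<close>. This is the a priori bound for solutions of Laplacian systems
  vanishing at the root.\<close>

lemma fixed_bound:
  fixes f :: "'v \<Rightarrow> real"
  assumes root0: "f r = 0"
    and step: "\<And>v. v \<in> verts G - {r} \<Longrightarrow> \<bar>f v\<bar> \<le> avg (\<lambda>u. \<bar>f u\<bar>) v + c"
    and c: "c \<ge> 0" and v: "v \<in> verts G"
  shows "\<bar>f v\<bar> \<le> 2 * real hit * c"
proof -
  define E where "E = Max ((\<lambda>u. \<bar>f u\<bar>) ` verts G)"
  have fin: "finite ((\<lambda>u. \<bar>f u\<bar>) ` verts G)" by simp
  have le: "\<bar>f u\<bar> \<le> E" if "u \<in> verts G" for u
    unfolding E_def using that by (intro Max_ge) auto
  obtain z where z: "z \<in> verts G" "\<bar>f z\<bar> = E"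
    using Max_in[OF fin] root unfolding E_def by (metis (mono_tags, lifting) empty_iff image_iff)
  have "\<bar>f z\<bar> \<le> E * surv (2 * hit + 1) z + c * wt (2 * hit + 1) z"
    by (rule averaging_bound[where f="\<lambda>_. f"]) (use root0 le step z in auto)
  also have "\<dots> \<le> E * (1 / 2) + c * real hit"
    using z(2) c by (intro add_mono mult_left_mono surv_half wt_le_hit z(1)) auto
  finally have "E \<le> 2 * real hit * c" using z by (simp add: algebra_simps)
  then show ?thesis using le[OF v] by simp
qed

end

section \<open>Arcs passed by a rotor\<close>

text \<open>Half-open: a routing advances the rotor first and then uses the new arc, so the start is
  excluded and the end included. For equal ends the turn is empty, not a full round.\<close>

definition turn :: "('a \<Rightarrow> 'a) \<Rightarrow> 'a \<Rightarrow> 'a \<Rightarrow> 'a set" where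
  "turn f a b = (\<lambda>i. (f ^^ i) a) ` {1..funpow_dist f a b}"

lemma cyclic_on_enum:
  assumes cyc: "cyclic_on f A" and a: "a \<in> A"
  obtains N where "N > 0" "A = (\<lambda>i. (f ^^ i) a) ` {..<N}" "inj_on (\<lambda>i. (f ^^ i) a) {..<N}"
    "(f ^^ N) a = a" "\<And>j. j < N \<Longrightarrow> funpow_dist f a ((f ^^ j) a) = j"
proof
  let ?N = "funpow_dist1 f a a"
  have A: "A = orbit f a" using assms by (simp add: cyclic_on_alldef)
  have aa: "a \<in> orbit f a" using A a by simp
  show "?N > 0" by simp
  have iv: "{0..<?N} = {..<?N}" by auto
  show "A = (\<lambda>i. (f ^^ i) a) ` {..<?N}"
    using A orbit_conv_funpow_dist1[OF aa] unfolding iv by simp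
  show inj: "inj_on (\<lambda>i. (f ^^ i) a) {..<?N}"
    using inj_on_funpow_dist1[OF aa] unfolding iv .
  show "(f ^^ ?N) a = a" by (rule funpow_dist1_prop[OF aa])
  show "funpow_dist f a ((f ^^ j) a) = j" if j: "j < ?N" for j
    unfolding funpow_dist_def
  proof (rule Least_equality)
    show "j \<le> i" if "(f ^^ i) a = (f ^^ j) a" for i
    proof (rule ccontr)
      assume "\<not> j \<le> i"
      then have "i < ?N" using j by simp
      then have "i = j" using inj that j by (auto dest!: inj_onD)
      with \<open>\<not> j \<le> i\<close> show False by simp
    qed
  qed simp
qed

context
  fixes f :: "'a \<Rightarrow> 'a" and A
  assumes cyc: "cyclic_on f A"
begin

lemma funpow_dist_cyclic:
  assumes "a \<in> A" "b \<in> A" shows "(f ^^ funpow_dist f a b) a = b"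
  using assms cyc by (intro funpow_dist_prop) (auto simp: cyclic_on_alldef)

lemma turn_subset: "a \<in> A \<Longrightarrow> turn f a b \<subseteq> A"
  using cyclic_on_funpow_in[OF cyc] by (auto simp: turn_def)

lemma turn_self: "turn f a a = {}"
  by (simp add: turn_def funpow_dist_0)

lemma not_in_turn: "a \<in> A \<Longrightarrow> b \<in> A \<Longrightarrow> a \<notin> turn f a b"
proof
  assume a: "a \<in> A" and b: "b \<in> A" and "a \<in> turn f a b"
  then obtain i where i: "i \<ge> 1" "i \<le> funpow_dist f a b" "(f ^^ i) a = a" by (auto simp: turn_def)
  have "b \<in> orbit f a" using a b cyc by (auto simp: cyclic_on_alldef)
  from funpow_neq_less_funpow_dist[OF this, of i 0] i show False by simp
qed

lemma in_turn_dist_le: "c \<in> turn f a b \<Longrightarrow> funpow_dist f a c \<le> funpow_dist f a b"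
proof -
  assume "c \<in> turn f a b"
  then obtain i where i: "i \<le> funpow_dist f a b" "(f ^^ i) a = c" by (auto simp: turn_def)
  then have "funpow_dist f a c \<le> i" unfolding funpow_dist_def by (intro Least_le)
  with i show ?thesis by simp
qed

lemma end_in_turn: "a \<in> A \<Longrightarrow> b \<in> A \<Longrightarrow> a \<noteq> b \<Longrightarrow> b \<in> turn f a b"
proof -
  assume a: "a \<in> A" and b: "b \<in> A" and "a \<noteq> b"
  then have "funpow_dist f a b \<ge> 1" using funpow_dist_cyclic[OF a b]
    by (cases "funpow_dist f a b") auto
  then show ?thesis using funpow_dist_cyclic[OF a b] by (force simp: turn_def)
qed

lemma turn_mono: "funpow_dist f a b \<le> funpow_dist f a c \<Longrightarrow> turn f a b \<subseteq> turn f a c"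
  by (auto simp: turn_def)

text \<open>Bookkeeping of a single routing. Usually the turn just gains \<open>f b\<close>. On
  returning to \<open>a\<close>, the turn, which then holds all of \<open>A\<close> except
  \<open>a\<close>, is reset to empty, and the first term records a full round, counted once for
  every arc of \<open>A\<close>.\<close>

lemma turn_step:
  assumes a: "a \<in> A" and b: "b \<in> A" and e: "e \<in> A"
  shows "of_bool (f b = a) + of_bool (e \<in> turn f a (f b)) =
    (of_bool (e \<in> turn f a b) + of_bool (e = f b) :: int)"
proof -
  obtain N where N: "N > 0" "A = (\<lambda>i. (f ^^ i) a) ` {..<N}" "inj_on (\<lambda>i. (f ^^ i) a) {..<N}"
    "(f ^^ N) a = a" "\<And>j. j < N \<Longrightarrow> funpow_dist f a ((f ^^ j) a) = j"
    using cyclic_on_enum[OF cyc a] by blast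
  obtain j where j: "j < N" "b = (f ^^ j) a" using N(2) b by auto
  obtain i where i: "i < N" "e = (f ^^ i) a" using N(2) e by auto
  have eq: "(f ^^ i) a = (f ^^ k) a \<longleftrightarrow> i = k" if "i < N" "k < N" for i k
    using N(3) that by (auto dest: inj_onD)
  have mem: "e \<in> turn f a ((f ^^ k) a) \<longleftrightarrow> 1 \<le> i \<and> i \<le> k" if "k < N" for k
  proof -
    have "e \<in> turn f a ((f ^^ k) a) \<longleftrightarrow> (\<exists>l\<in>{1..k}. (f ^^ i) a = (f ^^ l) a)"
      using N(5)[OF that] i by (auto simp: turn_def)
    also have "\<dots> \<longleftrightarrow> (\<exists>l\<in>{1..k}. i = l)"
      using eq i that by (intro bex_cong) auto
    finally show ?thesis by auto
  qed
  have fb: "f b = (f ^^ Suc j) a" using j by simp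
  show ?thesis
  proof (cases "Suc j = N")
    case True
    then have "f b = a" using fb N(4) by simp
    moreover have "e = a \<longleftrightarrow> i = 0" using eq[of i 0] i N(1) by simp
    ultimately show ?thesis using mem[OF j(1)] j(2) True i by (auto simp: turn_self)
  next
    case False
    then have S: "Suc j < N" using j by simp
    have "f b \<noteq> a" using eq[of "Suc j" 0] S N(1) fb by simp
    moreover have "e = f b \<longleftrightarrow> i = Suc j" using eq[of i "Suc j"] S i fb by simp
    ultimately show ?thesis using mem[OF S] mem[OF j(1)] j(2) fb by auto
  qed
qed

text \<open>Turns with a common start are nested, so their indicators differ by plus or minus the
  indicator of a set. Writing the negative case as -1 plus a complement gives both cases one form,
  in which the arc \<open>c\<close> receives the larger value and \<open>b\<close> the
  smaller.\<close>

lemma turn_diff: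
  assumes a: "a \<in> A" and b: "b \<in> A" and c: "c \<in> A"
  obtains h J where
    "\<And>e. of_bool (e \<in> turn f a c) - of_bool (e \<in> turn f a b) = (h + of_bool (e \<in> J) :: int)"
    "b = c \<Longrightarrow> h = 0 \<and> J = {}" "b \<noteq> c \<Longrightarrow> c \<in> J \<and> b \<notin> J"
proof (cases "b = c")
  case True
  then show ?thesis using that[of 0 "{}"] by simp
next
  case False
  have ne: "funpow_dist f a b \<noteq> funpow_dist f a c"
    using False funpow_dist_cyclic[OF a b] funpow_dist_cyclic[OF a c] by auto
  show ?thesis
  proof (cases "funpow_dist f a b < funpow_dist f a c")
    case True
    let ?J = "turn f a c - turn f a b"
    have sub: "turn f a b \<subseteq> turn f a c" using True by (intro turn_mono) simp
    have "c \<noteq> a" using True by (auto simp: funpow_dist_0)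
    then have "c \<in> ?J" using end_in_turn[OF a c] in_turn_dist_le[of c a b] True by auto
    moreover have "b \<notin> ?J"
      using end_in_turn[OF a b] not_in_turn[OF a c] by (cases "a = b") auto
    ultimately show ?thesis using sub False by (intro that[of 0 ?J]) auto
  next
    case nl: False
    let ?J = "- (turn f a b - turn f a c)"
    have less: "funpow_dist f a c < funpow_dist f a b" using nl ne by simp
    then have sub: "turn f a c \<subseteq> turn f a b" by (intro turn_mono) simp
    have "b \<noteq> a" using less by (auto simp: funpow_dist_0)
    then have "b \<notin> ?J" using end_in_turn[OF a b] in_turn_dist_le[of b a c] less by auto
    moreover have "c \<in> ?J"
      using end_in_turn[OF a c] not_in_turn[OF a b] by (cases "a = c") auto
    ultimately show ?thesis using sub False by (intro that[of "-1" ?J]) auto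
  qed
qed

end

section \<open>Arborescences as rotor configurations\<close>

context rooted_eulerian_digraph
begin

text \<open>If \<open>S\<close> were closed, following the chosen arcs inside the finite set
  \<open>S\<close> would eventually repeat a vertex; up to the first repetition this traces a
  directed cycle of \<open>T\<close>, which is also an undirected one.\<close>

lemma acyclic_arcs_leave:
  assumes T: "T \<subseteq> arcs G"
    and tree: "\<not> (\<exists>p. pre_digraph.cycle (bidirect (G\<lparr>arcs := T\<rparr>)) p \<and> distinct (map fst p))"
    and S: "S \<noteq> {}" "S \<subseteq> verts G" and c: "\<And>v. v \<in> S \<Longrightarrow> c v \<in> T \<and> tail G (c v) = v"
  shows "\<exists>v\<in>S. head G (c v) \<notin> S"
proof (rule ccontr)
  assume "\<not> ?thesis"
  then have cl: "head G (c v) \<in> S" if "v \<in> S" for v using that by blast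
  let ?H = "bidirect (G\<lparr>arcs := T\<rparr>)"
  have wf: "wf_digraph ?H"
    by (rule wf_digraph.intro) (use T in \<open>auto simp: bidirect_def split: if_splits\<close>)
  interpret H: wf_digraph ?H by (rule wf)
  have Hs: "verts ?H = verts G" "arcs ?H = T \<times> UNIV"
    "tail ?H (a, True) = tail G a" "head ?H (a, True) = head G a" for a
    by (simp_all add: bidirect_def)
  obtain v0 where v0: "v0 \<in> S" using S by blast
  define v where "v i = ((\<lambda>v. head G (c v)) ^^ i) v0" for i
  have vS: "v i \<in> S" for i
    by (induction i) (auto simp: v_def v0 cl)
  have vSuc: "v (Suc i) = head G (c (v i))" for i by (simp add: v_def)
  define rep where "rep j \<longleftrightarrow> (\<exists>i<j. v i = v j)" for j
  have "\<exists>j. rep j"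
  proof (rule ccontr)
    assume "\<not> ?thesis"
    then have "v a \<noteq> v b" if "a < b" for a b using that unfolding rep_def by blast
    then have "inj v" by (intro injI) (metis linorder_neqE_nat)
    moreover have "finite (range v)" 
      by (rule finite_subset[of _ "verts G"]) (use vS S in auto)
    ultimately show False using finite_imageD by blast
  qed
  define j where "j = (LEAST j. rep j)"
  \<comment> \<open>Minimality of \<open>j\<close> makes the vertices before it distinct, so the
    closed stretch from \<open>i\<close> to \<open>j\<close> is a simple cycle.\<close>
  have repj: "rep j" unfolding j_def using \<open>\<exists>j. rep j\<close> by (rule LeastI_ex)
  have min: "\<not> rep k" if "k < j" for k using that not_less_Least unfolding j_def by blast
  obtain i where i: "i < j" "v i = v j" using repj unfolding rep_def by blast
  have inj: "inj_on v {..<j}"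
  proof (rule inj_onI)
    fix a b assume "a \<in> {..<j}" "b \<in> {..<j}" "v a = v b"
    then show "a = b" using min[of a] min[of b] unfolding rep_def
      by (metis lessThan_iff linorder_neqE_nat)
  qed
  \<comment> \<open>The flag \<open>True\<close> means that arcs are traversed in their own
    direction.\<close>
  define q where "q n = map (\<lambda>k. (c (v k), True)) [i..<i + n]" for n
  have q: "H.awalk (v i) (q n) (v (i + n)) \<and> H.awalk_verts (v i) (q n) = map v [i..<Suc (i + n)]" for n
  proof (induction n)
    case 0
    have "v i \<in> verts ?H" using vS[of i] S by (auto simp: Hs)
    then show ?case by (simp add: q_def H.awalk_Nil_iff)
  next
    case (Suc n)
    have qs: "q (Suc n) = q n @ [(c (v (i + n)), True)]" by (simp add: q_def)
    have l: "H.awlast (v i) (q n) = v (i + n)" using Suc by simp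
    have a: "H.awalk (v (i + n)) [(c (v (i + n)), True)] (v (i + Suc n))"
      using c[OF vS[of "i + n"]] subsetD[OF S(2) vS[of "Suc (i + n)"]]
      by (simp add: H.awalk_simps Hs vSuc[symmetric])
    have h: "head ?H (c (v (i + n)), True) = v (i + Suc n)" by (simp add: Hs vSuc)
    have t: "tail ?H (c (v (i + n)), True) = v (i + n)"
      using c[OF vS[of "i + n"]] by (simp add: Hs)
    show ?case unfolding qs using Suc l a h t by (simp add: H.awalk_verts_append)
  qed
  have ij: "i + (j - i) = j" using i by simp
  have "H.cycle (q (j - i))"
    unfolding H.cycle_def
  proof (intro exI conjI)
    show "H.awalk (v i) (q (j - i)) (v i)" using q[of "j - i"] ij i by simp
    show "q (j - i) \<noteq> []" using i by (simp add: q_def)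
    have "tl (H.awalk_verts (v i) (q (j - i))) = map v [Suc i..<Suc j]"
      using q[of "j - i"] ij i by (simp add: upt_conv_Cons)
    moreover have "distinct (map v [Suc i..<Suc j])"
    proof -
      have "v j \<notin> v ` {Suc i..<j}"
      proof
        assume "v j \<in> v ` {Suc i..<j}"
        then obtain k where "Suc i \<le> k" "k < j" "v k = v i" using i by auto
        then show False using inj_onD[OF inj, of k i] i by simp
      qed
      moreover have "inj_on v {Suc i..<j}" by (rule inj_on_subset[OF inj]) auto
      ultimately show ?thesis using i by (simp add: distinct_map)
    qed
    ultimately show "distinct (tl (H.awalk_verts (v i) (q (j - i))))" by simp
  qed
  moreover have "distinct (map fst (q (j - i)))"
  proof -
    have "inj_on (\<lambda>k. c (v k)) {i..<j}"
    proof (rule inj_onI)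
      fix a b assume ab: "a \<in> {i..<j}" "b \<in> {i..<j}" "c (v a) = c (v b)"
      then have "v a = v b" using c[OF vS[of a]] c[OF vS[of b]] by metis
      then show "a = b" using inj ab by (auto dest!: inj_onD)
    qed
    then show ?thesis using i by (simp add: q_def distinct_map comp_def)
  qed
  ultimately show False using tree by blast
qed

definition rotor_conf :: "('v \<Rightarrow> 'e) \<Rightarrow> bool" where
  "rotor_conf \<rho> \<longleftrightarrow> (\<forall>v\<in>verts G - {r}. \<rho> v \<in> out_arcs G v)"

text \<open>For a rotor configuration this says that following the rotors from any vertex ends in
  \<open>r\<close>. The form with sets is the one needed for cutting a circulation along a set, and
  it is easy to carry through a routing sequence.\<close>

definition leads_to_root :: "('v \<Rightarrow> 'e) \<Rightarrow> bool" where
  "leads_to_root \<rho> \<longleftrightarrow> (\<forall>S. S \<subseteq> verts G - {r} \<longrightarrow> S \<noteq> {} \<longrightarrow> (\<exists>v\<in>S. head G (\<rho> v) \<notin> S))"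

lemma Arb_rotor:
  assumes T: "T \<in> Arb G r"
  shows "rotor_conf (tree_rotor G r T e)" "leads_to_root (tree_rotor G r T e)"
    "T = tree_rotor G r T e ` (verts G - {r})"
    "v \<in> verts G - {r} \<Longrightarrow> a \<in> T \<and> tail G a = v \<longleftrightarrow> a = tree_rotor G r T e v"
proof -
  let ?\<rho> = "tree_rotor G r T e"
  have sub: "T \<subseteq> arcs G" using T by (simp add: Arb_def)
  have tree: "\<not> (\<exists>p. pre_digraph.cycle (bidirect (G\<lparr>arcs := T\<rparr>)) p \<and> distinct (map fst p))"
    using T by (simp add: Arb_def underlying_tree_def)
  have uniq: "a \<in> T \<and> tail G a = v \<longleftrightarrow> a = ?\<rho> v" if v: "v \<in> verts G - {r}" for a v
  proof -
    have "out_degree (G\<lparr>arcs := T\<rparr>) v = 1" using T v by (simp add: Arb_def)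
    then have "card {a \<in> T. tail G a = v} = 1" by (simp add: out_degree_def out_arcs_def)
    then obtain b where b: "{a \<in> T. tail G a = v} = {b}" by (auto simp: card_1_singleton_iff)
    then have "?\<rho> v = b" using v by (auto simp: tree_rotor_def intro!: the_equality)
    then show ?thesis using b by auto
  qed
  then show "v \<in> verts G - {r} \<Longrightarrow> a \<in> T \<and> tail G a = v \<longleftrightarrow> a = ?\<rho> v" .
  show "rotor_conf ?\<rho>" unfolding rotor_conf_def using uniq sub by (auto simp: out_arcs_def)
  show "leads_to_root ?\<rho>"
    unfolding leads_to_root_def
  proof (intro allI impI)
    fix S assume S: "S \<subseteq> verts G - {r}" "S \<noteq> {}"
    show "\<exists>v\<in>S. head G (?\<rho> v) \<notin> S"
      by (rule acyclic_arcs_leave[OF sub tree]) (use S uniq in auto)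
  qed
  \<comment> \<open>\<open>Arb\<close> prescribes out-degrees only off the root. An arc of
    \<open>T\<close> leaving the root would give every vertex an arc of \<open>T\<close>, and then
    the set of all vertices would be closed.\<close>
  have "tail G a \<noteq> r" if a: "a \<in> T" for a
  proof
    assume ta: "tail G a = r"
    have "\<exists>v\<in>verts G. head G ((?\<rho>(r := a)) v) \<notin> verts G"
      by (rule acyclic_arcs_leave[OF sub tree]) (use root uniq a ta in auto)
    moreover have "(?\<rho>(r := a)) v \<in> arcs G" if "v \<in> verts G" for v
      using that uniq[of v] a sub by (cases "v = r") auto
    ultimately show False by auto
  qed
  then have tl: "tail G a \<in> verts G - {r}" if "a \<in> T" for a
    using that sub by auto
  show "T = ?\<rho> ` (verts G - {r})"
  proof (intro subset_antisym subsetI)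
    fix a assume "a \<in> T"
    then have "a = ?\<rho> (tail G a)" using uniq[OF tl] by blast
    then show "a \<in> ?\<rho> ` (verts G - {r})" using tl[OF \<open>a \<in> T\<close>] by (rule image_eqI)
  next
    fix a assume "a \<in> ?\<rho> ` (verts G - {r})"
    then show "a \<in> T" using uniq by blast
  qed
qed

end

section \<open>The rotor-router action\<close>

locale rotor_digraph = rooted_eulerian_digraph +
  fixes nxt :: "'b \<Rightarrow> 'b"
  assumes ribbon: "ribbon_structure G nxt"
begin

lemma cyclic_out:
  assumes "e \<in> out_arcs G v" shows "cyclic_on nxt (out_arcs G v)"
proof -
  have "v \<in> verts G" using assms by auto
  then show ?thesis using ribbon assms unfolding ribbon_structure_def by blast
qed

lemma nxt_out: "e \<in> out_arcs G v \<Longrightarrow> nxt e \<in> out_arcs G v"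
  by (rule cyclic_on_inI[OF cyclic_out])

text \<open>For the rotors of the two arborescences this is the indicator of the set
  \<open>I\<close> of the overview. Out-arcs of the root are excluded, so the value does not depend
  on the rotor there.\<close>

definition swing :: "('a \<Rightarrow> 'b) \<Rightarrow> ('a \<Rightarrow> 'b) \<Rightarrow> 'b \<Rightarrow> int" where
  "swing \<rho> \<rho>' e = of_bool (tail G e \<noteq> r \<and> e \<in> turn nxt (\<rho> (tail G e)) (\<rho>' (tail G e)))"

lemma swing_self: "swing \<rho> \<rho> e = 0"
  by (simp add: swing_def turn_def funpow_dist_0)

text \<open>The difference \<open>a\<close> of the two flows is a circulation whose values on the
  out-arcs of \<open>v\<close> are \<open>k v\<close> or \<open>k v + 1\<close>, the larger one on
  \<open>D v\<close>. Where the rotors differ, \<rho>2 carries the larger value and \<rho>1 the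
  smaller. Two cuts are made: \<rho>2 leads out of the positive part, and then \<rho>1 out of the
  negative part. Once both parts are empty, \<open>D v\<close> is empty, so the rotors
  agree.\<close>

lemma leads_to_root_unique:
  assumes conf0: "rotor_conf \<rho>\<^sub>0" and conf: "rotor_conf \<rho>\<^sub>1" "rotor_conf \<rho>\<^sub>2"
    and lead: "leads_to_root \<rho>\<^sub>1" "leads_to_root \<rho>\<^sub>2"
    and g1: "\<And>u. u \<in> verts G \<Longrightarrow> x u + lap g\<^sub>1 u + excess (swing \<rho>\<^sub>0 \<rho>\<^sub>1) u = 0"
    and g2: "\<And>u. u \<in> verts G \<Longrightarrow> x u + lap g\<^sub>2 u + excess (swing \<rho>\<^sub>0 \<rho>\<^sub>2) u = 0"
    and v: "v \<in> verts G - {r}"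
  shows "\<rho>\<^sub>1 v = \<rho>\<^sub>2 v"
proof -
  have "\<exists>h J. v \<in> verts G - {r} \<longrightarrow>
      (\<forall>e. of_bool (e \<in> turn nxt (\<rho>\<^sub>0 v) (\<rho>\<^sub>2 v)) - of_bool (e \<in> turn nxt (\<rho>\<^sub>0 v) (\<rho>\<^sub>1 v)) = (h + of_bool (e \<in> J) :: int)) \<and>
      (\<rho>\<^sub>1 v = \<rho>\<^sub>2 v \<longrightarrow> h = 0 \<and> J = {}) \<and> (\<rho>\<^sub>1 v \<noteq> \<rho>\<^sub>2 v \<longrightarrow> \<rho>\<^sub>2 v \<in> J \<and> \<rho>\<^sub>1 v \<notin> J)" for v
  proof (cases "v \<in> verts G - {r}")
    case True
    then have o: "\<rho>\<^sub>0 v \<in> out_arcs G v" "\<rho>\<^sub>1 v \<in> out_arcs G v" "\<rho>\<^sub>2 v \<in> out_arcs G v"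
      using conf0 conf unfolding rotor_conf_def by blast+
    obtain h :: int and J where
      "\<And>e. of_bool (e \<in> turn nxt (\<rho>\<^sub>0 v) (\<rho>\<^sub>2 v)) - of_bool (e \<in> turn nxt (\<rho>\<^sub>0 v) (\<rho>\<^sub>1 v)) = (h + of_bool (e \<in> J) :: int)"
      "\<rho>\<^sub>1 v = \<rho>\<^sub>2 v \<Longrightarrow> h = 0 \<and> J = {}" "\<rho>\<^sub>1 v \<noteq> \<rho>\<^sub>2 v \<Longrightarrow> \<rho>\<^sub>2 v \<in> J \<and> \<rho>\<^sub>1 v \<notin> J"
      using turn_diff[OF cyclic_out[OF o(1)] o] by blast
    then show ?thesis by blast
  qed blast
  then obtain h J where hJ: "\<And>v e. v \<in> verts G - {r} \<Longrightarrow>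
      of_bool (e \<in> turn nxt (\<rho>\<^sub>0 v) (\<rho>\<^sub>2 v)) - of_bool (e \<in> turn nxt (\<rho>\<^sub>0 v) (\<rho>\<^sub>1 v)) = (h v + of_bool (e \<in> J v) :: int)"
    and eq: "\<And>v. v \<in> verts G - {r} \<Longrightarrow> \<rho>\<^sub>1 v = \<rho>\<^sub>2 v \<Longrightarrow> h v = 0 \<and> J v = {}"
    and ne: "\<And>v. v \<in> verts G - {r} \<Longrightarrow> \<rho>\<^sub>1 v \<noteq> \<rho>\<^sub>2 v \<Longrightarrow> \<rho>\<^sub>2 v \<in> J v \<and> \<rho>\<^sub>1 v \<notin> J v"
    by metis
  \<comment> \<open>Normalised to \<open>k r = 0\<close>, so that the root belongs to neither
    cut.\<close>
  define k where "k v = (g\<^sub>2 v - g\<^sub>1 v) - (g\<^sub>2 r - g\<^sub>1 r) + (if v = r then 0 else h v)" for v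
  define D where "D v = (if v = r then {} else J v)" for v
  define a where "a e = k (tail G e) + of_bool (e \<in> D (tail G e))" for e
  have a_eq: "a e = (g\<^sub>2 (tail G e) - g\<^sub>1 (tail G e) - (g\<^sub>2 r - g\<^sub>1 r)) + (swing \<rho>\<^sub>0 \<rho>\<^sub>2 e - swing \<rho>\<^sub>0 \<rho>\<^sub>1 e)"
    if "e \<in> arcs G" for e
    using hJ[of "tail G e" e] that by (auto simp: a_def k_def D_def swing_def)
  have circ: "excess a u = 0" if u: "u \<in> verts G" for u
  proof -
    have "excess a u = excess (\<lambda>e. (g\<^sub>2 (tail G e) - g\<^sub>1 (tail G e) + - (g\<^sub>2 r - g\<^sub>1 r)) + (swing \<rho>\<^sub>0 \<rho>\<^sub>2 e - swing \<rho>\<^sub>0 \<rho>\<^sub>1 e)) u"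
      unfolding excess_def using a_eq by (intro arg_cong2[where f="(-)"] sum.cong) auto
    also have "\<dots> = lap (\<lambda>v. (g\<^sub>2 v - g\<^sub>1 v) + - (g\<^sub>2 r - g\<^sub>1 r)) u + (excess (swing \<rho>\<^sub>0 \<rho>\<^sub>2) u - excess (swing \<rho>\<^sub>0 \<rho>\<^sub>1) u)"
      by (subst excess_add, subst excess_diff[of "swing \<rho>\<^sub>0 \<rho>\<^sub>2"],
          subst excess_tail[of "\<lambda>v. (g\<^sub>2 v - g\<^sub>1 v) + - (g\<^sub>2 r - g\<^sub>1 r)" u]) simp
    also have "lap (\<lambda>v. (g\<^sub>2 v - g\<^sub>1 v) + - (g\<^sub>2 r - g\<^sub>1 r)) u = lap g\<^sub>2 u - lap g\<^sub>1 u"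
      unfolding lap_add_const[OF u] by (rule lap_diff)
    finally show ?thesis using g1[OF u] g2[OF u] by simp
  qed
  have kr: "k r = 0" "D r = {}" by (simp_all add: k_def D_def)
  have D_eq: "D v = {}" if "v \<in> verts G - {r}" "\<rho>\<^sub>1 v = \<rho>\<^sub>2 v" for v
    using eq[OF that] by (simp add: D_def)
  have D_ne: "\<rho>\<^sub>2 v \<in> D v \<and> \<rho>\<^sub>1 v \<notin> D v" if "v \<in> verts G - {r}" "\<rho>\<^sub>1 v \<noteq> \<rho>\<^sub>2 v" for v
    using ne[OF that] that by (auto simp: D_def)
  \<comment> \<open>Vertices with \<open>k v = 0\<close> and different rotors belong here: their
    values are 0 or 1, with 1 on the second rotor. Outside \<open>S\<close>, integrality makes
    \<open>k v + 1\<close> nonpositive as soon as \<open>k v\<close> is negative.\<close>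
  define S where "S = {v \<in> verts G - {r}. k v > 0 \<or> k v = 0 \<and> \<rho>\<^sub>1 v \<noteq> \<rho>\<^sub>2 v}"
  have notS: "k v < 0 \<or> k v = 0 \<and> D v = {}" if "v \<in> verts G" "v \<notin> S" for v
    using that kr D_eq[of v] unfolding S_def by (cases "v = r") force+
  have S_empty: "S = {}"
  proof (rule ccontr)
    assume "S \<noteq> {}"
    then obtain v where v: "v \<in> S" "head G (\<rho>\<^sub>2 v) \<notin> S"
      using lead(2) unfolding leads_to_root_def S_def by (metis (no_types, lifting) mem_Collect_eq subsetI)
    then have vv: "v \<in> verts G - {r}" by (simp add: S_def)
    then have ov: "\<rho>\<^sub>2 v \<in> arcs G" "tail G (\<rho>\<^sub>2 v) = v" using conf unfolding rotor_conf_def by auto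
    have "a (\<rho>\<^sub>2 v) = 0"
    proof (rule circulation_no_escape[OF circ])
      show "S \<subseteq> verts G" by (auto simp: S_def)
      show "0 \<le> a e" if "tail G e \<in> S" for e using that by (auto simp: a_def S_def)
      show "a e \<le> 0" if "e \<in> arcs G" "tail G e \<notin> S" for e
        using notS[OF _ that(2)] that(1) by (auto simp: a_def)
    qed (use ov v in auto)
    moreover have "a (\<rho>\<^sub>2 v) > 0" using v(1) D_ne[OF vv] ov by (auto simp: a_def S_def)
    ultimately show False by simp
  qed
  \<comment> \<open>Since \<open>S\<close> is empty, all arcs leaving vertices outside
    \<open>N\<close> carry zero. In \<open>N\<close> values may still be -1 or 0 when
    \<open>k v = -1\<close>, so the first rotor is followed: it avoids \<open>D v\<close> and
    carries exactly \<open>k v\<close>.\<close>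
  define N where "N = {v \<in> verts G - {r}. k v < 0}"
  have k0: "k v = 0 \<and> D v = {}" if "v \<in> verts G" "v \<notin> N" for v
    using notS[OF that(1)] S_empty that kr unfolding N_def by (cases "v = r") auto
  have N_empty: "N = {}"
  proof (rule ccontr)
    assume "N \<noteq> {}"
    then obtain v where v: "v \<in> N" "head G (\<rho>\<^sub>1 v) \<notin> N"
      using lead(1) unfolding leads_to_root_def N_def by (metis (no_types, lifting) mem_Collect_eq subsetI)
    then have vv: "v \<in> verts G - {r}" by (simp add: N_def)
    then have ov: "\<rho>\<^sub>1 v \<in> arcs G" "tail G (\<rho>\<^sub>1 v) = v" using conf unfolding rotor_conf_def by auto
    have "- a (\<rho>\<^sub>1 v) = 0"
    proof (rule circulation_no_escape[where S=N])
      show "excess (\<lambda>e. - a e) u = 0" if "u \<in> verts G" for u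
        using circ[OF that] by (simp add: excess_def sum_negf)
      show "N \<subseteq> verts G" by (auto simp: N_def)
      show "0 \<le> - a e" if "tail G e \<in> N" for e using that by (auto simp: a_def N_def)
      show "- a e \<le> 0" if "e \<in> arcs G" "tail G e \<notin> N" for e
        using k0[OF _ that(2)] that(1) by (auto simp: a_def)
    qed (use ov v in auto)
    moreover have "\<rho>\<^sub>1 v \<notin> D v" using D_eq[OF vv] D_ne[OF vv] by blast
    then have "a (\<rho>\<^sub>1 v) < 0" using v(1) ov by (auto simp: a_def N_def)
    ultimately show False by simp
  qed
  show ?thesis using k0[of v] D_ne[OF v] N_empty v by auto
qed

section \<open>Routing sequences as arc flows\<close>

lemma excess_single:
  assumes "e \<in> arcs G"
  shows "excess (\<lambda>e'. of_bool (e' = e) :: int) u = of_bool (u = head G e) - of_bool (u = tail G e)"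
proof -
  have s: "(\<Sum>e'\<in>A. of_bool (e' = e) :: int) = of_bool (e \<in> A)" if "finite A" for A
    using that by (auto simp: of_bool_def)
  show ?thesis unfolding excess_def using assms by (subst (1 2) s) auto
qed

text \<open>State after \<open>k\<close> routings: \<open>g v\<close> counts the full rounds of the
  rotor at \<open>v\<close>, and \<open>swing\<close> the last, partial one, so their sum is the
  number of uses of an arc. The last clause puts a chip on every set closed under the rotors; once
  all chips off the root are gone, it becomes \<open>leads_to_root\<close>.\<close>

definition flow_inv :: "('a \<Rightarrow> int) \<Rightarrow> ('a \<Rightarrow> 'b) \<Rightarrow> nat \<Rightarrow> ('a \<Rightarrow> int) \<Rightarrow> ('a \<Rightarrow> 'b) \<Rightarrow> ('a \<Rightarrow> int) \<Rightarrow> bool" where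
  "flow_inv x\<^sub>0 \<rho>\<^sub>0 k x \<rho> g \<longleftrightarrow> rotor_conf \<rho> \<and> g r = 0 \<and>
      (\<forall>u\<in>verts G. x u = x\<^sub>0 u + excess (\<lambda>e. g (tail G e) + swing \<rho>\<^sub>0 \<rho> e) u) \<and>
      (\<Sum>e\<in>arcs G. g (tail G e) + swing \<rho>\<^sub>0 \<rho> e) = int k \<and>
      (\<forall>u. u \<notin> verts G \<longrightarrow> x u = x\<^sub>0 u) \<and> (\<forall>v\<in>verts G - {r}. x v \<ge> 0) \<and> x r \<ge> x\<^sub>0 r \<and>
      (\<forall>S. S \<subseteq> verts G - {r} \<longrightarrow> S \<noteq> {} \<longrightarrow> (\<forall>v\<in>S. head G (\<rho> v) \<in> S) \<longrightarrow> (\<exists>v\<in>S. x v > 0))"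

lemma flow_invD:
  assumes "flow_inv x\<^sub>0 \<rho>\<^sub>0 k x \<rho> g"
  shows "rotor_conf \<rho>" "g r = 0"
    "\<And>u. u \<in> verts G \<Longrightarrow> x u = x\<^sub>0 u + excess (\<lambda>e. g (tail G e) + swing \<rho>\<^sub>0 \<rho> e) u"
    "(\<Sum>e\<in>arcs G. g (tail G e) + swing \<rho>\<^sub>0 \<rho> e) = int k"
    "\<And>u. u \<notin> verts G \<Longrightarrow> x u = x\<^sub>0 u"
    "\<And>v. v \<in> verts G - {r} \<Longrightarrow> x v \<ge> 0" "x r \<ge> x\<^sub>0 r"
    "\<And>S. S \<subseteq> verts G - {r} \<Longrightarrow> S \<noteq> {} \<Longrightarrow> (\<forall>v\<in>S. head G (\<rho> v) \<in> S) \<Longrightarrow> (\<exists>v\<in>S. x v > 0)"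
proof -
  note c1 = assms[unfolded flow_inv_def]
  note c2 = conjunct2[OF c1] note c3 = conjunct2[OF c2] note c4 = conjunct2[OF c3]
  note c5 = conjunct2[OF c4] note c6 = conjunct2[OF c5] note c7 = conjunct2[OF c6]
  show "rotor_conf \<rho>" using c1 by (rule conjunct1)
  show "g r = 0" using c2 by (rule conjunct1)
  show "\<And>u. u \<in> verts G \<Longrightarrow> x u = x\<^sub>0 u + excess (\<lambda>e. g (tail G e) + swing \<rho>\<^sub>0 \<rho> e) u"
    by (rule bspec[OF conjunct1[OF c3]])
  show "(\<Sum>e\<in>arcs G. g (tail G e) + swing \<rho>\<^sub>0 \<rho> e) = int k" using c4 by (rule conjunct1)
  show "\<And>u. u \<notin> verts G \<Longrightarrow> x u = x\<^sub>0 u" by (rule conjunct1[OF c5, rule_format])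
  show "\<And>v. v \<in> verts G - {r} \<Longrightarrow> x v \<ge> 0" by (rule bspec[OF conjunct1[OF c6]])
  show "x r \<ge> x\<^sub>0 r" using c7 by (rule conjunct1)
  show "\<And>S. S \<subseteq> verts G - {r} \<Longrightarrow> S \<noteq> {} \<Longrightarrow> \<forall>v\<in>S. head G (\<rho> v) \<in> S \<Longrightarrow> \<exists>v\<in>S. x v > 0"
    using conjunct2[OF c7] by (elim allE impE)
qed

lemma routing_flow:
  assumes conf: "rotor_conf \<rho>\<^sub>0" and x0: "\<And>v. v \<in> verts G - {r} \<Longrightarrow> x\<^sub>0 v \<ge> 0"
    and lead: "leads_to_root \<rho>\<^sub>0"
  shows "(legal_routing_off G nxt r ^^ k) (x\<^sub>0, \<rho>\<^sub>0) (x, \<rho>) \<Longrightarrow> \<exists>g. flow_inv x\<^sub>0 \<rho>\<^sub>0 k x \<rho> g"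
proof (induction k arbitrary: x \<rho>)
  case 0
  then have "x = x\<^sub>0" "\<rho> = \<rho>\<^sub>0" by auto
  moreover have "\<exists>v\<in>S. 0 < x\<^sub>0 v" if "S \<subseteq> verts G - {r}" "S \<noteq> {}" "\<forall>v\<in>S. head G (\<rho>\<^sub>0 v) \<in> S" for S
    using lead that unfolding leads_to_root_def by blast
  ultimately show ?case using conf x0 unfolding flow_inv_def
    by (intro exI[of _ "\<lambda>_. 0"]) (simp add: swing_self excess_def)
next
  case (Suc k)
  obtain x' \<rho>' where run: "(legal_routing_off G nxt r ^^ k) (x\<^sub>0, \<rho>\<^sub>0) (x', \<rho>')"
    and leg: "legal_routing_off G nxt r (x', \<rho>') (x, \<rho>)" using Suc.prems by auto
  obtain g where inv: "flow_inv x\<^sub>0 \<rho>\<^sub>0 k x' \<rho>' g" using Suc.IH[OF run] by blast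
  note conf' = flow_invD(1)[OF inv] and gr = flow_invD(2)[OF inv] and flow = flow_invD(3)[OF inv]
    and tot = flow_invD(4)[OF inv] and outside = flow_invD(5)[OF inv]
    and nonneg = flow_invD(6)[OF inv] and xr = flow_invD(7)[OF inv] and cyc = flow_invD(8)[OF inv]
  obtain v where v: "v \<in> verts G - {r}" "x' v > 0" "(x, \<rho>) = route G nxt v (x', \<rho>')"
    using leg by (auto simp: legal_routing_off_def)
  let ?e = "nxt (\<rho>' v)"
  have x: "x u = x' u - of_bool (u = v) + of_bool (u = head G ?e)" for u
    using v(3) by (auto simp: route_def)
  have \<rho>: "\<rho> = \<rho>'(v := ?e)" using v(3) by (auto simp: route_def)
  have o: "\<rho>\<^sub>0 v \<in> out_arcs G v" "\<rho>' v \<in> out_arcs G v"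
    using conf conf' v(1) unfolding rotor_conf_def by blast+
  then have eo: "?e \<in> out_arcs G v" by (intro nxt_out)
  then have earc: "?e \<in> arcs G" "tail G ?e = v" by auto
  have hv: "head G ?e \<noteq> v" using no_loop[of ?e] earc by auto
  \<comment> \<open>A full round is completed when the rotor is back at its initial arc.\<close>
  define g' where "g' = g(v := g v + of_bool (?e = \<rho>\<^sub>0 v))"
  have step: "g' (tail G e) + swing \<rho>\<^sub>0 \<rho> e = (g (tail G e) + swing \<rho>\<^sub>0 \<rho>' e) + of_bool (e = ?e)"
    if e: "e \<in> arcs G" for e
  proof (cases "tail G e = v")
    case True
    then have "e \<in> out_arcs G v" using e by simp
    from turn_step[OF cyclic_out[OF eo] o this] show ?thesis
      using True v(1) by (simp add: g'_def swing_def \<rho>)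
  next
    case False
    then show ?thesis using earc by (auto simp: g'_def swing_def \<rho>)
  qed
  show ?case
    unfolding flow_inv_def
  proof (intro exI[of _ g'] conjI)
    show "rotor_conf \<rho>" using conf' eo by (simp add: rotor_conf_def \<rho>)
    show "g' r = 0" using gr v(1) by (auto simp: g'_def)
    show "\<forall>u\<in>verts G. x u = x\<^sub>0 u + excess (\<lambda>e. g' (tail G e) + swing \<rho>\<^sub>0 \<rho> e) u"
    proof
      fix u assume u: "u \<in> verts G"
      have "excess (\<lambda>e. g' (tail G e) + swing \<rho>\<^sub>0 \<rho> e) u =
          excess (\<lambda>e. (g (tail G e) + swing \<rho>\<^sub>0 \<rho>' e) + of_bool (e = ?e)) u"
        unfolding excess_def using step by (intro arg_cong2[where f="(-)"] sum.cong) auto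
      also have "\<dots> = excess (\<lambda>e. g (tail G e) + swing \<rho>\<^sub>0 \<rho>' e) u + (of_bool (u = head G ?e) - of_bool (u = v))"
        by (subst excess_add) (simp add: excess_single[OF earc(1)] earc(2))
      finally show "x u = x\<^sub>0 u + excess (\<lambda>e. g' (tail G e) + swing \<rho>\<^sub>0 \<rho> e) u"
        using flow[OF u] x[of u] by simp
    qed
    have "(\<Sum>e\<in>arcs G. g' (tail G e) + swing \<rho>\<^sub>0 \<rho> e) =
        (\<Sum>e\<in>arcs G. (g (tail G e) + swing \<rho>\<^sub>0 \<rho>' e) + of_bool (e = ?e))"
      using step by (rule sum.cong[OF refl])
    also have "\<dots> = int k + 1"
      using tot earc by (simp add: sum.distrib of_bool_def)
    finally show "(\<Sum>e\<in>arcs G. g' (tail G e) + swing \<rho>\<^sub>0 \<rho> e) = int (Suc k)" by simp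
    show "\<forall>u. u \<notin> verts G \<longrightarrow> x u = x\<^sub>0 u"
      using outside x v(1) earc(1) by auto
    show "\<forall>v\<in>verts G - {r}. 0 \<le> x v"
      using nonneg v(2) by (auto simp: x of_bool_def)
    show "x\<^sub>0 r \<le> x r" using xr v(1) by (auto simp: x)
    show "\<forall>S. S \<subseteq> verts G - {r} \<longrightarrow> S \<noteq> {} \<longrightarrow> (\<forall>v\<in>S. head G (\<rho> v) \<in> S) \<longrightarrow> (\<exists>v\<in>S. x v > 0)"
    proof (intro allI impI)
      fix S assume S: "S \<subseteq> verts G - {r}" "S \<noteq> {}" "\<forall>v\<in>S. head G (\<rho> v) \<in> S"
      show "\<exists>v\<in>S. x v > 0"
      \<comment> \<open>If \<open>v\<close> lies in \<open>S\<close>, the chip just moved has landed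
        in \<open>S\<close>. Otherwise the rotors on \<open>S\<close> are unchanged, and the chip
        present before is still there, since \<open>S\<close> loses nothing.\<close>
      proof (cases "v \<in> S")
        case True
        then have h: "head G ?e \<in> S" using S(3) by (auto simp: \<rho>)
        then have "x (head G ?e) > 0" using nonneg[of "head G ?e"] S(1) hv by (auto simp: x)
        then show ?thesis using h by blast
      next
        case False
        have "\<exists>u\<in>S. x' u > 0"
        proof (rule cyc[OF S(1,2)], rule ballI)
          fix u assume "u \<in> S"
          then show "head G (\<rho>' u) \<in> S" using S(3) False by (auto simp: \<rho> split: if_splits)
        qed
        then obtain u where u: "u \<in> S" "x' u > 0" by blast
        then have "x u > 0" using False by (auto simp: x)
        then show ?thesis using u by blast
      qed
    qed
  qed
qed

lemma outcome_flow:
  assumes T: "T \<in> Arb G r" and out: "rotor_router_outcome G nxt r x T T'"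
  obtains \<rho> g where "rotor_conf \<rho>" "leads_to_root \<rho>" "T' = \<rho> ` (verts G - {r})"
    "\<forall>u\<in>verts G. x u + lap g u + excess (swing (tree_rotor G r T e) \<rho>) u = 0"
proof -
  obtain x' e' \<rho> where le: "lin_equiv G x x'" and nn: "\<forall>v \<in> verts G - {r}. x' v \<ge> 0"
    and run: "(legal_routing_off G nxt r)\<^sup>*\<^sup>* (x', tree_rotor G r T e') (\<lambda>_. 0, \<rho>)"
    and T': "T' = \<rho> ` (verts G - {r})"
    using out by (auto simp: rotor_router_outcome_def)
  obtain f where f: "\<And>u. u \<in> verts G \<Longrightarrow> x' u = x u + lap f u" using le by (auto simp: lin_equiv_iff)
  obtain k where k: "(legal_routing_off G nxt r ^^ k) (x', tree_rotor G r T e') (\<lambda>_. 0, \<rho>)"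
    using run by (auto simp: rtranclp_power)
  obtain g where inv: "flow_inv x' (tree_rotor G r T e') k (\<lambda>_. 0) \<rho> g"
    using routing_flow[OF Arb_rotor(1)[OF T] bspec[OF nn] Arb_rotor(2)[OF T] k] by blast
  note g = flow_invD(1,3)[OF inv]
  have sw: "swing (tree_rotor G r T e') \<rho> = swing (tree_rotor G r T e) \<rho>"
    by (auto simp: fun_eq_iff swing_def tree_rotor_def)
  \<comment> \<open>No chips are left, so no set off the root can be closed under the final
    rotors.\<close>
  have "leads_to_root \<rho>" unfolding leads_to_root_def using flow_invD(8)[OF inv] by (metis less_irrefl)
  moreover have "\<forall>u\<in>verts G. x u + lap (\<lambda>v. f v + g v) u + excess (swing (tree_rotor G r T e) \<rho>) u = 0"
  proof
    fix u assume u: "u \<in> verts G"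
    show "x u + lap (\<lambda>v. f v + g v) u + excess (swing (tree_rotor G r T e) \<rho>) u = 0"
      using g(2)[OF u] f[OF u] unfolding excess_add excess_tail lap_add sw by simp
  qed
  ultimately show ?thesis using g(1) T' by (intro that)
qed

text \<open>A multiple of the negated truncated life time, rounded: by \<open>lap_wt\<close> and
  \<open>surv_half\<close> its Laplacian off the root is at least half the degree times the
  multiple.\<close>

lemma nonneg_representative:
  obtains f :: "'a \<Rightarrow> int" where "\<And>v. v \<in> verts G - {r} \<Longrightarrow> lap f v \<ge> N"
proof -
  \<comment> \<open>Half of \<open>K\<close> is the absolute value of \<open>N\<close> plus 1; the
    extra 1 per out-arc pays for the rounding of \<open>f v\<close>, while rounding at the
    in-neighbours only helps.\<close>
  define K where "K = 2 * \<bar>real_of_int N\<bar> + 2"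
  let ?t = "2 * hit + 1"
  define f where "f v = - \<lfloor>K * wt ?t v\<rfloor>" for v
  have "lap f v \<ge> N" if v: "v \<in> verts G - {r}" for v
  proof -
    let ?d = "real (out_degree G v)"
    have d: "?d \<ge> 1" using out_degree_pos[OF v] by simp
    have vv: "v \<in> verts G" using v by simp
    have "?d * (1 / 2) \<le> ?d * (1 - surv ?t v)"
      using surv_half[OF vv] by (intro mult_left_mono) auto
    then have w: "?d / 2 \<le> - lap (wt ?t) v" unfolding lap_wt[OF v] by simp
    have "K / 2 - 1 = \<bar>real_of_int N\<bar>" by (simp add: K_def add_divide_distrib)
    then have "real_of_int N \<le> (K / 2 - 1) * 1" by simp
    also have "\<dots> \<le> (K / 2 - 1) * ?d" using d by (intro mult_left_mono) (auto simp: K_def)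
    also have "\<dots> = K * (?d / 2) - ?d" by (simp add: algebra_simps)
    also have "\<dots> \<le> K * - lap (wt ?t) v - ?d"
      using w by (intro diff_right_mono mult_left_mono) (auto simp: K_def)
    also have "\<dots> = (\<Sum>e\<in>in_arcs G v. - (K * wt ?t (tail G e))) - ?d * (1 - K * wt ?t v)"
      by (simp add: lap_def sum_distrib_left sum_negf algebra_simps)
    also have "\<dots> \<le> (\<Sum>e\<in>in_arcs G v. real_of_int (f (tail G e))) - ?d * real_of_int (f v)"
    proof (intro diff_mono sum_mono mult_left_mono)
      fix e
      show "- (K * wt ?t (tail G e)) \<le> real_of_int (f (tail G e))" unfolding f_def by linarith
      show "real_of_int (f v) \<le> 1 - K * wt ?t v" unfolding f_def by linarith
    qed simp
    also have "\<dots> = real_of_int (lap f v)" by (simp add: lap_def)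
    finally show ?thesis by simp
  qed
  then show ?thesis by (rule that)
qed

text \<open>Legal play stops because the number of routings equals the total flow. The chips off the
  root are bounded throughout, so \<open>g\<close> solves a Laplacian system with bounded right-hand
  side and is bounded by \<open>fixed_bound\<close>.\<close>

lemma outcome_exists:
  assumes T: "T \<in> Arb G r" and x: "x \<in> divisors0 G"
  shows "\<exists>T'. rotor_router_outcome G nxt r x T T'"
proof -
  define X where "X = (\<Sum>v\<in>verts G. \<bar>x v\<bar>)"
  obtain f where f: "\<And>v. v \<in> verts G - {r} \<Longrightarrow> lap f v \<ge> X" using nonneg_representative[of X] by blast
  define x' where "x' u = (if u \<in> verts G then x u + lap f u else 0)" for u
  have nn: "x' v \<ge> 0" if v: "v \<in> verts G - {r}" for v
  proof -
    have "\<bar>x v\<bar> \<le> X" unfolding X_def using v by (intro member_le_sum) auto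
    then show ?thesis using f[OF v] v by (simp add: x'_def)
  qed
  have sum0: "(\<Sum>v\<in>verts G. x' v) = 0"
    using x by (simp add: x'_def divisors0_def sum.distrib sum_lap)
  obtain e where e: "out_arcs G r \<noteq> {} \<longrightarrow> e \<in> out_arcs G r" by blast
  let ?\<rho> = "tree_rotor G r T e"
  note flow = routing_flow[OF Arb_rotor(1)[OF T, of e] nn Arb_rotor(2)[OF T]]
  define m where "m = card (arcs G)"
  \<comment> \<open>The three terms bound the current chips off the root, the initial chips, and the
    excess of the partial turns.\<close>
  define C where "C = real_of_int \<bar>x' r\<bar> + real_of_int (\<Sum>v\<in>verts G. \<bar>x' v\<bar>) + 2 * real m"
  have bound: "real k \<le> real m * (2 * real hit * C + 1)" and
    fin: "x v \<le> - x' r" if run: "(legal_routing_off G nxt r ^^ k) (x', ?\<rho>) (x, \<rho>)" and v: "v \<in> verts G - {r}"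
    for k x \<rho> v
  proof -
    obtain g where inv: "flow_inv x' ?\<rho> k x \<rho> g" using flow[OF _ run] by blast
    note gr = flow_invD(2)[OF inv] and fl = flow_invD(3)[OF inv] and tot = flow_invD(4)[OF inv]
      and nn' = flow_invD(6)[OF inv] and xr = flow_invD(7)[OF inv]
    have "(\<Sum>u\<in>verts G. x u) = (\<Sum>u\<in>verts G. x' u + excess (\<lambda>e. g (tail G e) + swing ?\<rho> \<rho> e) u)"
      by (rule sum.cong) (use fl in auto)
    then have s0: "(\<Sum>u\<in>verts G. x u) = 0" using sum0 by (simp add: sum.distrib sum_excess)
    \<comment> \<open>The total is zero and the root only gains chips, so the nonnegative chips off
      the root sum to at most \<open>- x' r\<close>.\<close>
    have xle: "x u \<le> - x' r" if u: "u \<in> verts G - {r}" for u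
    proof -
      have "x u \<le> (\<Sum>v\<in>verts G - {r}. x v)" using nn' u by (intro member_le_sum) auto
      also have "\<dots> = - x r" using s0 root by (simp add: sum_diff1)
      finally show ?thesis using xr by simp
    qed
    show "x v \<le> - x' r" by (rule xle[OF v])
    have gb: "\<bar>real_of_int (g u)\<bar> \<le> 2 * real hit * C" if u: "u \<in> verts G" for u
    proof (rule fixed_bound[OF _ _ _ u])
      show "real_of_int (g r) = 0" using gr by simp
      show "0 \<le> C" by (auto simp: C_def intro!: add_nonneg_nonneg sum_nonneg)
      fix v assume v: "v \<in> verts G - {r}"
      let ?d = "real (out_degree G v)"
      have d: "?d \<ge> 1" using out_degree_pos[OF v] by simp
      define q where "q = real_of_int (x' v - x v + excess (swing ?\<rho> \<rho>) v)"
      have exb: "\<bar>excess (swing ?\<rho> \<rho>) v\<bar> \<le> 2 * int m"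
      proof -
        have b: "\<bar>\<Sum>e\<in>A. swing ?\<rho> \<rho> e\<bar> \<le> int m" if A: "A \<subseteq> arcs G" for A
        proof -
          have "\<bar>\<Sum>e\<in>A. swing ?\<rho> \<rho> e\<bar> \<le> (\<Sum>e\<in>A. \<bar>swing ?\<rho> \<rho> e\<bar>)" by (rule sum_abs)
          also have "\<dots> \<le> (\<Sum>e\<in>A. 1)" by (rule sum_mono) (simp add: swing_def)
          also have "\<dots> \<le> int m" unfolding m_def using card_mono[OF finite_arcs A] by simp
          finally show ?thesis .
        qed
        have "\<bar>\<Sum>e\<in>in_arcs G v. swing ?\<rho> \<rho> e\<bar> \<le> int m" "\<bar>\<Sum>e\<in>out_arcs G v. swing ?\<rho> \<rho> e\<bar> \<le> int m"
          by (intro b; auto)+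
        then show ?thesis unfolding excess_def by linarith
      qed
      have "\<bar>x' v\<bar> \<le> (\<Sum>v\<in>verts G. \<bar>x' v\<bar>)" using v by (intro member_le_sum) auto
      then have "\<bar>x' v - x v + excess (swing ?\<rho> \<rho>) v\<bar> \<le> \<bar>x' r\<bar> + (\<Sum>v\<in>verts G. \<bar>x' v\<bar>) + 2 * int m"
        using exb xle[OF v] nn'[OF v] by linarith
      then have "real_of_int \<bar>x' v - x v + excess (swing ?\<rho> \<rho>) v\<bar> \<le>
          real_of_int (\<bar>x' r\<bar> + (\<Sum>v\<in>verts G. \<bar>x' v\<bar>) + 2 * int m)"
        by (simp only: of_int_le_iff)
      then have q: "\<bar>q\<bar> \<le> C" by (simp add: q_def C_def)
      have "lap g v = - (x' v - x v + excess (swing ?\<rho> \<rho>) v)"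
        using fl[of v] v by (simp add: excess_add excess_tail)
      then have "real_of_int (lap g v) = - q" by (simp add: q_def)
      then have eq: "?d * real_of_int (g v) = (\<Sum>e\<in>in_arcs G v. real_of_int (g (tail G e))) + q"
        by (simp add: lap_def algebra_simps)
      have "?d * \<bar>real_of_int (g v)\<bar> = \<bar>(\<Sum>e\<in>in_arcs G v. real_of_int (g (tail G e))) + q\<bar>"
        unfolding eq[symmetric] by (simp add: abs_mult)
      also have "\<dots> \<le> (\<Sum>e\<in>in_arcs G v. \<bar>real_of_int (g (tail G e))\<bar>) + \<bar>q\<bar>"
        by (rule order_trans[OF abs_triangle_ineq]) (simp add: sum_abs)
      also have "\<dots> \<le> (\<Sum>e\<in>in_arcs G v. \<bar>real_of_int (g (tail G e))\<bar>) + C" using q by simp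
      also have "\<dots> \<le> (\<Sum>e\<in>in_arcs G v. \<bar>real_of_int (g (tail G e))\<bar>) + ?d * C"
        using d mult_right_mono[OF d, of C] q by simp
      finally show "\<bar>real_of_int (g v)\<bar> \<le> avg (\<lambda>u. \<bar>real_of_int (g u)\<bar>) v + C"
        using d by (simp add: avg_def field_simps)
    qed
    have "real k = real_of_int (\<Sum>e\<in>arcs G. g (tail G e) + swing ?\<rho> \<rho> e)" by (simp only: tot of_int_of_nat_eq)
    also have "\<dots> = (\<Sum>e\<in>arcs G. real_of_int (g (tail G e)) + real_of_int (swing ?\<rho> \<rho> e))" by simp
    also have "\<dots> \<le> (\<Sum>e\<in>arcs G. 2 * real hit * C + 1)"
    proof (intro sum_mono add_mono)
      fix e assume "e \<in> arcs G"
      then show "real_of_int (g (tail G e)) \<le> 2 * real hit * C" using gb[of "tail G e"] by simp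
      show "real_of_int (swing ?\<rho> \<rho> e) \<le> 1" by (simp add: swing_def)
    qed
    finally show "real k \<le> real m * (2 * real hit * C + 1)" by (simp add: m_def)
  qed
  have run0: "\<exists>k x \<rho>. (legal_routing_off G nxt r ^^ k) (x', ?\<rho>) (x, \<rho>) \<and> (\<forall>v\<in>verts G - {r}. x v \<le> 0)"
  proof (rule ccontr)
    assume no: "\<not> ?thesis"
    have "\<exists>x \<rho>. (legal_routing_off G nxt r ^^ k) (x', ?\<rho>) (x, \<rho>)" for k
    proof (induction k)
      case (Suc k)
      then obtain x \<rho> where run: "(legal_routing_off G nxt r ^^ k) (x', ?\<rho>) (x, \<rho>)" by blast
      then obtain v where v: "v \<in> verts G - {r}" "x v > 0" using no by force
      obtain y \<sigma> where "route G nxt v (x, \<rho>) = (y, \<sigma>)" by fastforce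
      then have "legal_routing_off G nxt r (x, \<rho>) (y, \<sigma>)"
        using v by (force simp: legal_routing_off_def)
      then show ?case using run by auto
    qed auto
    \<comment> \<open>\<open>bound\<close> is stated relative to a vertex other than the root; if
      there were none, the initial state would already be final.\<close>
    moreover obtain v where v: "v \<in> verts G - {r}"
    proof -
      have "(legal_routing_off G nxt r ^^ 0) (x', ?\<rho>) (x', ?\<rho>)" by simp
      then show ?thesis using no that by blast
    qed
    moreover obtain k :: nat where "real k > real m * (2 * real hit * C + 1)" using reals_Archimedean2 by blast
    ultimately show False using bound by (metis not_le)
  qed
  then obtain k y \<rho> where run: "(legal_routing_off G nxt r ^^ k) (x', ?\<rho>) (y, \<rho>)"
    and le: "\<And>v. v \<in> verts G - {r} \<Longrightarrow> y v \<le> 0" by blast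
  obtain g where inv: "flow_inv x' ?\<rho> k y \<rho> g" using flow[OF _ run] by blast
  note fl = flow_invD(3)[OF inv] and outside = flow_invD(5)[OF inv] and nn' = flow_invD(6)[OF inv]
  have z: "y v = 0" if "v \<in> verts G - {r}" for v using le[OF that] nn'[OF that] by simp
  have "(\<Sum>u\<in>verts G. y u) = (\<Sum>u\<in>verts G. x' u + excess (\<lambda>e. g (tail G e) + swing ?\<rho> \<rho> e) u)"
    by (rule sum.cong) (use fl in auto)
  then have "(\<Sum>u\<in>verts G. y u) = 0" using sum0 by (simp add: sum.distrib sum_excess)
  moreover have "(\<Sum>u\<in>verts G. y u) = y r" using z root by (simp add: sum.remove)
  ultimately have "y u = 0" for u
    using z outside by (cases "u \<in> verts G"; cases "u = r") (auto simp: x'_def)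
  then have "y = (\<lambda>_. 0)" by blast
  then have "(legal_routing_off G nxt r)\<^sup>*\<^sup>* (x', ?\<rho>) (\<lambda>_. 0, \<rho>)"
    using run by (auto simp: rtranclp_power)
  moreover have "lin_equiv G x x'" unfolding lin_equiv_iff by (rule exI[of _ f]) (simp add: x'_def)
  moreover have "x' \<in> divisors G" by (simp add: divisors_def x'_def)
  ultimately show ?thesis unfolding rotor_router_outcome_def using nn e by blast
qed

text \<open>Existence and uniqueness of the outcome turn the definite description into an actual
  outcome, whose rotors satisfy the flow equation. If they are those of \<open>T\<^sub>2\<close>,
  that equation is the claimed solution after normalisation at \<open>r\<close>; conversely a
  solution makes the rotors of \<open>T\<^sub>2\<close> a second solution of the flow equation, and
  \<open>leads_to_root_unique\<close> identifies the two.\<close>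

theorem rotor_router_action_eq_iff:
  assumes T1: "T\<^sub>1 \<in> Arb G r" and T2: "T\<^sub>2 \<in> Arb G r" and x: "x \<in> divisors0 G"
  shows "rotor_router_action G nxt r x T\<^sub>1 = T\<^sub>2 \<longleftrightarrow>
    (\<exists>g. g r = 0 \<and> (\<forall>u\<in>verts G. x u + excess (swing (tree_rotor G r T\<^sub>1 e) (tree_rotor G r T\<^sub>2 e)) u + lap g u = 0))"
proof -
  let ?\<rho>1 = "tree_rotor G r T\<^sub>1 e" and ?\<rho>2 = "tree_rotor G r T\<^sub>2 e"
  obtain T where T: "rotor_router_outcome G nxt r x T\<^sub>1 T" using outcome_exists[OF T1 x] by blast
  have uniq: "T' = T''" if o: "rotor_router_outcome G nxt r x T\<^sub>1 T'" "rotor_router_outcome G nxt r x T\<^sub>1 T''" for T' T''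
  proof -
    obtain \<rho> g where 1: "rotor_conf \<rho>" "leads_to_root \<rho>" "T' = \<rho> ` (verts G - {r})"
      "\<forall>u\<in>verts G. x u + lap g u + excess (swing ?\<rho>1 \<rho>) u = 0"
      using outcome_flow[OF T1 o(1), where e=e] by blast
    obtain \<rho>' g' where 2: "rotor_conf \<rho>'" "leads_to_root \<rho>'" "T'' = \<rho>' ` (verts G - {r})"
      "\<forall>u\<in>verts G. x u + lap g' u + excess (swing ?\<rho>1 \<rho>') u = 0"
      using outcome_flow[OF T1 o(2), where e=e] by blast
    have "\<rho> v = \<rho>' v" if "v \<in> verts G - {r}" for v
      by (rule leads_to_root_unique[OF Arb_rotor(1)[OF T1] 1(1) 2(1) 1(2) 2(2) bspec[OF 1(4)] bspec[OF 2(4)] that])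
    then show ?thesis unfolding 1(3) 2(3) by (intro image_cong) auto
  qed
  have act: "rotor_router_action G nxt r x T\<^sub>1 = T"
    unfolding rotor_router_action_def using T uniq by (intro the_equality) auto
  obtain \<rho> g where \<rho>: "rotor_conf \<rho>" "leads_to_root \<rho>" "T = \<rho> ` (verts G - {r})"
    "\<forall>u\<in>verts G. x u + lap g u + excess (swing ?\<rho>1 \<rho>) u = 0"
    using outcome_flow[OF T1 T, where e=e] by blast
  show ?thesis
  proof
    assume "rotor_router_action G nxt r x T\<^sub>1 = T\<^sub>2"
    then have TT: "\<rho> ` (verts G - {r}) = T\<^sub>2" using act \<rho>(3) by simp
    have "\<rho> v = ?\<rho>2 v" if v: "v \<in> verts G - {r}" for v
    proof -
      have "\<rho> v \<in> T\<^sub>2" using TT v by blast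
      moreover have "tail G (\<rho> v) = v" using \<rho>(1) v unfolding rotor_conf_def by auto
      ultimately show ?thesis using Arb_rotor(4)[OF T2 v] by blast
    qed
    then have sw: "swing ?\<rho>1 \<rho> a = swing ?\<rho>1 ?\<rho>2 a" if "a \<in> arcs G" for a
      using that by (auto simp: swing_def)
    have ex: "excess (swing ?\<rho>1 \<rho>) u = excess (swing ?\<rho>1 ?\<rho>2) u" for u
      unfolding excess_def using sw by (intro arg_cong2[where f="(-)"] sum.cong) auto
    show "\<exists>g. g r = 0 \<and> (\<forall>u\<in>verts G. x u + excess (swing ?\<rho>1 ?\<rho>2) u + lap g u = 0)"
    proof (intro exI[of _ "\<lambda>v. g v + - g r"] conjI ballI)
      fix u assume u: "u \<in> verts G"
      show "x u + excess (swing ?\<rho>1 ?\<rho>2) u + lap (\<lambda>v. g v + - g r) u = 0"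
        using bspec[OF \<rho>(4) u] ex[of u] lap_add_const[OF u, of g "- g r"] by simp
    qed simp
  next
    assume "\<exists>g. g r = 0 \<and> (\<forall>u\<in>verts G. x u + excess (swing ?\<rho>1 ?\<rho>2) u + lap g u = 0)"
    then obtain g' where g': "\<And>u. u \<in> verts G \<Longrightarrow> x u + lap g' u + excess (swing ?\<rho>1 ?\<rho>2) u = 0"
      by (auto simp: algebra_simps)
    have "\<rho> v = ?\<rho>2 v" if "v \<in> verts G - {r}" for v
      by (rule leads_to_root_unique[OF Arb_rotor(1)[OF T1] \<rho>(1) Arb_rotor(1)[OF T2] \<rho>(2) Arb_rotor(2)[OF T2] bspec[OF \<rho>(4)] g' that])
    then have "T = ?\<rho>2 ` (verts G - {r})" unfolding \<rho>(3) by (intro image_cong) auto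
    then show "rotor_router_action G nxt r x T\<^sub>1 = T\<^sub>2" using act Arb_rotor(3)[OF T2, of e] by simp
  qed
qed

end

section \<open>Solving the Laplacian system by rounded Jacobi iteration\<close>

context rooted_eulerian_digraph
begin

text \<open>The fixed point equation is that of \<open>M\<close> times a solution of
  \<open>y + lap g = 0\<close>, solved for the diagonal term, with the quotient rounded
  down.\<close>

primrec sweep :: "int \<Rightarrow> ('v \<Rightarrow> int) \<Rightarrow> nat \<Rightarrow> 'v \<Rightarrow> int" where
  "sweep M y 0 = (\<lambda>_. 0)"
| "sweep M y (Suc t) = (\<lambda>v. if v \<in> verts G - {r}
     then (M * y v + (\<Sum>e\<in>in_arcs G v. sweep M y t (tail G e))) div int (out_degree G v) else 0)"

lemma sweep_root: "sweep M y t r = 0"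
  by (cases t) auto

lemma div_bounds:
  assumes "d \<ge> 1"
  shows "real_of_int a / real d - 1 \<le> real_of_int (a div int d)"
    and "real_of_int (a div int d) \<le> real_of_int a / real d"
  using assms floor_divide_of_int_eq[of a "int d", where ?'a=real] by linarith+

text \<open>Independent of \<open>t\<close>, whether or not the system has a solution: this keeps
  the word length polynomial during the iteration. The added 1 is the rounding error per
  sweep.\<close>

lemma sweep_bound:
  assumes M: "M \<ge> 0" and S: "\<And>v. v \<in> verts G \<Longrightarrow> \<bar>y v\<bar> \<le> S" and v: "v \<in> verts G"
  shows "\<bar>sweep M y t v\<bar> \<le> int hit * (M * S + 1)"
proof -
  have S0: "S \<ge> 0" using S[OF root] by simp
  define c where "c = real_of_int (M * S + 1)"
  have "\<bar>real_of_int (sweep M y t v)\<bar> \<le> 0 * surv t v + c * wt t v"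
  proof (rule averaging_bound[OF _ _ _ v])
    show "real_of_int (sweep M y t r) = 0" for t by (simp add: sweep_root)
    fix t v assume v: "v \<in> verts G - {r}"
    have d: "out_degree G v \<ge> 1" using out_degree_pos[OF v] by simp
    let ?d = "real (out_degree G v)"
    define s where "s = (\<Sum>e\<in>in_arcs G v. sweep M y t (tail G e))"
    have "\<bar>real_of_int s\<bar> \<le> (\<Sum>e\<in>in_arcs G v. \<bar>real_of_int (sweep M y t (tail G e))\<bar>)"
      unfolding s_def of_int_sum by (rule sum_abs)
    then have s: "\<bar>real_of_int s\<bar> / ?d \<le> avg (\<lambda>u. \<bar>real_of_int (sweep M y t u)\<bar>) v"
      unfolding avg_def by (intro divide_right_mono) auto
    have y: "\<bar>real_of_int (M * y v)\<bar> \<le> real_of_int (M * S)"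
    proof -
      have "\<bar>M * y v\<bar> \<le> M * S" using M S[of v] v by (simp add: abs_mult mult_left_mono)
      then show ?thesis by (metis of_int_abs of_int_le_iff)
    qed
    have "\<bar>real_of_int (M * y v)\<bar> / ?d \<le> real_of_int (M * S) / 1"
      using d y by (intro frac_le) auto
    then have q: "\<bar>real_of_int (M * y v + s) / ?d\<bar> \<le> avg (\<lambda>u. \<bar>real_of_int (sweep M y t u)\<bar>) v + real_of_int (M * S)"
      using s abs_triangle_ineq[of "real_of_int (M * y v)" "real_of_int s"] d
      by (simp add: add_divide_distrib abs_divide) (smt (verit) add_divide_distrib divide_right_mono of_nat_0_le_iff)
    have "real_of_int (sweep M y (Suc t) v) = real_of_int ((M * y v + s) div int (out_degree G v))"
      using v by (simp add: s_def)
    then show "\<bar>real_of_int (sweep M y (Suc t) v)\<bar> \<le> avg (\<lambda>u. \<bar>real_of_int (sweep M y t u)\<bar>) v + c"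
      using q div_bounds[OF d, of "M * y v + s"] unfolding c_def of_int_add[of "M * S"] of_int_1 by linarith
  qed simp
  also have "\<dots> \<le> c * real hit"
    using wt_le_hit[OF v, of t] M S0 by (simp add: c_def mult_left_mono)
  finally have "real_of_int \<bar>sweep M y t v\<bar> \<le> real_of_int (int hit * (M * S + 1))"
    by (simp add: c_def mult.commute)
  then show ?thesis by (simp only: of_int_le_iff)
qed

lemma round_near:
  fixes a M k :: int
  assumes "2 * \<bar>a - M * k\<bar> < M"
  shows "(2 * a + M) div (2 * M) = k"
proof -
  define z where "z = a - M * k"
  have z: "2 * \<bar>z\<bar> < M" using assms by (simp add: z_def)
  then have M: "2 * M \<noteq> 0" by linarith
  have "2 * a + M = (2 * z + M) + k * (2 * M)" by (simp add: z_def algebra_simps)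
  then have "(2 * a + M) div (2 * M) = k + (2 * z + M) div (2 * M)"
    by (simp only: div_mult_self1[OF M])
  also have "(2 * z + M) div (2 * M) = 0"
    using z by (intro div_pos_pos_trivial) linarith+
  finally show ?thesis by simp
qed

text \<open>The distance to \<open>M * g\<close> starts at most at \<open>M * (2 * hit) * S\<close>
  by \<open>fixed_bound\<close>, is reduced below 1 by \<open>l\<close> halvings, and rounding adds
  at most \<open>hit\<close>. The result \<open>hit + 1\<close> is still below \<open>M / 2\<close>,
  which fixes the choice of \<open>M\<close>.\<close>

lemma sweep_round:
  assumes g: "g r = 0" "\<And>u. u \<in> verts G \<Longrightarrow> y u + lap g u = 0"
    and S: "\<And>v. v \<in> verts G \<Longrightarrow> \<bar>y v\<bar> \<le> S"
    and M: "M = 2 * int hit + 3"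
    and l: "M * (2 * int hit) * S < 2 ^ l" and v: "v \<in> verts G"
  shows "(2 * sweep M y ((2 * hit + 1) * l) v + M) div (2 * M) = g v"
proof -
  have S0: "S \<ge> 0" using S[OF root] by simp
  have eqn: "real (out_degree G v) * real_of_int (g v) = real_of_int (y v) + (\<Sum>e\<in>in_arcs G v. real_of_int (g (tail G e)))"
    if "v \<in> verts G" for v
  proof -
    have "int (out_degree G v) * g v = y v + (\<Sum>e\<in>in_arcs G v. g (tail G e))"
      using g(2)[OF that] by (simp add: lap_def algebra_simps)
    then have "real_of_int (int (out_degree G v) * g v) = real_of_int (y v + (\<Sum>e\<in>in_arcs G v. g (tail G e)))"
      by (simp only:)
    then show ?thesis by simp
  qed
  have gb: "\<bar>real_of_int (g v)\<bar> \<le> 2 * real hit * real_of_int S" if v: "v \<in> verts G" for v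
  proof (rule fixed_bound[OF _ _ _ v])
    show "real_of_int (g r) = 0" using g by simp
    show "0 \<le> real_of_int S" using S0 by simp
    fix v assume v: "v \<in> verts G - {r}"
    let ?d = "real (out_degree G v)"
    have d: "?d \<ge> 1" using out_degree_pos[OF v] by simp
    have yS: "\<bar>real_of_int (y v)\<bar> \<le> real_of_int S" using S[of v] v by (metis DiffD1 of_int_abs of_int_le_iff)
    have "?d * \<bar>real_of_int (g v)\<bar> = \<bar>real_of_int (y v) + (\<Sum>e\<in>in_arcs G v. real_of_int (g (tail G e)))\<bar>"
      using v by (simp add: eqn[symmetric] abs_mult)
    also have "\<dots> \<le> \<bar>real_of_int (y v)\<bar> + (\<Sum>e\<in>in_arcs G v. \<bar>real_of_int (g (tail G e))\<bar>)"
      by (rule order_trans[OF abs_triangle_ineq]) (simp add: sum_abs)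
    also have "\<dots> \<le> ?d * real_of_int S + (\<Sum>e\<in>in_arcs G v. \<bar>real_of_int (g (tail G e))\<bar>)"
      using d mult_right_mono[OF d, of "real_of_int S"] yS S0 by simp
    finally show "\<bar>real_of_int (g v)\<bar> \<le> avg (\<lambda>u. \<bar>real_of_int (g u)\<bar>) v + real_of_int S"
      using d by (simp add: avg_def field_simps)
  qed
  let ?t = "(2 * hit + 1) * l"
  define err where "err t v = real_of_int (sweep M y t v - M * g v)" for t v
  define E where "E = real_of_int M * (2 * real hit * real_of_int S)"
  have M0: "M > 0" using M by simp
  have E0: "E \<ge> 0" using M0 S0 by (simp add: E_def)
  have "\<bar>err ?t v\<bar> \<le> E * surv ?t v + 1 * wt ?t v"
  proof (rule averaging_bound[OF _ _ _ v])
    show "err t r = 0" for t using g by (simp add: err_def sweep_root)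
    show "\<bar>err 0 v\<bar> \<le> E" if "v \<in> verts G" for v
      using gb[OF that] M0 by (simp add: err_def E_def abs_mult)
    fix t v assume v: "v \<in> verts G - {r}"
    have d: "out_degree G v \<ge> 1" using out_degree_pos[OF v] by simp
    let ?d = "real (out_degree G v)"
    define s where "s = (\<Sum>e\<in>in_arcs G v. sweep M y t (tail G e))"
    have "real_of_int M * (?d * real_of_int (g v)) = real_of_int (M * y v) + (\<Sum>e\<in>in_arcs G v. real_of_int (M * g (tail G e)))"
      using v by (subst eqn) (auto simp: algebra_simps sum_distrib_left)
    then have "real_of_int (M * y v + s) - ?d * real_of_int (M * g v) = (\<Sum>e\<in>in_arcs G v. err t (tail G e))"
      by (simp add: s_def err_def sum_subtractf algebra_simps)
    then have "real_of_int (M * y v + s) / ?d - real_of_int (M * g v) = avg (err t) v"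
      using d by (simp add: avg_def field_simps)
    moreover have "\<bar>avg (err t) v\<bar> \<le> avg (\<lambda>u. \<bar>err t u\<bar>) v"
      unfolding avg_def abs_divide by (auto intro!: divide_right_mono)
    moreover have "err (Suc t) v = real_of_int ((M * y v + s) div int (out_degree G v)) - real_of_int (M * g v)"
      using v by (simp add: s_def err_def)
    ultimately show "\<bar>err (Suc t) v\<bar> \<le> avg (\<lambda>u. \<bar>err t u\<bar>) v + 1"
      using div_bounds[OF d, of "M * y v + s"] by linarith
  qed
  also have "\<dots> \<le> E * (1 / 2) ^ l + 1 * real hit"
    using surv_power[OF v, of l] wt_le_hit[OF v, of ?t] E0 by (intro add_mono mult_left_mono) auto
  also have "E * (1 / 2) ^ l \<le> 1"
  proof -
    have "real_of_int (M * (2 * int hit) * S) < real_of_int (2 ^ l)" using l by (simp only: of_int_less_iff)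
    then have "E < 2 ^ l" by (simp add: E_def mult.assoc)
    then show ?thesis by (simp add: field_simps)
  qed
  finally have "\<bar>err ?t v\<bar> \<le> 1 + real hit" by simp
  then have "real_of_int \<bar>sweep M y ?t v - M * g v\<bar> \<le> real_of_int (1 + int hit)" by (simp add: err_def)
  then have "\<bar>sweep M y ?t v - M * g v\<bar> \<le> 1 + int hit" by (simp only: of_int_le_iff)
  moreover have "2 * c < 2 * int hit + 3" if "c \<le> 1 + int hit" for c using that by linarith
  ultimately have "2 * \<bar>sweep M y ?t v - M * g v\<bar> < 2 * int hit + 3" by blast
  then show ?thesis unfolding M[symmetric] by (rule round_near)
qed

text \<open>By \<open>sweep_round\<close> any solution agrees on the vertices with the rounded
  iterate; in the other direction the rounded iterate is itself the witness.\<close>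

lemma solvable_iff_rounded:
  assumes S: "\<And>v. v \<in> verts G \<Longrightarrow> \<bar>y v\<bar> \<le> S"
    and M: "M = 2 * int hit + 3"
    and l: "M * (2 * int hit) * S < 2 ^ l"
  shows "(\<exists>g. g r = 0 \<and> (\<forall>u\<in>verts G. y u + lap g u = 0)) \<longleftrightarrow>
    (\<forall>u\<in>verts G. y u + lap (\<lambda>v. (2 * sweep M y ((2 * hit + 1) * l) v + M) div (2 * M)) u = 0)"
    (is "_ \<longleftrightarrow> (\<forall>u\<in>verts G. y u + lap ?h u = 0)")
proof
  assume "\<exists>g. g r = 0 \<and> (\<forall>u\<in>verts G. y u + lap g u = 0)"
  then obtain g where g: "g r = 0" "\<And>u. u \<in> verts G \<Longrightarrow> y u + lap g u = 0" by blast
  have eq: "?h v = g v" if "v \<in> verts G" for v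
    by (rule sweep_round[OF g S M l that])
  show "\<forall>u\<in>verts G. y u + lap ?h u = 0"
  proof
    fix u assume u: "u \<in> verts G"
    have "lap ?h u = lap g u"
      unfolding lap_def using eq u by (intro arg_cong2[where f="(-)"] sum.cong) auto
    then show "y u + lap ?h u = 0" using g(2)[OF u] by simp
  qed
next
  assume h: "\<forall>u\<in>verts G. y u + lap ?h u = 0"
  \<comment> \<open>At the root the iterate is 0, and \<open>M div (2 * M)\<close> is 0.\<close>
  have "?h r = 0" using M by (simp add: sweep_root)
  with h show "\<exists>g. g r = 0 \<and> (\<forall>u\<in>verts G. y u + lap g u = 0)" by (intro exI[of _ ?h] conjI)
qed

end

section \<open>Time bounds for random access machines\<close>

lemma int_size_pos: "int_size k \<ge> 1"
  by (simp add: int_size_def)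

lemma abs_less_two_power_int_size: "\<bar>k\<bar> < 2 ^ (int_size k - 1)"
proof -
  have "nat \<bar>k\<bar> < 2 ^ floorlog 2 (nat \<bar>k\<bar>)"
    using floorlog_bounds[of "nat \<bar>k\<bar>" 2] by (cases "nat \<bar>k\<bar> = 0") (auto simp: floorlog_def)
  then show ?thesis by (simp add: int_size_def nat_less_iff)
qed

lemma int_size_le_iff: "int_size k \<le> Suc p \<longleftrightarrow> \<bar>k\<bar> < 2 ^ p"
proof -
  have "floorlog 2 (nat \<bar>k\<bar>) \<le> p \<longleftrightarrow> nat \<bar>k\<bar> < 2 ^ p" by (simp add: floorlog_le_iff)
  then show ?thesis by (simp add: int_size_def nat_less_iff)
qed

lemma int_size_mono: "\<bar>a\<bar> \<le> \<bar>b\<bar> \<Longrightarrow> int_size a \<le> int_size b"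
  using abs_less_two_power_int_size[of b] int_size_le_iff[of a "int_size b - 1"] int_size_pos[of b]
  by simp

text \<open>The lengths are added instead of taking their maximum plus one, so that sums and
  products obey the same rule.\<close>

lemma int_size_add_le:
  assumes "\<bar>c\<bar> \<le> \<bar>a\<bar> + \<bar>b\<bar>" shows "int_size c \<le> int_size a + int_size b"
proof -
  let ?p = "int_size a - 1" and ?q = "int_size b - 1"
  have "\<bar>c\<bar> < 2 ^ ?p + 2 ^ ?q"
    using assms abs_less_two_power_int_size[of a] abs_less_two_power_int_size[of b] by linarith
  also have "\<dots> \<le> 2 ^ (?p + ?q) + (2 ^ (?p + ?q) :: int)"
    by (intro add_mono power_increasing) auto
  also have "\<dots> = 2 ^ Suc (?p + ?q)" by simp
  finally have "int_size c \<le> Suc (Suc (?p + ?q))" by (simp only: int_size_le_iff)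
  then show ?thesis using int_size_pos[of a] int_size_pos[of b] by linarith
qed

lemma int_size_mult_le: "int_size (a * b) \<le> int_size a + int_size b"
proof -
  let ?p = "int_size a - 1" and ?q = "int_size b - 1"
  have "\<bar>a * b\<bar> < 2 ^ ?p * 2 ^ ?q"
    unfolding abs_mult
    using abs_less_two_power_int_size[of a] abs_less_two_power_int_size[of b]
    by (intro mult_strict_mono) auto
  then have "int_size (a * b) \<le> Suc (?p + ?q)" by (simp only: int_size_le_iff power_add)
  then show ?thesis using int_size_pos[of a] int_size_pos[of b] by linarith
qed

lemma abs_div_le: "\<bar>a div b\<bar> \<le> \<bar>a :: int\<bar>"
proof -
  have pos: "\<bar>a div b\<bar> \<le> \<bar>a\<bar>" if "b > 0" for a b :: int
  proof (cases "a \<ge> 0")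
    case True
    then show ?thesis using zdiv_mono2[of a 1 b] that by (simp add: pos_imp_zdiv_nonneg_iff)
  next
    case False
    then have "a div b < 0" using that by (simp add: pos_imp_zdiv_neg_iff)
    then show ?thesis using False zdiv_mono2_neg[of a 1 b] that by simp
  qed
  consider "b > 0" | "b = 0" | "- b > 0" by linarith
  then show ?thesis
  proof cases
    case 3
    then show ?thesis using pos[of "- b" "- a"] by simp
  qed (use pos in auto)
qed

lemma abs_mod_le: "\<bar>a mod b\<bar> \<le> \<bar>a\<bar> + \<bar>b :: int\<bar>"
proof -
  consider "b > 0" | "b = 0" | "b < 0" by linarith
  then show ?thesis
  proof cases
    case 1
    then show ?thesis using pos_mod_bound[of b a] pos_mod_sign[of b a] by linarith
  next
    case 3
    then show ?thesis using neg_mod_bound[of b a] neg_mod_sign[of b a] by linarith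
  qed simp
qed

section \<open>Syntactic weights that bound the logarithmic cost\<close>

primrec azsize :: "aexp \<Rightarrow> nat" where
  "azsize (Const k) = int_size k"
| "azsize (Reg i) = 1"
| "azsize (Arr a i) = 1"
| "azsize (Add a b) = azsize a + azsize b"
| "azsize (Sub a b) = azsize a + azsize b"
| "azsize (Mul a b) = azsize a + azsize b"
| "azsize (Div a b) = azsize a"
| "azsize (Mod a b) = azsize a + azsize b"

text \<open>While \<open>azsize\<close> compares the length of a value with the word length of
  memory, this compares the evaluation cost with its square, the square being due to multiplication
  and division. Both depend on syntax alone and are thus constants of a program.\<close>

primrec aweight :: "aexp \<Rightarrow> nat" where
  "aweight (Const k) = int_size k"
| "aweight (Reg i) = 1"
| "aweight (Arr a i) = aweight i + azsize i + 1"
| "aweight (Add a b) = aweight a + aweight b + (azsize a + azsize b)"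
| "aweight (Sub a b) = aweight a + aweight b + (azsize a + azsize b)"
| "aweight (Mul a b) = aweight a + aweight b + azsize a * azsize b"
| "aweight (Div a b) = aweight a + aweight b + azsize a * azsize b"
| "aweight (Mod a b) = aweight a + aweight b + azsize a * azsize b"

primrec bweight :: "bexp \<Rightarrow> nat" where
  "bweight (Less a b) = aweight a + aweight b + (azsize a + azsize b)"
| "bweight (Equal a b) = aweight a + aweight b + (azsize a + azsize b)"

primrec weight :: "com \<Rightarrow> nat" where
  "weight Skip = 1"
| "weight (Assign i a) = 1 + aweight a + azsize a"
| "weight (Store k i a) = 1 + aweight i + aweight a + azsize i + azsize a"
| "weight (Seq c d) = weight c + weight d"
| "weight (If b c d) = 1 + bweight b + weight c + weight d"
| "weight (While b c) = 1 + bweight b + weight c"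

definition mem_le :: "int \<Rightarrow> ram \<Rightarrow> bool" where
  "mem_le B s \<longleftrightarrow> (\<forall>i. \<bar>regs s i\<bar> \<le> B) \<and> (\<forall>a i. \<bar>arrs s a i\<bar> \<le> B)"

lemma int_size_aval:
  assumes "mem_le B s" shows "int_size (aval e s) \<le> azsize e * int_size B"
proof (induction e)
  case (Const k)
  then show ?case using int_size_pos[of B] by simp
next
  case (Reg i)
  then show ?case using assms by (auto simp: mem_le_def intro!: int_size_mono order_trans[OF _ abs_ge_self])
next
  case (Arr a i)
  then show ?case using assms by (auto simp: mem_le_def intro!: int_size_mono order_trans[OF _ abs_ge_self])
next
  case (Add a b)
  then show ?case using int_size_add_le[OF abs_triangle_ineq, of "aval a s" "aval b s"]
    by (simp add: algebra_simps)
next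
  case (Sub a b)
  then show ?case using int_size_add_le[OF abs_triangle_ineq4, of "aval a s" "aval b s"]
    by (simp add: algebra_simps)
next
  case (Mul a b)
  then show ?case using int_size_mult_le[of "aval a s" "aval b s"] by (simp add: algebra_simps)
next
  case (Div a b)
  then show ?case using int_size_mono[OF abs_div_le[of "aval a s" "aval b s"]] by simp
next
  case (Mod a b)
  then show ?case using int_size_add_le[OF abs_mod_le[of "aval a s" "aval b s"]] by (simp add: algebra_simps)
qed

lemma le_mult_square: "n \<le> k * b \<Longrightarrow> b \<ge> (1::nat) \<Longrightarrow> n \<le> k * b\<^sup>2"
  by (erule order_trans) (simp add: power2_eq_square)

lemma acost_le:
  assumes "mem_le B s" shows "acost e s \<le> aweight e * (int_size B)\<^sup>2"
proof -
  let ?b = "int_size B"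
  have sz: "int_size (aval e s) \<le> azsize e * ?b\<^sup>2" for e
    using int_size_aval[OF assms] int_size_pos by (rule le_mult_square)
  have mul: "int_size (aval a s) * int_size (aval b s) \<le> azsize a * azsize b * ?b\<^sup>2" for a b
    using mult_mono[OF int_size_aval[OF assms, of a] int_size_aval[OF assms, of b]]
    by (simp add: power2_eq_square algebra_simps)
  show ?thesis
  proof (induction e)
    case (Const k)
    then show ?case using sz[of "Const k"] by simp
  next
    case (Reg i)
    then show ?case using sz[of "Reg i"] by simp
  next
    case (Arr a i)
    then show ?case using sz[of "Arr a i"] sz[of i] by (simp add: algebra_simps)
  next
    case (Add a b)
    then show ?case using sz[of a] sz[of b] by (simp add: algebra_simps)
  next
    case (Sub a b)
    then show ?case using sz[of a] sz[of b] by (simp add: algebra_simps)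
  next
    case (Mul a b)
    then show ?case using mul[of a b] by (simp add: algebra_simps)
  next
    case (Div a b)
    then show ?case using mul[of a b] by (simp add: algebra_simps)
  next
    case (Mod a b)
    then show ?case using mul[of a b] by (simp add: algebra_simps)
  qed
qed

lemma int_size_aval_square:
  "mem_le B s \<Longrightarrow> int_size (aval e s) \<le> azsize e * (int_size B)\<^sup>2"
  using int_size_aval int_size_pos by (rule le_mult_square)

lemma bcost_le:
  assumes "mem_le B s" shows "bcost b s \<le> bweight b * (int_size B)\<^sup>2"
proof (cases b)
  case (Less x y)
  then show ?thesis using acost_le[OF assms, of x] acost_le[OF assms, of y]
    int_size_aval_square[OF assms, of x] int_size_aval_square[OF assms, of y]
    by (simp add: algebra_simps)
next
  case (Equal x y)
  then show ?thesis using acost_le[OF assms, of x] acost_le[OF assms, of y]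
    int_size_aval_square[OF assms, of x] int_size_aval_square[OF assms, of y]
    by (simp add: algebra_simps)
qed

text \<open>The number \<open>n\<close> bounds the executed instructions; the logarithmic cost of each of them is
  at most the weight of the program times the square of the word length of \<open>B\<close>.\<close>

definition hoare :: "int \<Rightarrow> (ram \<Rightarrow> bool) \<Rightarrow> com \<Rightarrow> nat \<Rightarrow> (ram \<Rightarrow> bool) \<Rightarrow> bool" where
  "hoare B P c n Q \<longleftrightarrow> (\<forall>s. mem_le B s \<longrightarrow> P s \<longrightarrow>
     (\<exists>t s'. exec c s t s' \<and> t \<le> n * (weight c * (int_size B)\<^sup>2) \<and> mem_le B s' \<and> Q s'))"

lemma hoareI:
  "(\<And>s. mem_le B s \<Longrightarrow> P s \<Longrightarrow>
     \<exists>t s'. exec c s t s' \<and> t \<le> n * (weight c * (int_size B)\<^sup>2) \<and> mem_le B s' \<and> Q s') \<Longrightarrow> hoare B P c n Q"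
  by (simp add: hoare_def)

lemma hoareE:
  assumes "hoare B P c n Q" "mem_le B s" "P s"
  obtains t s' where "exec c s t s'" "t \<le> n * (weight c * (int_size B)\<^sup>2)" "mem_le B s'" "Q s'"
  using assms unfolding hoare_def by blast

lemma hoare_conseq:
  assumes "hoare B P c n Q" "\<And>s. P' s \<Longrightarrow> P s" "\<And>s. mem_le B s \<Longrightarrow> Q s \<Longrightarrow> Q' s" "n \<le> n'"
  shows "hoare B P' c n' Q'"
proof (rule hoareI)
  fix s assume "mem_le B s" "P' s"
  then obtain t s' where "exec c s t s'" "t \<le> n * (weight c * (int_size B)\<^sup>2)" "mem_le B s'" "Q s'"
    using hoareE[OF assms(1)] assms(2) by metis
  moreover have "n * (weight c * (int_size B)\<^sup>2) \<le> n' * (weight c * (int_size B)\<^sup>2)"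
    using assms(4) by (rule mult_le_mono1)
  ultimately show "\<exists>t s'. exec c s t s' \<and> t \<le> n' * (weight c * (int_size B)\<^sup>2) \<and> mem_le B s' \<and> Q' s'"
    using assms(3) by (meson order_trans)
qed

lemma hoare_Skip: "(\<And>s. P s \<Longrightarrow> Q s) \<Longrightarrow> hoare B P Skip 1 Q"
proof (rule hoareI)
  fix s assume "\<And>s. P s \<Longrightarrow> Q s" "mem_le B s" "P s"
  then show "\<exists>t s'. exec Skip s t s' \<and> t \<le> 1 * (weight Skip * (int_size B)\<^sup>2) \<and> mem_le B s' \<and> Q s'"
    using int_size_pos[of B] exec_Skip[of s] by (intro exI[of _ 1] exI[of _ s]) auto
qed

lemma hoare_Assign:
  assumes "\<And>s. mem_le B s \<Longrightarrow> P s \<Longrightarrow>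
    \<bar>aval a s\<bar> \<le> B \<and> Q (s\<lparr>regs := (regs s)(i := aval a s)\<rparr>)"
  shows "hoare B P (Assign i a) 1 Q"
proof (rule hoareI)
  fix s assume s: "mem_le B s" "P s"
  let ?s = "s\<lparr>regs := (regs s)(i := aval a s)\<rparr>"
  have "1 \<le> (int_size B)\<^sup>2" using int_size_pos[of B] by simp
  then have "1 + acost a s + int_size (aval a s) \<le> 1 * (weight (Assign i a) * (int_size B)\<^sup>2)"
    using acost_le[OF s(1), of a] int_size_aval_square[OF s(1), of a] by (simp add: algebra_simps)
  moreover have "mem_le B ?s" using s(1) assms[OF s] by (simp add: mem_le_def)
  ultimately show "\<exists>t s'. exec (Assign i a) s t s' \<and>
      t \<le> 1 * (weight (Assign i a) * (int_size B)\<^sup>2) \<and> mem_le B s' \<and> Q s'"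
    using exec_Assign[of i a s] assms[OF s] by blast
qed

lemma hoare_Store:
  assumes "\<And>s. mem_le B s \<Longrightarrow> P s \<Longrightarrow>
    \<bar>aval a s\<bar> \<le> B \<and> Q (s\<lparr>arrs := (arrs s)(k := (arrs s k)(aval i s := aval a s))\<rparr>)"
  shows "hoare B P (Store k i a) 1 Q"
proof (rule hoareI)
  fix s assume s: "mem_le B s" "P s"
  let ?s = "s\<lparr>arrs := (arrs s)(k := (arrs s k)(aval i s := aval a s))\<rparr>"
  have "1 \<le> (int_size B)\<^sup>2" using int_size_pos[of B] by simp
  then have "1 + acost i s + acost a s + int_size (aval i s) + int_size (aval a s) \<le>
      1 * (weight (Store k i a) * (int_size B)\<^sup>2)"
    using acost_le[OF s(1), of a] int_size_aval_square[OF s(1), of a]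
      acost_le[OF s(1), of i] int_size_aval_square[OF s(1), of i] by (simp add: algebra_simps)
  moreover have "mem_le B ?s" using s(1) assms[OF s] by (simp add: mem_le_def)
  ultimately show "\<exists>t s'. exec (Store k i a) s t s' \<and>
      t \<le> 1 * (weight (Store k i a) * (int_size B)\<^sup>2) \<and> mem_le B s' \<and> Q s'"
    using exec_Store[of k i a s] assms[OF s] by blast
qed

lemma hoare_Seq:
  assumes c: "hoare B P c n R" and d: "hoare B R d m Q"
  shows "hoare B P (Seq c d) (n + m) Q"
proof (rule hoareI)
  fix s assume s: "mem_le B s" "P s"
  obtain t s' where 1: "exec c s t s'" "t \<le> n * (weight c * (int_size B)\<^sup>2)" "mem_le B s'" "R s'"
    by (rule hoareE[OF c s])
  obtain u s'' where 2: "exec d s' u s''" "u \<le> m * (weight d * (int_size B)\<^sup>2)" "mem_le B s''" "Q s''"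
    by (rule hoareE[OF d 1(3,4)])
  have "t + u \<le> (n + m) * (weight (Seq c d) * (int_size B)\<^sup>2)"
    using 1(2) 2(2) by (simp add: algebra_simps)
  then show "\<exists>t s'. exec (Seq c d) s t s' \<and> t \<le> (n + m) * (weight (Seq c d) * (int_size B)\<^sup>2) \<and> mem_le B s' \<and> Q s'"
    using exec_Seq[OF 1(1) 2(1)] 2(3,4) by blast
qed

lemma hoare_If:
  assumes c: "hoare B (\<lambda>s. P s \<and> bval b s) c n Q" and d: "hoare B (\<lambda>s. P s \<and> \<not> bval b s) d n Q"
  shows "hoare B P (If b c d) (n + 1) Q"
proof (rule hoareI)
  fix s assume s: "mem_le B s" "P s"
  have "1 \<le> (int_size B)\<^sup>2" using int_size_pos[of B] by simp
  then have b: "1 + bcost b s \<le> (1 + bweight b) * (int_size B)\<^sup>2"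
    using bcost_le[OF s(1), of b] by (simp add: algebra_simps)
  show "\<exists>t s'. exec (If b c d) s t s' \<and> t \<le> (n + 1) * (weight (If b c d) * (int_size B)\<^sup>2) \<and> mem_le B s' \<and> Q s'"
  proof (cases "bval b s")
    case True
    obtain t s' where 1: "exec c s t s'" "t \<le> n * (weight c * (int_size B)\<^sup>2)" "mem_le B s'" "Q s'"
      using hoareE[OF c s(1)] s(2) True by blast
    have "1 + bcost b s + t \<le> (n + 1) * (weight (If b c d) * (int_size B)\<^sup>2)"
      using 1(2) b by (simp add: algebra_simps)
    then show ?thesis using exec_IfTrue[OF True 1(1)] 1(3,4) by blast
  next
    case False
    obtain t s' where 1: "exec d s t s'" "t \<le> n * (weight d * (int_size B)\<^sup>2)" "mem_le B s'" "Q s'"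
      using hoareE[OF d s(1)] s(2) False by blast
    have "1 + bcost b s + t \<le> (n + 1) * (weight (If b c d) * (int_size B)\<^sup>2)"
      using 1(2) b by (simp add: algebra_simps)
    then show ?thesis using exec_IfFalse[OF False 1(1)] 1(3,4) by blast
  qed
qed

text \<open>The number \<open>N\<close> of rounds is known beforehand and the assertion is indexed
  by the round, so termination comes from counting down \<open>N - k\<close>.\<close>

lemma hoare_While:
  assumes body: "\<And>k. k < N \<Longrightarrow> hoare B (I k) c n (I (Suc k))"
    and go: "\<And>k s. k < N \<Longrightarrow> I k s \<Longrightarrow> bval b s"
    and stop: "\<And>s. I N s \<Longrightarrow> \<not> bval b s"
  shows "hoare B (I 0) (While b c) (N * (n + 1) + 1) (I N)"
proof (rule hoareI)
  let ?\<beta> = "(int_size B)\<^sup>2"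
  have b: "1 + bcost b s \<le> (1 + bweight b) * ?\<beta>" if "mem_le B s" for s
  proof -
    have "1 \<le> ?\<beta>" using int_size_pos[of B] by simp
    then show ?thesis using bcost_le[OF that, of b] by (simp add: algebra_simps)
  qed
  have "\<exists>t s'. exec (While b c) s t s' \<and> t \<le> (j * (n + 1) + 1) * (weight (While b c) * ?\<beta>) \<and> mem_le B s' \<and> I N s'"
    if "mem_le B s" "I k s" "k + j = N" for j k s
    using that
  proof (induction j arbitrary: k s)
    case 0
    then have "\<not> bval b s" using stop by simp
    then have "exec (While b c) s (1 + bcost b s) s" by (rule exec_WhileFalse)
    moreover have "1 + bcost b s \<le> (0 * (n + 1) + 1) * (weight (While b c) * ?\<beta>)"
      using b[OF 0(1)] by (simp add: algebra_simps)
    ultimately show ?case using 0 by auto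
  next
    case (Suc j)
    then have k: "k < N" by simp
    obtain t s' where 1: "exec c s t s'" "t \<le> n * (weight c * ?\<beta>)" "mem_le B s'" "I (Suc k) s'"
      using hoareE[OF body[OF k]] Suc.prems by blast
    obtain u s'' where 2: "exec (While b c) s' u s''" "u \<le> (j * (n + 1) + 1) * (weight (While b c) * ?\<beta>)"
      "mem_le B s''" "I N s''"
      using Suc.IH[OF 1(3,4)] Suc.prems by auto
    have "1 + bcost b s + t \<le> (n + 1) * (weight (While b c) * ?\<beta>)"
      using 1(2) b[OF Suc.prems(1)] by (simp add: algebra_simps)
    moreover have "(Suc j * (n + 1) + 1) * (weight (While b c) * ?\<beta>) =
        (n + 1) * (weight (While b c) * ?\<beta>) + (j * (n + 1) + 1) * (weight (While b c) * ?\<beta>)"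
      by (simp only: add_mult_distrib[symmetric]) simp
    ultimately have "1 + bcost b s + t + u \<le> (Suc j * (n + 1) + 1) * (weight (While b c) * ?\<beta>)"
      using 2(2) by linarith
    then show ?case
      using exec_WhileTrue[OF go[OF k Suc.prems(2)] 1(1) 2(1)] 2(3,4) by blast
  qed
  from this[of _ 0 N] show "\<And>s. mem_le B s \<Longrightarrow> I 0 s \<Longrightarrow>
      \<exists>t s'. exec (While b c) s t s' \<and> t \<le> (N * (n + 1) + 1) * (weight (While b c) * ?\<beta>) \<and> mem_le B s' \<and> I N s'"
    by simp
qed

lemma hoare_If_True:
  assumes "\<And>s. P s \<Longrightarrow> bval b s" "hoare B P c n Q" shows "hoare B P (If b c d) (n + 1) Q"
proof (rule hoare_If)
  show "hoare B (\<lambda>s. P s \<and> bval b s) c n Q" using assms by (intro hoare_conseq[OF assms(2)]) auto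
  show "hoare B (\<lambda>s. P s \<and> \<not> bval b s) d n Q" using assms(1) by (auto simp: hoare_def)
qed

lemma hoare_If_False:
  assumes "\<And>s. P s \<Longrightarrow> \<not> bval b s" "hoare B P d n Q" shows "hoare B P (If b c d) (n + 1) Q"
proof (rule hoare_If)
  show "hoare B (\<lambda>s. P s \<and> \<not> bval b s) d n Q" using assms by (intro hoare_conseq[OF assms(2)]) auto
  show "hoare B (\<lambda>s. P s \<and> bval b s) c n Q" using assms(1) by (auto simp: hoare_def)
qed

text \<open>All loops of the algorithm reset their counter, so that the contents of the registers are
  known exactly between any two instructions.\<close>

definition For :: "nat \<Rightarrow> nat \<Rightarrow> com \<Rightarrow> com" where
  "For i l c = Seq
     (While (Less (Reg i) (Reg l)) (Seq c (Assign i (Add (Reg i) (Const 1)))))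
     (Assign i (Const 0))"

text \<open>Registers are fixed exactly, arrays only through a predicate, because only finitely many
  of their cells matter.\<close>

definition st :: "(nat \<Rightarrow> int) \<Rightarrow> ((nat \<Rightarrow> int \<Rightarrow> int) \<Rightarrow> bool) \<Rightarrow> ram \<Rightarrow> bool" where
  "st R K s \<longleftrightarrow> regs s = R \<and> K (arrs s)"

lemma hoare_Assign_st:
  assumes "\<And>s. st R K s \<Longrightarrow> aval a s = z" "\<bar>z\<bar> \<le> B"
  shows "hoare B (st R K) (Assign i a) 1 (st (R(i := z)) K)"
  using assms by (intro hoare_Assign) (auto simp: st_def)

lemma hoare_Store_st:
  assumes "\<And>s. st R K s \<Longrightarrow> aval a s = z" "\<And>s. st R K s \<Longrightarrow> aval j s = w" "\<bar>z\<bar> \<le> B"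
    and "\<And>f. K f \<Longrightarrow> K' (f(k := (f k)(w := z)))"
  shows "hoare B (st R K) (Store k j a) 1 (st R K')"
  using assms by (intro hoare_Store) (auto simp: st_def)

text \<open>\<open>Rf k\<close> is the register content between rounds with the counter masked to 0.
  Each round adds a test and an increment to the body; the final 2 is the failing test and the
  reset.\<close>

lemma hoare_For:
  assumes body: "\<And>k. k < N \<Longrightarrow>
      hoare B (st ((Rf k)(i := int k)) (K k)) c n (st ((Rf (Suc k))(i := int k)) (K (Suc k)))"
    and counter: "\<And>k. Rf k i = 0" and lim: "\<And>k. Rf k l = int N" and il: "i \<noteq> l"
    and B: "int N \<le> B"
  shows "hoare B (st (Rf 0) (K 0)) (For i l c) (N * (n + 2) + 2) (st (Rf N) (K N))"
proof -
  let ?J = "\<lambda>k. st ((Rf k)(i := int k)) (K k)"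
  have step: "hoare B (?J k) (Seq c (Assign i (Add (Reg i) (Const 1)))) (n + 1) (?J (Suc k))" if k: "k < N" for k
  proof (rule hoare_Seq[OF body[OF k]])
    have "hoare B (st ((Rf (Suc k))(i := int k)) (K (Suc k))) (Assign i (Add (Reg i) (Const 1))) 1
        (st (((Rf (Suc k))(i := int k))(i := int k + 1)) (K (Suc k)))"
      by (rule hoare_Assign_st) (use B k in \<open>auto simp: st_def\<close>)
    then show "hoare B (st ((Rf (Suc k))(i := int k)) (K (Suc k))) (Assign i (Add (Reg i) (Const 1))) 1 (?J (Suc k))"
      by (simp add: add.commute)
  qed
  have loop: "hoare B (?J 0) (While (Less (Reg i) (Reg l)) (Seq c (Assign i (Add (Reg i) (Const 1)))))
      (N * ((n + 1) + 1) + 1) (?J N)"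
    by (rule hoare_While[where I="?J"], erule step) (use lim il in \<open>auto simp: st_def\<close>)
  have R0: "(Rf 0)(i := int 0) = Rf 0" using counter[of 0] by auto
  have RN: "(Rf N)(i := 0) = Rf N" using counter[of N] by auto
  have "hoare B (?J N) (Assign i (Const 0)) 1 (st (((Rf N)(i := int N))(i := 0)) (K N))"
    by (rule hoare_Assign_st) (use B in auto)
  then have "hoare B (?J N) (Assign i (Const 0)) 1 (st (Rf N) (K N))" by (simp add: RN)
  with loop have "hoare B (?J 0) (For i l c) ((N * ((n + 1) + 1) + 1) + 1) (st (Rf N) (K N))"
    unfolding For_def by (rule hoare_Seq)
  then show ?thesis unfolding R0 by (rule hoare_conseq) auto
qed

section \<open>The algorithm\<close>

text \<open>Registers 1, 2, 3 hold \<open>n\<close>, \<open>m\<close>, \<open>r\<close>. Arrays 1 to 4 hold the divisor \<open>y\<close>, the out-degrees, the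
  current iterate and an accumulator. In the input, block \<open>k\<close> of the arc data starts at
  position \<open>3 + k m\<close>.\<close>

definition inp :: "int \<Rightarrow> aexp \<Rightarrow> aexp" where
  "inp k e = Arr 0 (Add (Const 3) (Add (Mul (Const k) (Reg 2)) e))"

definition load_prog :: com where
  "load_prog = Seq (Assign 1 (Arr 0 (Const 0))) (Seq (Assign 2 (Arr 0 (Const 1))) (Assign 3 (Arr 0 (Const 2))))"

definition divisor_prog :: com where
  "divisor_prog = For 4 1 (Store 1 (Reg 4) (inp 5 (Reg 4)))"

definition degree_prog :: com where
  "degree_prog = For 4 2 (Store 2 (inp 0 (Reg 4)) (Add (Arr 2 (inp 0 (Reg 4))) (Const 1)))"

text \<open>One chip is sent along each arc reached. The test comes before the step, so a rotor that
  already agrees with \<open>T\<^sub>2\<close> does not move, as in \<open>turn\<close>.\<close>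

definition rotate_prog :: com where
  "rotate_prog = While (Equal (inp 4 (Reg 5)) (Const 0))
     (Seq (Assign 5 (inp 2 (Reg 5)))
     (Seq (Store 1 (inp 1 (Reg 5)) (Add (Arr 1 (inp 1 (Reg 5))) (Const 1)))
       (Store 1 (inp 0 (Reg 5)) (Sub (Arr 1 (inp 0 (Reg 5))) (Const 1)))))"

definition turn_prog :: com where
  "turn_prog = For 4 2 (Seq
     (If (Equal (inp 3 (Reg 4)) (Const 1)) (Seq (Assign 5 (Reg 4)) rotate_prog) Skip)
     (Assign 5 (Const 0)))"

definition norm_prog :: com where
  "norm_prog = For 4 1 (If (Less (Arr 1 (Reg 4)) (Const 0))
     (Assign 6 (Sub (Reg 6) (Arr 1 (Reg 4)))) (Assign 6 (Add (Reg 6) (Arr 1 (Reg 4)))))"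

text \<open>Register 7 receives the number of sweeps per halving, \<open>2 * hit + 1\<close>,
  register 8 the scaling factor \<open>M\<close>, and register 9 a bound on the initial
  error.\<close>

definition params_prog :: com where
  "params_prog = Seq (Assign 7 (Add (Mul (Const 4) (Mul (Mul (Reg 1) (Reg 1)) (Reg 2))) (Const 1)))
     (Seq (Assign 8 (Add (Reg 7) (Const 2))) (Assign 9 (Mul (Mul (Reg 8) (Reg 7)) (Reg 6))))"

definition accumulate_prog :: com where
  "accumulate_prog = For 4 2
     (Store 4 (inp 1 (Reg 4)) (Add (Arr 4 (inp 1 (Reg 4))) (Arr 3 (inp 0 (Reg 4)))))"

definition sweep_prog :: com where
  "sweep_prog = Seq (For 4 1 (Store 4 (Reg 4) (Mul (Reg 8) (Arr 1 (Reg 4)))))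
     (Seq accumulate_prog
       (For 4 1 (If (Equal (Reg 4) (Reg 3)) Skip
          (Store 3 (Reg 4) (Div (Arr 4 (Reg 4)) (Arr 2 (Reg 4)))))))"

text \<open>Halving register 9 down to 0 performs one block of sweeps per bit of the error bound,
  without computing a logarithm.\<close>

definition iterate_prog :: com where
  "iterate_prog = While (Less (Const 0) (Reg 9))
     (Seq (For 10 7 sweep_prog) (Assign 9 (Div (Reg 9) (Const 2))))"

definition round_prog :: com where
  "round_prog = For 4 1 (Store 3 (Reg 4)
     (Div (Add (Mul (Const 2) (Arr 3 (Reg 4))) (Reg 8)) (Mul (Const 2) (Reg 8))))"

definition residue_prog :: com where
  "residue_prog = Seq
     (For 4 1 (Store 4 (Reg 4) (Sub (Arr 1 (Reg 4)) (Mul (Arr 2 (Reg 4)) (Arr 3 (Reg 4))))))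
     accumulate_prog"

definition answer_prog :: com where
  "answer_prog = Seq (Assign 0 (Const 1))
     (For 4 1 (If (Equal (Arr 4 (Reg 4)) (Const 0)) Skip (Assign 0 (Const 0))))"

definition decide_prog :: com where
  "decide_prog = Seq load_prog (Seq divisor_prog (Seq degree_prog (Seq turn_prog (Seq norm_prog
     (Seq params_prog (Seq iterate_prog (Seq round_prog (Seq residue_prog answer_prog))))))))"

locale rotor_instance = rotor_digraph G r nxt
  for G :: "(nat, nat) pre_digraph" (structure) and r :: nat and nxt :: "nat \<Rightarrow> nat" +
  fixes T\<^sub>1 T\<^sub>2 :: "nat set" and x :: "nat \<Rightarrow> int" and X :: nat
  assumes numbered: "numbered G" and T1: "T\<^sub>1 \<in> Arb G r" and T2: "T\<^sub>2 \<in> Arb G r"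
    and x: "x \<in> divisors0 G" and X: "\<And>v. v \<in> verts G \<Longrightarrow> \<bar>x v\<bar> \<le> int X"
begin

section \<open>Numbered instances and their memory bounds\<close>

definition n :: nat where "n = card (verts G)"
definition m :: nat where "m = card (arcs G)"

lemma verts_eq: "verts G = {..<n}" and arcs_eq: "arcs G = {..<m}"
  using numbered by (auto simp: numbered_def n_def m_def)

lemma arc_verts: "e < m \<Longrightarrow> tail G e < n" "e < m \<Longrightarrow> head G e < n"
  using wellformed[of e] by (auto simp: verts_eq arcs_eq)

lemma root_less: "r < n" using root by (simp add: verts_eq)

lemma nxt_less: "e < m \<Longrightarrow> nxt e < m" "e < m \<Longrightarrow> tail G (nxt e) = tail G e"
proof -
  assume "e < m"
  then have "e \<in> out_arcs G (tail G e)" by (simp add: arcs_eq)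
  from nxt_out[OF this] show "nxt e < m" "tail G (nxt e) = tail G e" by (simp_all add: arcs_eq)
qed

definition \<rho>\<^sub>1 :: "nat \<Rightarrow> nat" where "\<rho>\<^sub>1 = tree_rotor G r T\<^sub>1 0"
definition \<rho>\<^sub>2 :: "nat \<Rightarrow> nat" where "\<rho>\<^sub>2 = tree_rotor G r T\<^sub>2 0"
definition y :: "nat \<Rightarrow> int" where "y v = x v + excess (swing \<rho>\<^sub>1 \<rho>\<^sub>2) v"

definition P :: nat where "P = 2 * hit + 1"
definition M :: nat where "M = 2 * hit + 3"
definition Yb :: nat where "Yb = X + 2 * m * m"
definition Sb :: nat where "Sb = n * Yb"
definition Gb :: nat where "Gb = hit * (M * Sb + 1)"
definition Hb :: nat where "Hb = 2 * Gb + M"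
text \<open>A common bound on all memory cells during the run. With a sum of nonnegative quantities,
  each single bound in \<open>B_ge\<close> is just membership in the list.\<close>

definition B :: int where
  "B = int (sum_list [X, n, m, 1, Yb, Sb, P, M, M * P * Sb, M * Sb + m * Gb, Gb, Hb, Yb + 2 * (m * Hb)])"

definition idx :: "int \<Rightarrow> nat \<Rightarrow> int" where
  "idx k j = 3 + (k * int m + int j)"

definition in_ok :: "(int \<Rightarrow> int) \<Rightarrow> bool" where
  "in_ok a \<longleftrightarrow> (\<forall>e<m. a (idx 0 e) = int (tail G e) \<and> a (idx 1 e) = int (head G e) \<and>
      a (idx 2 e) = int (nxt e) \<and> a (idx 3 e) = of_bool (e \<in> T\<^sub>1) \<and> a (idx 4 e) = of_bool (e \<in> T\<^sub>2)) \<and>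
    (\<forall>v<n. a (idx 5 v) = x v)"

definition ar :: "(nat \<Rightarrow> int) \<Rightarrow> (nat \<Rightarrow> int) \<Rightarrow> (nat \<Rightarrow> int) \<Rightarrow> (nat \<Rightarrow> int) \<Rightarrow> (nat \<Rightarrow> int \<Rightarrow> int) \<Rightarrow> bool" where
  "ar Y D F A f \<longleftrightarrow> in_ok (f 0) \<and>
     (\<forall>v<n. f 1 (int v) = Y v \<and> f 2 (int v) = D v \<and> f 3 (int v) = F v \<and> f 4 (int v) = A v)"

lemma ar_cong:
  assumes "\<And>v. v < n \<Longrightarrow> Y v = Y' v" "\<And>v. v < n \<Longrightarrow> D v = D' v" "\<And>v. v < n \<Longrightarrow> F v = F' v"
    "\<And>v. v < n \<Longrightarrow> A v = A' v"
  shows "ar Y D F A = ar Y' D' F' A'"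
  unfolding ar_def using assms by (intro ext) auto

lemma st_regs: "st R K s \<Longrightarrow> regs s = R"
  by (simp add: st_def)

lemma st_arrs:
  assumes "st R (ar Y D F A) s" "v < n"
  shows "arrs s 1 (int v) = Y v" "arrs s 2 (int v) = D v" "arrs s 3 (int v) = F v" "arrs s 4 (int v) = A v"
    "arrs s (Suc 0) (int v) = Y v"
  using assms by (auto simp: st_def ar_def)

lemma aval_inp:
  assumes "st R (ar Y D F A) s" "R 2 = int m" "aval c s = int e" "e < m"
  shows "aval (inp 0 c) s = int (tail G e)" "aval (inp 1 c) s = int (head G e)" "aval (inp 2 c) s = int (nxt e)"
    "aval (inp 3 c) s = of_bool (e \<in> T\<^sub>1)" "aval (inp 4 c) s = of_bool (e \<in> T\<^sub>2)"
proof -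
  have "aval (inp k c) s = arrs s 0 (idx k e)" for k
    using assms by (simp add: inp_def idx_def st_def)
  then show "aval (inp 0 c) s = int (tail G e)" "aval (inp 1 c) s = int (head G e)" "aval (inp 2 c) s = int (nxt e)"
    "aval (inp 3 c) s = of_bool (e \<in> T\<^sub>1)" "aval (inp 4 c) s = of_bool (e \<in> T\<^sub>2)"
    using assms by (auto simp: st_def ar_def in_ok_def)
qed

lemma aval_inp5:
  assumes "st R (ar Y D F A) s" "R 2 = int m" "aval c s = int v" "v < n"
  shows "aval (inp 5 c) s = x v"
proof -
  have "aval (inp 5 c) s = arrs s 0 (idx 5 v)"
    using assms by (simp add: inp_def idx_def st_def)
  then show ?thesis using assms by (auto simp: st_def ar_def in_ok_def)
qed

lemma hoare_Store1:
  assumes "\<And>s. st R (ar Y D F A) s \<Longrightarrow> aval a s = z" "\<And>s. st R (ar Y D F A) s \<Longrightarrow> aval j s = int v"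
    "\<bar>z\<bar> \<le> B" "v < n" "\<And>u. u < n \<Longrightarrow> Y' u = (Y(v := z)) u"
  shows "hoare B (st R (ar Y D F A)) (Store 1 j a) 1 (st R (ar Y' D F A))"
  by (rule hoare_Store_st[OF assms(1,2,3)]) (use assms(4,5) in \<open>auto simp: ar_def\<close>)

lemma hoare_Store2:
  assumes "\<And>s. st R (ar Y D F A) s \<Longrightarrow> aval a s = z" "\<And>s. st R (ar Y D F A) s \<Longrightarrow> aval j s = int v"
    "\<bar>z\<bar> \<le> B" "v < n" "\<And>u. u < n \<Longrightarrow> D' u = (D(v := z)) u"
  shows "hoare B (st R (ar Y D F A)) (Store 2 j a) 1 (st R (ar Y D' F A))"
  by (rule hoare_Store_st[OF assms(1,2,3)]) (use assms(4,5) in \<open>auto simp: ar_def\<close>)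

lemma hoare_Store3:
  assumes "\<And>s. st R (ar Y D F A) s \<Longrightarrow> aval a s = z" "\<And>s. st R (ar Y D F A) s \<Longrightarrow> aval j s = int v"
    "\<bar>z\<bar> \<le> B" "v < n" "\<And>u. u < n \<Longrightarrow> F' u = (F(v := z)) u"
  shows "hoare B (st R (ar Y D F A)) (Store 3 j a) 1 (st R (ar Y D F' A))"
  by (rule hoare_Store_st[OF assms(1,2,3)]) (use assms(4,5) in \<open>auto simp: ar_def\<close>)

lemma hoare_Store4:
  assumes "\<And>s. st R (ar Y D F A) s \<Longrightarrow> aval a s = z" "\<And>s. st R (ar Y D F A) s \<Longrightarrow> aval j s = int v"
    "\<bar>z\<bar> \<le> B" "v < n" "\<And>u. u < n \<Longrightarrow> A' u = (A(v := z)) u"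
  shows "hoare B (st R (ar Y D F A)) (Store 4 j a) 1 (st R (ar Y D F A'))"
  by (rule hoare_Store_st[OF assms(1,2,3)]) (use assms(4,5) in \<open>auto simp: ar_def\<close>)

lemma B_ge: "int n \<le> B" "int m \<le> B" "int X \<le> B" "int Yb \<le> B" "int Sb \<le> B" "int P \<le> B" "int M \<le> B"
  "int (M * P * Sb) \<le> B" "int (M * Sb + m * Gb) \<le> B" "int Gb \<le> B" "int Hb \<le> B"
  "int (Yb + 2 * (m * Hb)) \<le> B" "int 1 \<le> B"
  unfolding B_def of_nat_le_iff by (rule member_le_sum_list; simp)+

definition base :: "(nat \<Rightarrow> int) \<Rightarrow> bool" where
  "base R \<longleftrightarrow> R 1 = int n \<and> R 2 = int m \<and> R 3 = int r \<and> R 4 = 0 \<and> R 5 = 0"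

lemma baseD: "base R \<Longrightarrow> R 1 = int n" "base R \<Longrightarrow> R 2 = int m" "base R \<Longrightarrow> R 3 = int r"
  "base R \<Longrightarrow> R (Suc 0) = int n" "base R \<Longrightarrow> R 4 = 0" "base R \<Longrightarrow> R 5 = 0"
  by (auto simp: base_def)

lemma divisor_prog_spec:
  assumes R: "base R"
  shows "hoare B (st R (ar Y D F A)) divisor_prog (n * (1 + 2) + 2) (st R (ar x D F A))"
proof -
  let ?Y = "\<lambda>k v. if v < k then x v else Y v"
  have "hoare B (st R (ar (?Y 0) D F A)) divisor_prog (n * (1 + 2) + 2) (st R (ar (?Y n) D F A))"
    unfolding divisor_prog_def
  proof (rule hoare_For[where Rf="\<lambda>_. R" and K="\<lambda>k. ar (?Y k) D F A"])
    fix k assume k: "k < n"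
    have *: "aval (inp 5 (Reg 4)) s = x k" if "st (R(4 := int k)) (ar (?Y k) D F A) s" for s
      by (rule aval_inp5[OF that]) (use R k that in \<open>auto simp: baseD st_def\<close>)
    show "hoare B (st (R(4 := int k)) (ar (?Y k) D F A)) (Store 1 (Reg 4) (inp 5 (Reg 4))) 1
        (st (R(4 := int k)) (ar (?Y (Suc k)) D F A))"
      by (rule hoare_Store1[where v=k and z="x k"])
        (use * k X[of k] B_ge(3) in \<open>auto simp: st_def verts_eq less_Suc_eq\<close>)
  qed (use R B_ge in \<open>auto simp: baseD\<close>)
  moreover have "ar (?Y 0) D F A = ar Y D F A" "ar (?Y n) D F A = ar x D F A" by (auto intro!: ar_cong)
  ultimately show ?thesis by (simp only:)
qed

lemma degree_prog_spec:
  assumes R: "base R"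
  shows "hoare B (st R (ar Y (\<lambda>_. 0) F A)) degree_prog (m * (1 + 2) + 2) (st R (ar Y (\<lambda>v. int (out_degree G v)) F A))"
proof -
  let ?D = "\<lambda>k v. int (card {e. e < k \<and> tail G e = v})"
  have "hoare B (st R (ar Y (?D 0) F A)) degree_prog (m * (1 + 2) + 2) (st R (ar Y (?D m) F A))"
    unfolding degree_prog_def
  proof (rule hoare_For[where Rf="\<lambda>_. R" and K="\<lambda>k. ar Y (?D k) F A"])
    fix k assume k: "k < m"
    have *: "aval (inp 0 (Reg 4)) s = int (tail G k)" if "st (R(4 := int k)) (ar Y (?D k) F A) s" for s
      by (rule aval_inp[OF that]) (use R k that in \<open>auto simp: baseD st_def\<close>)
    have Suc: "?D (Suc k) v = (if v = tail G k then ?D k v + 1 else ?D k v)" for v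
    proof -
      have "{e. e < Suc k \<and> tail G e = v} = (if v = tail G k then insert k {e. e < k \<and> tail G e = v}
          else {e. e < k \<and> tail G e = v})" by (auto simp: less_Suc_eq)
      then show ?thesis by simp
    qed
    have "card {e. e < k \<and> tail G e = tail G k} \<le> card {..<k}" by (rule card_mono) auto
    then have le: "\<bar>?D k (tail G k) + 1\<bar> \<le> B" using k B_ge(2) by simp
    show "hoare B (st (R(4 := int k)) (ar Y (?D k) F A))
        (Store 2 (inp 0 (Reg 4)) (Add (Arr 2 (inp 0 (Reg 4))) (Const 1))) 1
        (st (R(4 := int k)) (ar Y (?D (Suc k)) F A))"
      by (rule hoare_Store2[where v="tail G k" and z="?D k (tail G k) + 1"])
        (use le arc_verts(1)[OF k] in \<open>auto simp: * st_arrs Suc\<close>)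
  qed (use R B_ge in \<open>auto simp: baseD\<close>)
  moreover have "?D m = (\<lambda>v. int (out_degree G v))"
    by (auto simp: out_degree_def out_arcs_def arcs_eq)
  moreover have "?D 0 = (\<lambda>_. 0)" by simp
  ultimately show ?thesis by (simp only:)
qed

section \<open>Turning the rotors from the first arborescence to the second\<close>

definition contrib :: "nat \<Rightarrow> nat \<Rightarrow> int" where
  "contrib a v = of_bool (v = head G a) - of_bool (v = tail G a)"

definition steps :: "nat \<Rightarrow> nat" where
  "steps e = funpow_dist nxt e (\<rho>\<^sub>2 (tail G e))"

lemma T1_tail: "e \<in> T\<^sub>1 \<Longrightarrow> tail G e \<in> verts G - {r} \<and> \<rho>\<^sub>1 (tail G e) = e"
proof -
  assume "e \<in> T\<^sub>1"
  then obtain v where v: "v \<in> verts G - {r}" "e = \<rho>\<^sub>1 v"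
    using Arb_rotor(3)[OF T1, of 0] unfolding \<rho>\<^sub>1_def by blast
  moreover have "tail G e = v" using Arb_rotor(4)[OF T1 v(1), of e 0] v(2) by (simp add: \<rho>\<^sub>1_def)
  ultimately show ?thesis by simp
qed

lemma rotor_out: "v \<in> verts G - {r} \<Longrightarrow> \<rho>\<^sub>1 v \<in> out_arcs G v \<and> \<rho>\<^sub>2 v \<in> out_arcs G v"
  using Arb_rotor(1)[OF T1, of 0] Arb_rotor(1)[OF T2, of 0]
  unfolding rotor_conf_def \<rho>\<^sub>1_def \<rho>\<^sub>2_def by blast

context
  fixes e assumes eT: "e \<in> T\<^sub>1"
begin

lemma rot_arc: "(nxt ^^ j) e < m \<and> tail G ((nxt ^^ j) e) = tail G e"
proof (induction j)
  case 0
  have "e \<in> arcs G" using eT T1 by (auto simp: Arb_def)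
  then show ?case by (simp add: arcs_eq)
qed (simp add: nxt_less)

lemma rot_out: "(nxt ^^ j) e \<in> out_arcs G (tail G e)"
  using rot_arc[of j] by (simp add: arcs_eq)

text \<open>Exactly one arc of \<open>T\<^sub>2\<close> leaves this vertex, so the characteristic
  vector alone tells the loop where to stop.\<close>

lemma rot_in_T2: "(nxt ^^ j) e \<in> T\<^sub>2 \<longleftrightarrow> (nxt ^^ j) e = \<rho>\<^sub>2 (tail G e)"
  using Arb_rotor(4)[OF T2, of "tail G e" "(nxt ^^ j) e" 0] T1_tail[OF eT] rot_arc[of j] by (simp add: \<rho>\<^sub>2_def)

lemma e_out: "e \<in> out_arcs G (tail G e)" "\<rho>\<^sub>2 (tail G e) \<in> out_arcs G (tail G e)"
  using rot_out[of 0] rotor_out T1_tail[OF eT] by auto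

lemma steps_stop: "(nxt ^^ steps e) e \<in> T\<^sub>2" "j < steps e \<Longrightarrow> (nxt ^^ j) e \<notin> T\<^sub>2"
  unfolding rot_in_T2 steps_def
  using funpow_dist_cyclic[OF cyclic_out[OF e_out(1)] e_out]
    funpow_dist_least[of j nxt e "\<rho>\<^sub>2 (tail G e)"] by auto

lemma rot_inj: "inj_on (\<lambda>j. (nxt ^^ j) e) {0..steps e}"
proof -
  have "\<rho>\<^sub>2 (tail G e) \<in> orbit nxt e"
    using cyclic_out[OF e_out(1)] e_out by (auto simp: cyclic_on_alldef)
  then show ?thesis unfolding steps_def by (rule inj_on_funpow_dist)
qed

lemma steps_le: "steps e \<le> m"
proof -
  have "card ((\<lambda>j. (nxt ^^ j) e) ` {0..steps e}) = Suc (steps e)" by (simp add: card_image[OF rot_inj])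
  moreover have "card ((\<lambda>j. (nxt ^^ j) e) ` {0..steps e}) \<le> card {..<m}"
    using rot_arc by (intro card_mono) auto
  ultimately show ?thesis by simp
qed

end

definition Yturn :: "nat \<Rightarrow> nat \<Rightarrow> int" where
  "Yturn e v = (\<Sum>j=1..steps e. contrib ((nxt ^^ j) e) v)"

definition Yacc :: "nat \<Rightarrow> nat \<Rightarrow> int" where
  "Yacc k v = x v + (\<Sum>e | e < k \<and> e \<in> T\<^sub>1. Yturn e v)"

lemma contrib_le: "\<bar>contrib a v\<bar> \<le> 1"
  by (simp add: contrib_def of_bool_def)

lemma partial_turn_le: "\<bar>\<Sum>i=1..j. contrib ((nxt ^^ i) e) v\<bar> \<le> int j"
proof -
  have "\<bar>\<Sum>i=1..j. contrib ((nxt ^^ i) e) v\<bar> \<le> (\<Sum>i=1..j. \<bar>contrib ((nxt ^^ i) e) v\<bar>)" by (rule sum_abs)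
  also have "\<dots> \<le> (\<Sum>i=1..j. 1)" by (intro sum_mono contrib_le)
  finally show ?thesis by simp
qed

lemma Yacc_le:
  assumes "v < n" shows "\<bar>Yacc k v\<bar> \<le> int (X + k * m)"
proof -
  have "\<bar>\<Sum>e | e < k \<and> e \<in> T\<^sub>1. Yturn e v\<bar> \<le> (\<Sum>e | e < k \<and> e \<in> T\<^sub>1. \<bar>Yturn e v\<bar>)" by (rule sum_abs)
  also have "\<dots> \<le> (\<Sum>e | e < k \<and> e \<in> T\<^sub>1. int m)"
  proof (rule sum_mono)
    fix e assume "e \<in> {e. e < k \<and> e \<in> T\<^sub>1}"
    then have "steps e \<le> m" by (intro steps_le) simp
    then show "\<bar>Yturn e v\<bar> \<le> int m" using partial_turn_le[of e v "steps e"] by (simp add: Yturn_def)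
  qed
  also have "\<dots> = int (card {e. e < k \<and> e \<in> T\<^sub>1} * m)" by simp
  also have "\<dots> \<le> int (k * m)"
  proof -
    have "card {e. e < k \<and> e \<in> T\<^sub>1} \<le> card {..<k}" by (rule card_mono) auto
    then show ?thesis by (simp only: of_nat_le_iff card_lessThan mult_le_mono1)
  qed
  finally show ?thesis using X[of v] assms by (simp add: Yacc_def verts_eq)
qed

text \<open>The moves made turn by turn are regrouped by arcs: the arcs of \<open>T\<^sub>1\<close>
  are the initial rotors, the arcs met in one turn are distinct, and out-arcs of the root contribute
  nothing. Splitting each move into its head and tail part gives \<open>excess\<close>.\<close>

lemma Yacc_total:
  assumes "v < n" shows "Yacc m v = y v"
proof -
  have T1eq: "{e. e < m \<and> e \<in> T\<^sub>1} = \<rho>\<^sub>1 ` (verts G - {r})"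
    using Arb_rotor(3)[OF T1, of 0] T1 by (auto simp: \<rho>\<^sub>1_def Arb_def arcs_eq)
  have inj: "inj_on \<rho>\<^sub>1 (verts G - {r})"
  proof (rule inj_onI)
    fix u v assume "u \<in> verts G - {r}" "v \<in> verts G - {r}" "\<rho>\<^sub>1 u = \<rho>\<^sub>1 v"
    then show "u = v" using rotor_out[of u] rotor_out[of v] by auto
  qed
  have inT1: "\<rho>\<^sub>1 u \<in> T\<^sub>1" if "u \<in> verts G - {r}" for u using T1eq that by auto
  have tl: "tail G (\<rho>\<^sub>1 u) = u" if "u \<in> verts G - {r}" for u using rotor_out[OF that] by simp
  have turn: "Yturn (\<rho>\<^sub>1 u) v = (\<Sum>a\<in>out_arcs G u. swing \<rho>\<^sub>1 \<rho>\<^sub>2 a * contrib a v)" if u: "u \<in> verts G - {r}" for u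
  proof -
    have "inj_on (\<lambda>j. (nxt ^^ j) (\<rho>\<^sub>1 u)) {1..steps (\<rho>\<^sub>1 u)}"
      by (rule inj_on_subset[OF rot_inj[OF inT1[OF u]]]) auto
    then have "Yturn (\<rho>\<^sub>1 u) v = (\<Sum>a\<in>turn nxt (\<rho>\<^sub>1 u) (\<rho>\<^sub>2 u). contrib a v)"
      unfolding Yturn_def turn_def steps_def tl[OF u] by (subst sum.reindex) (auto simp: comp_def)
    also have "\<dots> = (\<Sum>a\<in>out_arcs G u. if a \<in> turn nxt (\<rho>\<^sub>1 u) (\<rho>\<^sub>2 u) then contrib a v else 0)"
    proof -
      have o: "\<rho>\<^sub>1 u \<in> out_arcs G u" using rotor_out[OF u] by blast
      have "turn nxt (\<rho>\<^sub>1 u) (\<rho>\<^sub>2 u) \<subseteq> out_arcs G u" by (rule turn_subset[OF cyclic_out[OF o] o])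
      then show ?thesis by (simp add: sum.If_cases finite_out_arcs Int_absorb1)
    qed
    also have "\<dots> = (\<Sum>a\<in>out_arcs G u. swing \<rho>\<^sub>1 \<rho>\<^sub>2 a * contrib a v)"
      using u by (intro sum.cong) (auto simp: swing_def)
    finally show ?thesis .
  qed
  have z: "(\<Sum>a\<in>out_arcs G r. swing \<rho>\<^sub>1 \<rho>\<^sub>2 a * contrib a v) = 0"
    by (intro sum.neutral) (auto simp: swing_def)
  have "Yacc m v - x v = (\<Sum>u\<in>verts G - {r}. Yturn (\<rho>\<^sub>1 u) v)"
    unfolding Yacc_def T1eq by (simp add: sum.reindex[OF inj])
  also have "\<dots> = (\<Sum>u\<in>verts G - {r}. \<Sum>a\<in>out_arcs G u. swing \<rho>\<^sub>1 \<rho>\<^sub>2 a * contrib a v)"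
    by (rule sum.cong[OF refl turn])
  also have "\<dots> = (\<Sum>u\<in>verts G. \<Sum>a\<in>out_arcs G u. swing \<rho>\<^sub>1 \<rho>\<^sub>2 a * contrib a v)"
    using z root by (simp add: sum.remove[of "verts G" r])
  also have "\<dots> = (\<Sum>a\<in>arcs G. swing \<rho>\<^sub>1 \<rho>\<^sub>2 a * contrib a v)" by (rule sum_out_arcs)
  also have "\<dots> = (\<Sum>a\<in>arcs G. if head G a = v then swing \<rho>\<^sub>1 \<rho>\<^sub>2 a else 0) - (\<Sum>a\<in>arcs G. if tail G a = v then swing \<rho>\<^sub>1 \<rho>\<^sub>2 a else 0)"
    unfolding sum_subtractf[symmetric] by (intro sum.cong) (auto simp: contrib_def)
  also have "\<dots> = excess (swing \<rho>\<^sub>1 \<rho>\<^sub>2) v"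
    by (simp add: excess_def in_arcs_def out_arcs_def sum.inter_filter)
  finally show ?thesis by (simp add: y_def)
qed


lemma rotate_prog_spec:
  assumes R: "base R" and e: "e \<in> T\<^sub>1" and k: "k < m"
    and Y: "\<And>v. v < n \<Longrightarrow> \<bar>Y v\<bar> \<le> int (X + k * m)"
  shows "hoare B (st (R(4 := int k, 5 := int e)) (ar Y D F A)) rotate_prog (m * (3 + 1) + 1)
    (st (R(4 := int k, 5 := int ((nxt ^^ steps e) e))) (ar (\<lambda>v. Y v + Yturn e v) D F A))"
proof -
  let ?c = "\<lambda>j. (nxt ^^ j) e"
  let ?Y = "\<lambda>j v. Y v + (\<Sum>i=1..j. contrib (?c i) v)"
  let ?I = "\<lambda>j. st (R(4 := int k, 5 := int (?c j))) (ar (?Y j) D F A)"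
  have c: "?c j < m" "tail G (?c j) = tail G e" for j using rot_arc[OF e] by auto
  have av: "aval (inp l (Reg 5)) s = (if l = 0 then int (tail G e) else if l = 1 then int (head G (?c j))
      else if l = 2 then int (nxt (?c j)) else of_bool (?c j \<in> T\<^sub>2))"
    if "st (R(4 := int k, 5 := int (?c j))) (ar Y' D F A) s" "l \<in> {0, 1, 2, 4}" for l j Y' s
  proof -
    have "aval (Reg 5) s = int (?c j)" using that by (simp add: st_def)
    note ev = aval_inp[OF that(1) _ this c(1)]
    show ?thesis using that(2) ev R c(2) by (auto simp: baseD)
  qed
  have body: "hoare B (?I j) (Seq (Assign 5 (inp 2 (Reg 5)))
     (Seq (Store 1 (inp 1 (Reg 5)) (Add (Arr 1 (inp 1 (Reg 5))) (Const 1)))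
       (Store 1 (inp 0 (Reg 5)) (Sub (Arr 1 (inp 0 (Reg 5))) (Const 1))))) (1 + (1 + 1)) (?I (Suc j))"
    if j: "j < steps e" for j
  proof (intro hoare_Seq)
    let ?a = "?c (Suc j)"
    let ?R = "R(4 := int k, 5 := int ?a)"
    let ?Z = "(?Y j)(head G ?a := ?Y j (head G ?a) + 1)"
    have "m \<ge> steps e" by (rule steps_le[OF e])
    then have jm: "j < m" using j by simp
    \<comment> \<open>The incoming bound allows for \<open>k\<close> turns of \<open>m\<close> moves
      each; the current turn adds at most \<open>m\<close>, and \<open>k + 1 <= m\<close>.\<close>
    have Yb: "\<bar>?Y j v\<bar> + 1 \<le> B" if "v < n" for v
    proof -
      have "\<bar>?Y j v\<bar> + 1 \<le> int (X + k * m) + int j + 1"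
        using Y[OF that] partial_turn_le[of e v j] by linarith
      also have "\<dots> \<le> int (X + k * m + m)" using jm by simp
      also have "X + k * m + m \<le> Yb"
      proof -
        have "k * m + m = Suc k * m" by simp
        also have "\<dots> \<le> m * m" using k by (intro mult_le_mono1) simp
        finally show ?thesis by (simp add: Yb_def)
      qed
      finally show ?thesis using B_ge(4) by simp
    qed
    have h: "head G ?a < n" "tail G e < n" 
      using arc_verts(2)[OF c(1)[of "Suc j"]] arc_verts(1)[OF c(1)[of 0]] by auto
    have ht: "head G ?a \<noteq> tail G e" using no_loop[of ?a] c[of "Suc j"] by (auto simp: arcs_eq)
    have "hoare B (?I j) (Assign 5 (inp 2 (Reg 5))) 1 (st ((R(4 := int k, 5 := int (?c j)))(5 := int ?a)) (ar (?Y j) D F A))"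
      by (rule hoare_Assign_st) (use av[of j] c(1)[of "Suc j"] B_ge(2) in auto)
    then show "hoare B (?I j) (Assign 5 (inp 2 (Reg 5))) 1 (st ?R (ar (?Y j) D F A))" by simp
    show "hoare B (st ?R (ar (?Y j) D F A)) (Store 1 (inp 1 (Reg 5)) (Add (Arr 1 (inp 1 (Reg 5))) (Const 1))) 1
        (st ?R (ar ?Z D F A))"
      by (rule hoare_Store1[where v="head G ?a" and z="?Y j (head G ?a) + 1"])
        (use av[of "Suc j"] h Yb[OF h(1)] in \<open>auto simp: st_arrs simp del: funpow.simps\<close>)
    show "hoare B (st ?R (ar ?Z D F A)) (Store 1 (inp 0 (Reg 5)) (Sub (Arr 1 (inp 0 (Reg 5))) (Const 1))) 1
        (?I (Suc j))"
    proof (rule hoare_Store1[where v="tail G e" and z="?Y j (tail G e) - 1"])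
      show "?Y (Suc j) u = (?Z(tail G e := ?Y j (tail G e) - 1)) u" for u
        using ht c(2)[of "Suc j"] by (auto simp: contrib_def simp del: funpow.simps)
    qed (use av[of "Suc j"] h Yb[OF h(2)] ht in \<open>auto simp: st_arrs simp del: funpow.simps\<close>)
  qed
  have "hoare B (?I 0) rotate_prog (steps e * ((1 + (1 + 1)) + 1) + 1) (?I (steps e))"
    unfolding rotate_prog_def
  proof (rule hoare_While[where I="?I"])
    show "bval (Equal (inp 4 (Reg 5)) (Const 0)) s" if "j < steps e" "?I j s" for j s
      using av[OF that(2), of 4] steps_stop(2)[OF e that(1)] by simp
    show "\<not> bval (Equal (inp 4 (Reg 5)) (Const 0)) s" if "?I (steps e) s" for s
      using av[OF that, of 4] steps_stop(1)[OF e] by simp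
  qed (rule body)
  then show ?thesis
    by (rule hoare_conseq) (use steps_le[OF e] in \<open>auto simp: Yturn_def\<close>)
qed

lemma turn_prog_spec:
  assumes R: "base R"
  shows "hoare B (st R (ar x D F A)) turn_prog (m * ((1 + (m * (3 + 1) + 1) + 1 + 1) + 2) + 2) (st R (ar y D F A))"
proof -
  have "hoare B (st R (ar (Yacc 0) D F A)) turn_prog (m * ((1 + (m * (3 + 1) + 1) + 1 + 1) + 2) + 2) (st R (ar (Yacc m) D F A))"
    unfolding turn_prog_def
  proof (rule hoare_For[where Rf="\<lambda>_. R" and K="\<lambda>k. ar (Yacc k) D F A"])
    fix k assume k: "k < m"
    let ?R = "R(4 := int k)"
    have av: "aval (inp 3 (Reg 4)) s = of_bool (k \<in> T\<^sub>1)" if "st ?R (ar (Yacc k) D F A) s" for s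
      by (rule aval_inp[OF that]) (use R k that in \<open>auto simp: baseD st_def\<close>)
    \<comment> \<open>The branches leave different arcs in register 5; only the subsequent reset
      makes the states agree, so this value is kept existential.\<close>
    obtain z where "hoare B (st ?R (ar (Yacc k) D F A))
        (If (Equal (inp 3 (Reg 4)) (Const 1)) (Seq (Assign 5 (Reg 4)) rotate_prog) Skip)
        (1 + (m * (3 + 1) + 1) + 1) (st (?R(5 := z)) (ar (Yacc (Suc k)) D F A))"
    proof (cases "k \<in> T\<^sub>1")
      case True
      have ins: "{e. e < Suc k \<and> e \<in> T\<^sub>1} = insert k {e. e < k \<and> e \<in> T\<^sub>1}"
        using True by (auto simp: less_Suc_eq)
      have Suc: "Yacc (Suc k) = (\<lambda>v. Yacc k v + Yturn k v)"
        unfolding Yacc_def fun_eq_iff ins by (subst sum.insert) auto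
      have "hoare B (st ?R (ar (Yacc k) D F A))
        (If (Equal (inp 3 (Reg 4)) (Const 1)) (Seq (Assign 5 (Reg 4)) rotate_prog) Skip)
        (1 + (m * (3 + 1) + 1) + 1) (st (?R(5 := int ((nxt ^^ steps k) k))) (ar (Yacc (Suc k)) D F A))"
      proof (rule hoare_If_True)
        show "hoare B (st ?R (ar (Yacc k) D F A)) (Seq (Assign 5 (Reg 4)) rotate_prog)
          (1 + (m * (3 + 1) + 1)) (st (?R(5 := int ((nxt ^^ steps k) k))) (ar (Yacc (Suc k)) D F A))"
          unfolding Suc
        proof (rule hoare_Seq)
          show "hoare B (st ?R (ar (Yacc k) D F A)) (Assign 5 (Reg 4)) 1 (st (?R(5 := int k)) (ar (Yacc k) D F A))"
            by (rule hoare_Assign_st) (use k B_ge(2) in \<open>auto simp: st_def\<close>)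
        qed (rule rotate_prog_spec[OF R True k Yacc_le])
      qed (use av True in auto)
      then show ?thesis by (rule that)
    next
      case False
      then have same: "{e. e < Suc k \<and> e \<in> T\<^sub>1} = {e. e < k \<and> e \<in> T\<^sub>1}" by (auto simp: less_Suc_eq)
      have Suc: "Yacc (Suc k) = Yacc k" unfolding Yacc_def fun_eq_iff same by simp
      have R5: "?R(5 := 0) = ?R" using R by (auto simp: baseD)
      have "hoare B (st ?R (ar (Yacc k) D F A))
        (If (Equal (inp 3 (Reg 4)) (Const 1)) (Seq (Assign 5 (Reg 4)) rotate_prog) Skip)
        (1 + 1) (st (?R(5 := 0)) (ar (Yacc (Suc k)) D F A))"
        unfolding Suc R5 by (rule hoare_If_False) (use av False in \<open>auto intro!: hoare_Skip[simplified]\<close>)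
      then show ?thesis by (intro that, rule hoare_conseq) auto
    qed
    moreover have "hoare B (st (?R(5 := z)) (ar (Yacc (Suc k)) D F A)) (Assign 5 (Const 0)) 1 (st ?R (ar (Yacc (Suc k)) D F A))"
    proof -
      have "hoare B (st (?R(5 := z)) (ar (Yacc (Suc k)) D F A)) (Assign 5 (Const 0)) 1 (st (?R(5 := z, 5 := 0)) (ar (Yacc (Suc k)) D F A))"
        by (rule hoare_Assign_st) (use B_ge(13) in auto)
      moreover have "?R(5 := z, 5 := 0) = ?R" using R by (auto simp: baseD)
      ultimately show ?thesis by (simp only:)
    qed
    ultimately show "hoare B (st ?R (ar (Yacc k) D F A)) (Seq
     (If (Equal (inp 3 (Reg 4)) (Const 1)) (Seq (Assign 5 (Reg 4)) rotate_prog) Skip)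
     (Assign 5 (Const 0))) (1 + (m * (3 + 1) + 1) + 1 + 1) (st ?R (ar (Yacc (Suc k)) D F A))"
      by (rule hoare_Seq)
  qed (use R B_ge in \<open>auto simp: baseD\<close>)
  moreover have "ar (Yacc 0) D F A = ar x D F A" "ar (Yacc m) D F A = ar y D F A"
    by (auto intro!: ar_cong simp: Yacc_total) (simp add: Yacc_def)
  ultimately show ?thesis by (simp only:)
qed

lemma y_le: "v < n \<Longrightarrow> \<bar>y v\<bar> \<le> int Yb"
proof -
  assume v: "v < n"
  have "\<bar>y v\<bar> \<le> int (X + m * m)" using Yacc_le[OF v, of m] by (simp only: Yacc_total[OF v])
  also have "\<dots> \<le> int Yb" unfolding Yb_def of_nat_le_iff by simp
  finally show ?thesis .
qed

text \<open>The sum of absolute values serves as the bound on \<open>y\<close> that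
  \<open>solvable_iff_rounded\<close> asks for.\<close>

definition S :: int where "S = (\<Sum>v<n. \<bar>y v\<bar>)"

lemma y_le_S: "v < n \<Longrightarrow> \<bar>y v\<bar> \<le> S"
  unfolding S_def by (rule member_le_sum) auto

lemma partial_norm_le: "k \<le> n \<Longrightarrow> (\<Sum>v<k. \<bar>y v\<bar>) \<le> int Sb"
proof -
  assume k: "k \<le> n"
  have "(\<Sum>v<k. \<bar>y v\<bar>) \<le> (\<Sum>v<k. int Yb)" by (rule sum_mono) (use k y_le in auto)
  also have "\<dots> = int (k * Yb)" by simp
  also have "\<dots> \<le> int Sb" unfolding Sb_def of_nat_le_iff using k by (rule mult_le_mono1)
  finally show ?thesis .
qed

lemma S_le: "0 \<le> S" "S \<le> int Sb"
  using partial_norm_le[of n] by (auto simp: S_def sum_nonneg)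

lemma norm_prog_spec:
  assumes R: "base R" and R6: "R 6 = 0"
  shows "hoare B (st R (ar y D F A)) norm_prog (n * (1 + 1 + 2) + 2) (st (R(6 := S)) (ar y D F A))"
proof -
  let ?R = "\<lambda>k. R(6 := \<Sum>v<k. \<bar>y v\<bar>)"
  have "hoare B (st (?R 0) (ar y D F A)) norm_prog (n * (1 + 1 + 2) + 2) (st (?R n) (ar y D F A))"
    unfolding norm_prog_def
  proof (rule hoare_For[where Rf="?R" and K="\<lambda>_. ar y D F A"])
    fix k assume k: "k < n"
    let ?Q = "(?R k)(4 := int k)"
    have eq: "?Q(6 := \<Sum>v<Suc k. \<bar>y v\<bar>) = (?R (Suc k))(4 := int k)" by auto
    have av: "aval (Arr 1 (Reg 4)) s = y k" if "st ?Q (ar y D F A) s" for s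
      using st_arrs[OF that k] that by (simp add: st_def)
    have b: "\<bar>\<Sum>v<Suc k. \<bar>y v\<bar>\<bar> \<le> B"
      using partial_norm_le[of "Suc k"] k B_ge(5) by (simp add: sum_nonneg)
    show "hoare B (st ?Q (ar y D F A)) (If (Less (Arr 1 (Reg 4)) (Const 0))
        (Assign 6 (Sub (Reg 6) (Arr 1 (Reg 4)))) (Assign 6 (Add (Reg 6) (Arr 1 (Reg 4))))) (1 + 1)
        (st ((?R (Suc k))(4 := int k)) (ar y D F A))"
    proof (cases "y k < 0")
      case True
      show ?thesis unfolding eq[symmetric]
        by (rule hoare_If_True, use av True in simp, rule hoare_Assign_st)
          (use av True b in \<open>auto simp: st_def\<close>)
    next
      case False
      show ?thesis unfolding eq[symmetric]
        by (rule hoare_If_False, use av False in simp, rule hoare_Assign_st)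
          (use av False b in \<open>auto simp: st_def\<close>)
    qed
  qed (use R B_ge in \<open>auto simp: baseD\<close>)
  moreover have "?R 0 = R" "?R n = R(6 := S)" using R6 by (auto simp: S_def)
  ultimately show ?thesis by (simp only:)
qed

section \<open>Parameters and Jacobi sweeps\<close>

lemma P_eq: "int P = 4 * (int n * int n * int m) + 1"
  by (simp add: P_def hit_def n_def m_def power2_eq_square)

lemma M_eq: "int M = int P + 2"
  by (simp add: P_def M_def)

text \<open>Dominates the initial error \<open>M * (2 * hit) * S\<close>; the factor
  \<open>2 * hit\<close> is rounded up to \<open>P\<close>, which is already in a register.\<close>

definition E\<^sub>0 :: int where "E\<^sub>0 = int M * int P * S"

lemma E0_le: "0 \<le> E\<^sub>0" "E\<^sub>0 \<le> int (M * P * Sb)"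
  using S_le by (auto simp: E\<^sub>0_def mult_left_mono)

lemma params_prog_spec:
  assumes R: "base R" and R6: "R 6 = S"
  shows "hoare B (st R K) params_prog (1 + (1 + 1)) (st (R(7 := int P, 8 := int M, 9 := E\<^sub>0)) K)"
  unfolding params_prog_def
proof (intro hoare_Seq)
  show "hoare B (st R K) (Assign 7 (Add (Mul (Const 4) (Mul (Mul (Reg 1) (Reg 1)) (Reg 2))) (Const 1))) 1 (st (R(7 := int P)) K)"
    by (rule hoare_Assign_st) (use R B_ge in \<open>auto simp: st_def baseD P_eq\<close>)
  show "hoare B (st (R(7 := int P)) K) (Assign 8 (Add (Reg 7) (Const 2))) 1 (st (R(7 := int P, 8 := int M)) K)"
    by (rule hoare_Assign_st) (use R B_ge in \<open>auto simp: st_def baseD M_eq\<close>)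
  show "hoare B (st (R(7 := int P, 8 := int M)) K) (Assign 9 (Mul (Mul (Reg 8) (Reg 7)) (Reg 6))) 1
      (st (R(7 := int P, 8 := int M, 9 := E\<^sub>0)) K)"
    by (rule hoare_Assign_st) (use R R6 E0_le B_ge(8) in \<open>auto simp: st_def baseD E\<^sub>0_def\<close>)
qed

definition accum :: "(nat \<Rightarrow> int) \<Rightarrow> (nat \<Rightarrow> int) \<Rightarrow> nat \<Rightarrow> nat \<Rightarrow> int" where
  "accum A F k v = A v + (\<Sum>e | e < k \<and> head G e = v. F (tail G e))"

lemma accum_total: "accum A F m v = A v + (\<Sum>e\<in>in_arcs G v. F (tail G e))"
  by (simp add: accum_def in_arcs_def arcs_eq)

lemma accumulate_prog_spec:
  assumes R: "base R" and A: "\<And>v. v < n \<Longrightarrow> \<bar>A v\<bar> \<le> a" and F: "\<And>v. v < n \<Longrightarrow> \<bar>F v\<bar> \<le> b"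
    and ab: "a + int m * b \<le> B"
  shows "hoare B (st R (ar Y D F A)) accumulate_prog (m * (1 + 2) + 2) (st R (ar Y D F (accum A F m)))"
proof -
  have b0: "b \<ge> 0" using F[OF root_less] by simp
  have "hoare B (st R (ar Y D F (accum A F 0))) accumulate_prog (m * (1 + 2) + 2) (st R (ar Y D F (accum A F m)))"
    unfolding accumulate_prog_def
  proof (rule hoare_For[where Rf="\<lambda>_. R" and K="\<lambda>k. ar Y D F (accum A F k)"])
    fix k assume k: "k < m"
    let ?R = "R(4 := int k)"
    have av: "aval (inp 0 (Reg 4)) s = int (tail G k)" "aval (inp 1 (Reg 4)) s = int (head G k)"
      if "st ?R (ar Y D F (accum A F k)) s" for s
      by (rule aval_inp[OF that], use R k that in \<open>auto simp: baseD st_def\<close>)+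
    have Suc: "accum A F (Suc k) v = (if v = head G k then accum A F k v + F (tail G k) else accum A F k v)" for v
    proof -
      have "{e. e < Suc k \<and> head G e = v} = (if v = head G k then insert k {e. e < k \<and> head G e = v}
          else {e. e < k \<and> head G e = v})" by (auto simp: less_Suc_eq)
      then show ?thesis by (simp add: accum_def)
    qed
    have bnd: "\<bar>accum A F j v\<bar> \<le> B" if "j \<le> m" "v < n" for j v
    proof -
      have "\<bar>\<Sum>e | e < j \<and> head G e = v. F (tail G e)\<bar> \<le> (\<Sum>e | e < j \<and> head G e = v. \<bar>F (tail G e)\<bar>)"
        by (rule sum_abs)
      also have "\<dots> \<le> (\<Sum>e | e < j \<and> head G e = v. b)"
        by (rule sum_mono) (use F arc_verts that in auto)
      also have "\<dots> = int (card {e. e < j \<and> head G e = v}) * b" by simp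
      also have "\<dots> \<le> int m * b"
      proof (rule mult_right_mono[OF _ b0])
        have "card {e. e < j \<and> head G e = v} \<le> card {..<j}" by (rule card_mono) auto
        then show "int (card {e. e < j \<and> head G e = v}) \<le> int m" using that by simp
      qed
      finally show ?thesis using A[OF that(2)] ab unfolding accum_def by linarith
    qed
    have h: "head G k < n" "tail G k < n" using arc_verts k by auto
    show "hoare B (st ?R (ar Y D F (accum A F k)))
        (Store 4 (inp 1 (Reg 4)) (Add (Arr 4 (inp 1 (Reg 4))) (Arr 3 (inp 0 (Reg 4))))) 1
        (st ?R (ar Y D F (accum A F (Suc k))))"
    proof (rule hoare_Store4[where v="head G k" and z="accum A F (Suc k) (head G k)"])
      show "\<bar>accum A F (Suc k) (head G k)\<bar> \<le> B" by (rule bnd) (use k h in auto)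
    qed (use h in \<open>auto simp: av st_arrs Suc\<close>)
  qed (use R B_ge in \<open>auto simp: baseD\<close>)
  moreover have "accum A F 0 = A" by (simp add: accum_def fun_eq_iff)
  ultimately show ?thesis by (simp only:)
qed

abbreviation deg :: "nat \<Rightarrow> int" where "deg v \<equiv> int (out_degree G v)"

abbreviation G\<^sub>t :: "nat \<Rightarrow> nat \<Rightarrow> int" where "G\<^sub>t t \<equiv> sweep (int M) y t"

lemma Gt_le: "v < n \<Longrightarrow> \<bar>G\<^sub>t t v\<bar> \<le> int Gb"
proof -
  assume v: "v < n"
  have "\<bar>G\<^sub>t t v\<bar> \<le> int hit * (int M * int Sb + 1)"
    by (rule sweep_bound) (use v y_le_S S_le in \<open>auto simp: verts_eq intro: order_trans\<close>)
  then show ?thesis unfolding Gb_def by (simp only: of_nat_mult of_nat_add of_nat_1)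
qed

text \<open>What the last sweep leaves in the accumulator. Naming it lets the loop assertion
  describe array 4 as well, starting from zeroed memory.\<close>

definition A\<^sub>t :: "nat \<Rightarrow> nat \<Rightarrow> int" where
  "A\<^sub>t t = (if t = 0 then (\<lambda>_. 0) else accum (\<lambda>v. int M * y v) (G\<^sub>t (t - 1)) m)"

text \<open>All sums over in-arcs are formed from the old iterate before array 3 is overwritten, so
  this is Jacobi and not Gauss-Seidel iteration, although the update is in place.\<close>

lemma sweep_prog_spec:
  assumes R: "base R" and R8: "R 8 = int M"
  shows "hoare B (st R (ar y deg (G\<^sub>t t) A)) sweep_prog
    ((n * (1 + 2) + 2) + ((m * (1 + 2) + 2) + (n * (1 + 1 + 2) + 2)))
    (st R (ar y deg (G\<^sub>t (Suc t)) (A\<^sub>t (Suc t))))"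
  unfolding sweep_prog_def
proof (intro hoare_Seq)
  have rr: "R 1 = int n" "R (Suc 0) = int n" "R 2 = int m" "R 3 = int r" "R 4 = 0" "R 5 = 0"
    using R by (auto simp: base_def)
  let ?A = "\<lambda>k v. if v < k then int M * y v else A v"
  let ?C = "accum (\<lambda>v. int M * y v) (G\<^sub>t t) m"
  have My: "\<bar>int M * y v\<bar> \<le> int (M * Sb)" if "v < n" for v
    using y_le_S[OF that] S_le by (auto simp: abs_mult intro!: mult_left_mono)
  have MyB: "int (M * Sb) \<le> B" using B_ge(9) by (rule order_trans[rotated]) simp
  have "hoare B (st R (ar y deg (G\<^sub>t t) (?A 0))) (For 4 1 (Store 4 (Reg 4) (Mul (Reg 8) (Arr 1 (Reg 4)))))
      (n * (1 + 2) + 2) (st R (ar y deg (G\<^sub>t t) (?A n)))"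
  proof (rule hoare_For[where Rf="\<lambda>_. R" and K="\<lambda>k. ar y deg (G\<^sub>t t) (?A k)"])
    fix k assume k: "k < n"
    show "hoare B (st (R(4 := int k)) (ar y deg (G\<^sub>t t) (?A k))) (Store 4 (Reg 4) (Mul (Reg 8) (Arr 1 (Reg 4)))) 1
        (st (R(4 := int k)) (ar y deg (G\<^sub>t t) (?A (Suc k))))"
      by (rule hoare_Store4[where v=k and z="int M * y k"])
        (use k My[OF k] MyB R8 in \<open>auto simp: st_regs st_arrs less_Suc_eq\<close>)
  qed (use rr B_ge in auto)
  moreover have "ar y deg (G\<^sub>t t) (?A 0) = ar y deg (G\<^sub>t t) A"
    "ar y deg (G\<^sub>t t) (?A n) = ar y deg (G\<^sub>t t) (\<lambda>v. int M * y v)" by (auto intro!: ar_cong)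
  ultimately show "hoare B (st R (ar y deg (G\<^sub>t t) A)) (For 4 1 (Store 4 (Reg 4) (Mul (Reg 8) (Arr 1 (Reg 4)))))
      (n * (1 + 2) + 2) (st R (ar y deg (G\<^sub>t t) (\<lambda>v. int M * y v)))" by (simp only:)
  show "hoare B (st R (ar y deg (G\<^sub>t t) (\<lambda>v. int M * y v))) accumulate_prog (m * (1 + 2) + 2)
      (st R (ar y deg (G\<^sub>t t) ?C))"
    by (rule accumulate_prog_spec[OF R My Gt_le]) (use B_ge(9) in auto)
  let ?F = "\<lambda>k v. if v < k then G\<^sub>t (Suc t) v else G\<^sub>t t v"
  have new: "G\<^sub>t (Suc t) v = ?C v div deg v" if "v < n" "v \<noteq> r" for v
    using that by (simp add: accum_total verts_eq)
  have "hoare B (st R (ar y deg (?F 0) ?C)) (For 4 1 (If (Equal (Reg 4) (Reg 3)) Skip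
          (Store 3 (Reg 4) (Div (Arr 4 (Reg 4)) (Arr 2 (Reg 4))))))
      (n * (1 + 1 + 2) + 2) (st R (ar y deg (?F n) ?C))"
  proof (rule hoare_For[where Rf="\<lambda>_. R" and K="\<lambda>k. ar y deg (?F k) ?C"])
    fix k assume k: "k < n"
    let ?R = "R(4 := int k)"
    show "hoare B (st ?R (ar y deg (?F k) ?C)) (If (Equal (Reg 4) (Reg 3)) Skip
          (Store 3 (Reg 4) (Div (Arr 4 (Reg 4)) (Arr 2 (Reg 4))))) (1 + 1)
        (st ?R (ar y deg (?F (Suc k)) ?C))"
    proof (cases "k = r")
      case True
      \<comment> \<open>Skipping the root is correct because both iterates vanish there.\<close>
      have eq: "ar y deg (?F (Suc k)) ?C = ar y deg (?F k) ?C"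
        using True sweep_root[of "int M" y t] sweep_root[of "int M" y "Suc t"]
        by (intro ar_cong) (auto simp: less_Suc_eq simp del: sweep.simps)
      show ?thesis unfolding eq
        by (rule hoare_If_True) (use True rr in \<open>auto simp: st_regs intro!: hoare_Skip[simplified]\<close>)
    next
      case False
      show ?thesis
      proof (rule hoare_If_False)
        show "hoare B (st ?R (ar y deg (?F k) ?C)) (Store 3 (Reg 4) (Div (Arr 4 (Reg 4)) (Arr 2 (Reg 4)))) 1
            (st ?R (ar y deg (?F (Suc k)) ?C))"
          by (rule hoare_Store3[where v=k and z="G\<^sub>t (Suc t) k"])
            (use k Gt_le[OF k, of "Suc t"] B_ge(10) False in
              \<open>auto simp: st_regs st_arrs new less_Suc_eq simp del: sweep.simps\<close>)
      qed (use False rr in \<open>auto simp: st_regs\<close>)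
    qed
  qed (use rr B_ge in auto)
  moreover have "ar y deg (?F 0) ?C = ar y deg (G\<^sub>t t) ?C" by (auto intro!: ar_cong)
  moreover have "ar y deg (?F n) ?C = ar y deg (G\<^sub>t (Suc t)) (A\<^sub>t (Suc t))"
    by (auto intro!: ar_cong simp: A\<^sub>t_def simp del: sweep.simps)
  ultimately show "hoare B (st R (ar y deg (G\<^sub>t t) ?C)) (For 4 1 (If (Equal (Reg 4) (Reg 3)) Skip
          (Store 3 (Reg 4) (Div (Arr 4 (Reg 4)) (Arr 2 (Reg 4))))))
      (n * (1 + 1 + 2) + 2) (st R (ar y deg (G\<^sub>t (Suc t)) (A\<^sub>t (Suc t))))" by (simp only:)
qed


text \<open>The bit length plays two roles: it is the number of halvings until register 9 is 0, and
  it satisfies the inequality that \<open>sweep_round\<close> demands.\<close>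

definition l :: nat where "l = floorlog 2 (nat E\<^sub>0)"

lemma E0_less: "E\<^sub>0 < 2 ^ l"
proof -
  have "nat E\<^sub>0 < 2 ^ l" unfolding l_def by (rule floorlog_leD) auto
  then show ?thesis using E0_le(1) by (simp add: nat_less_iff)
qed

lemma E0_div_pos: "j < l \<Longrightarrow> E\<^sub>0 div 2 ^ j > 0"
proof -
  assume j: "j < l"
  have "2 ^ (Suc j - 1) \<le> nat E\<^sub>0" using j unfolding l_def by (intro floorlog_geD) auto
  then have "2 ^ j \<le> E\<^sub>0" by (simp add: le_nat_iff[OF E0_le(1)])
  then show ?thesis by (simp add: pos_imp_zdiv_pos_iff)
qed

abbreviation sweep_steps :: nat where
  "sweep_steps \<equiv> (n * (1 + 2) + 2) + ((m * (1 + 2) + 2) + (n * (1 + 1 + 2) + 2))"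

lemma iterate_prog_spec:
  assumes R: "base R" and R7: "R 7 = int P" and R8: "R 8 = int M" and R9: "R 9 = E\<^sub>0" and R10: "R 10 = 0"
  shows "hoare B (st R (ar y deg (\<lambda>_. 0) (\<lambda>_. 0))) iterate_prog (l * ((P * (sweep_steps + 2) + 2 + 1) + 1) + 1)
    (st (R(9 := 0)) (ar y deg (G\<^sub>t (P * l)) (A\<^sub>t (P * l))))"
proof -
  let ?R = "\<lambda>j. R(9 := E\<^sub>0 div 2 ^ j)"
  let ?I = "\<lambda>j. st (?R j) (ar y deg (G\<^sub>t (P * j)) (A\<^sub>t (P * j)))"
  have body: "hoare B (?I j) (Seq (For 10 7 sweep_prog) (Assign 9 (Div (Reg 9) (Const 2))))
      (P * (sweep_steps + 2) + 2 + 1) (?I (Suc j))" for j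
  proof (rule hoare_Seq)
    have "hoare B (st (?R j) (ar y deg (G\<^sub>t (P * j + 0)) (A\<^sub>t (P * j + 0)))) (For 10 7 sweep_prog)
        (P * (sweep_steps + 2) + 2) (st (?R j) (ar y deg (G\<^sub>t (P * j + P)) (A\<^sub>t (P * j + P))))"
    proof (rule hoare_For[where Rf="\<lambda>_. ?R j" and K="\<lambda>k. ar y deg (G\<^sub>t (P * j + k)) (A\<^sub>t (P * j + k))"])
      fix k
      have "base ((?R j)(10 := int k))" using R by (simp add: base_def)
      from sweep_prog_spec[OF this, of "P * j + k" "A\<^sub>t (P * j + k)"] R8
      show "hoare B (st ((?R j)(10 := int k)) (ar y deg (G\<^sub>t (P * j + k)) (A\<^sub>t (P * j + k)))) sweep_prog sweep_steps
        (st ((?R j)(10 := int k)) (ar y deg (G\<^sub>t (P * j + Suc k)) (A\<^sub>t (P * j + Suc k))))"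
        by (simp only: add_Suc_right) simp
    qed (use R7 R10 B_ge in auto)
    then show "hoare B (?I j) (For 10 7 sweep_prog) (P * (sweep_steps + 2) + 2)
        (st (?R j) (ar y deg (G\<^sub>t (P * Suc j)) (A\<^sub>t (P * Suc j))))"
      by (simp only: add_0_right mult_Suc_right add.commute[of P])
    have d: "E\<^sub>0 div 2 ^ Suc j = E\<^sub>0 div 2 ^ j div 2"
      by (simp only: power_Suc2 div_mult2_eq' zdiv_zmult2_eq[of 2])
    have "\<bar>E\<^sub>0 div 2 ^ Suc j\<bar> \<le> B"
      using abs_div_le[of "E\<^sub>0" "2 ^ Suc j"] E0_le B_ge(8) by linarith
    then have "hoare B (st (?R j) (ar y deg (G\<^sub>t (P * Suc j)) (A\<^sub>t (P * Suc j)))) (Assign 9 (Div (Reg 9) (Const 2))) 1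
        (st ((?R j)(9 := E\<^sub>0 div 2 ^ Suc j)) (ar y deg (G\<^sub>t (P * Suc j)) (A\<^sub>t (P * Suc j))))"
      by (intro hoare_Assign_st) (auto simp only: st_regs aval.simps fun_upd_same d)
    then show "hoare B (st (?R j) (ar y deg (G\<^sub>t (P * Suc j)) (A\<^sub>t (P * Suc j)))) (Assign 9 (Div (Reg 9) (Const 2))) 1 (?I (Suc j))"
      by (simp only: fun_upd_upd)
  qed
  have "hoare B (?I 0) iterate_prog (l * ((P * (sweep_steps + 2) + 2 + 1) + 1) + 1) (?I l)"
    unfolding iterate_prog_def
  proof (rule hoare_While[where I="?I"])
    show "bval (Less (Const 0) (Reg 9)) s" if "j < l" "?I j s" for j s
      using E0_div_pos[OF that(1)] that(2) by (simp add: st_regs)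
    show "\<not> bval (Less (Const 0) (Reg 9)) s" if "?I l s" for s
      using E0_less E0_le that by (simp add: st_regs)
  qed (rule body)
  moreover have "?R 0 = R" using R9 by auto
  moreover have "?R l = R(9 := 0)" using E0_less E0_le by simp
  moreover have "G\<^sub>t (P * 0) = (\<lambda>_. 0)" "A\<^sub>t (P * 0) = (\<lambda>_. 0)" by (simp_all add: A\<^sub>t_def)
  ultimately show ?thesis by (simp only:)
qed

section \<open>Rounding and the exact check of the candidate\<close>

definition h :: "nat \<Rightarrow> int" where
  "h v = (2 * G\<^sub>t (P * l) v + int M) div (2 * int M)"

lemma h_le: "v < n \<Longrightarrow> \<bar>h v\<bar> \<le> int Hb"
proof -
  assume v: "v < n"
  have "\<bar>h v\<bar> \<le> \<bar>2 * G\<^sub>t (P * l) v + int M\<bar>" unfolding h_def by (rule abs_div_le)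
  also have "\<dots> \<le> int Hb" using Gt_le[OF v, of "P * l"] by (simp add: Hb_def)
  finally show ?thesis .
qed

lemma round_prog_spec:
  assumes R: "base R" and R8: "R 8 = int M"
  shows "hoare B (st R (ar y deg (G\<^sub>t (P * l)) A)) round_prog (n * (1 + 2) + 2) (st R (ar y deg h A))"
proof -
  let ?F = "\<lambda>k v. if v < k then h v else G\<^sub>t (P * l) v"
  have "hoare B (st R (ar y deg (?F 0) A)) round_prog (n * (1 + 2) + 2) (st R (ar y deg (?F n) A))"
    unfolding round_prog_def
  proof (rule hoare_For[where Rf="\<lambda>_. R" and K="\<lambda>k. ar y deg (?F k) A"])
    fix k assume k: "k < n"
    show "hoare B (st (R(4 := int k)) (ar y deg (?F k) A)) (Store 3 (Reg 4)
       (Div (Add (Mul (Const 2) (Arr 3 (Reg 4))) (Reg 8)) (Mul (Const 2) (Reg 8)))) 1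
       (st (R(4 := int k)) (ar y deg (?F (Suc k)) A))"
      by (rule hoare_Store3[where v=k and z="h k"])
        (use k h_le[OF k] B_ge(11) R8 in \<open>auto simp: st_regs st_arrs less_Suc_eq h_def\<close>)
  qed (use R B_ge in \<open>auto simp: baseD\<close>)
  moreover have "ar y deg (?F 0) A = ar y deg (G\<^sub>t (P * l)) A" "ar y deg (?F n) A = ar y deg h A"
    by (auto intro!: ar_cong)
  ultimately show ?thesis by (simp only:)
qed

lemma residue_prog_spec:
  assumes R: "base R"
  shows "hoare B (st R (ar y deg h A)) residue_prog ((n * (1 + 2) + 2) + (m * (1 + 2) + 2))
    (st R (ar y deg h (\<lambda>v. y v + lap h v)))"
  unfolding residue_prog_def
proof (rule hoare_Seq)
  let ?r = "\<lambda>v. y v - deg v * h v"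
  let ?A = "\<lambda>k v. if v < k then ?r v else A v"
  have b: "\<bar>?r v\<bar> \<le> int (Yb + m * Hb)" if v: "v < n" for v
  proof -
    have "deg v \<le> int m" unfolding out_degree_def m_def
      by (simp add: card_mono out_arcs_def)
    then have "\<bar>deg v * h v\<bar> \<le> int m * int Hb"
      unfolding abs_mult using h_le[OF v] by (intro mult_mono) auto
    then show ?thesis using y_le[OF v] abs_triangle_ineq4[of "y v" "deg v * h v"] by simp
  qed
  have bB: "int (Yb + m * Hb) \<le> B" using B_ge(12) by (rule order_trans[rotated]) simp
  have "hoare B (st R (ar y deg h (?A 0))) (For 4 1 (Store 4 (Reg 4) (Sub (Arr 1 (Reg 4)) (Mul (Arr 2 (Reg 4)) (Arr 3 (Reg 4))))))
      (n * (1 + 2) + 2) (st R (ar y deg h (?A n)))"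
  proof (rule hoare_For[where Rf="\<lambda>_. R" and K="\<lambda>k. ar y deg h (?A k)"])
    fix k assume k: "k < n"
    show "hoare B (st (R(4 := int k)) (ar y deg h (?A k))) (Store 4 (Reg 4) (Sub (Arr 1 (Reg 4)) (Mul (Arr 2 (Reg 4)) (Arr 3 (Reg 4))))) 1
       (st (R(4 := int k)) (ar y deg h (?A (Suc k))))"
      by (rule hoare_Store4[where v=k and z="?r k"])
        (use k order_trans[OF b[OF k] bB] in \<open>auto simp: st_regs st_arrs less_Suc_eq\<close>)
  qed (use R B_ge in \<open>auto simp: baseD\<close>)
  moreover have "ar y deg h (?A 0) = ar y deg h A" "ar y deg h (?A n) = ar y deg h ?r"
    by (auto intro!: ar_cong)
  ultimately show "hoare B (st R (ar y deg h A)) (For 4 1 (Store 4 (Reg 4) (Sub (Arr 1 (Reg 4)) (Mul (Arr 2 (Reg 4)) (Arr 3 (Reg 4))))))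
      (n * (1 + 2) + 2) (st R (ar y deg h ?r))" by (simp only:)
  have "hoare B (st R (ar y deg h ?r)) accumulate_prog (m * (1 + 2) + 2) (st R (ar y deg h (accum ?r h m)))"
    by (rule accumulate_prog_spec[OF R b h_le]) (use B_ge(12) in auto)
  moreover have "accum ?r h m = (\<lambda>v. y v + lap h v)"
    by (auto simp: accum_total lap_def)
  ultimately show "hoare B (st R (ar y deg h ?r)) accumulate_prog (m * (1 + 2) + 2) (st R (ar y deg h (\<lambda>v. y v + lap h v)))"
    by (simp only:)
qed

lemma answer_prog_spec:
  assumes R: "base R"
  shows "hoare B (st R (ar Y D F A)) answer_prog (1 + (n * (1 + 1 + 2) + 2))
    (st (R(0 := of_bool (\<forall>v<n. A v = 0))) (ar Y D F A))"
  unfolding answer_prog_def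
proof (rule hoare_Seq)
  show "hoare B (st R (ar Y D F A)) (Assign 0 (Const 1)) 1 (st (R(0 := 1)) (ar Y D F A))"
    by (rule hoare_Assign_st) (use B_ge(13) in auto)
  let ?R = "\<lambda>k. R(0 := of_bool (\<forall>v<k. A v = 0))"
  have "hoare B (st (?R 0) (ar Y D F A)) (For 4 1 (If (Equal (Arr 4 (Reg 4)) (Const 0)) Skip (Assign 0 (Const 0))))
      (n * (1 + 1 + 2) + 2) (st (?R n) (ar Y D F A))"
  proof (rule hoare_For[where Rf="?R" and K="\<lambda>_. ar Y D F A"])
    fix k assume k: "k < n"
    let ?Q = "(?R k)(4 := int k)"
    have av: "aval (Arr 4 (Reg 4)) s = A k" if "st ?Q (ar Y D F A) s" for s
      using st_arrs[OF that k] that by (simp add: st_def)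
    show "hoare B (st ?Q (ar Y D F A)) (If (Equal (Arr 4 (Reg 4)) (Const 0)) Skip (Assign 0 (Const 0))) (1 + 1)
        (st ((?R (Suc k))(4 := int k)) (ar Y D F A))"
    proof (cases "A k = 0")
      case True
      then have "(\<forall>v<Suc k. A v = 0) = (\<forall>v<k. A v = 0)" by (auto simp: less_Suc_eq)
      then have eq: "(?R (Suc k))(4 := int k) = ?Q" by (simp only:)
      show ?thesis unfolding eq
        by (rule hoare_If_True) (use av True in \<open>auto intro!: hoare_Skip[simplified]\<close>)
    next
      case False
      then have "\<not> (\<forall>v<Suc k. A v = 0)" by auto
      then have eq: "(?R (Suc k))(4 := int k) = ?Q(0 := 0)" by auto
      show ?thesis unfolding eq
      proof (rule hoare_If_False)
        show "hoare B (st ?Q (ar Y D F A)) (Assign 0 (Const 0)) 1 (st (?Q(0 := 0)) (ar Y D F A))"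
          by (rule hoare_Assign_st) (use B_ge(13) in auto)
      qed (use av False in auto)
    qed
  qed (use R B_ge in \<open>auto simp: baseD\<close>)
  then show "hoare B (st (R(0 := 1)) (ar Y D F A)) (For 4 1 (If (Equal (Arr 4 (Reg 4)) (Const 0)) Skip (Assign 0 (Const 0))))
      (n * (1 + 1 + 2) + 2) (st (?R n) (ar Y D F A))" by simp
qed

section \<open>The whole program on an encoded instance\<close>

definition fresh :: "(nat \<Rightarrow> int \<Rightarrow> int) \<Rightarrow> bool" where
  "fresh f \<longleftrightarrow> f 0 0 = int n \<and> f 0 1 = int m \<and> f 0 2 = int r \<and> ar (\<lambda>_. 0) (\<lambda>_. 0) (\<lambda>_. 0) (\<lambda>_. 0) f"

lemma load_prog_spec:
  "hoare B (st (\<lambda>_. 0) fresh) load_prog (1 + (1 + 1))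
    (st ((\<lambda>_. 0)(1 := int n, 2 := int m, 3 := int r)) (ar (\<lambda>_. 0) (\<lambda>_. 0) (\<lambda>_. 0) (\<lambda>_. 0)))"
  unfolding load_prog_def
proof (intro hoare_Seq)
  show "hoare B (st (\<lambda>_. 0) fresh) (Assign 1 (Arr 0 (Const 0))) 1 (st ((\<lambda>_. 0)(1 := int n)) fresh)"
    by (rule hoare_Assign_st) (use B_ge in \<open>auto simp: st_def fresh_def\<close>)
  show "hoare B (st ((\<lambda>_. 0)(1 := int n)) fresh) (Assign 2 (Arr 0 (Const 1))) 1
      (st ((\<lambda>_. 0)(1 := int n, 2 := int m)) fresh)"
    by (rule hoare_Assign_st) (use B_ge in \<open>auto simp: st_def fresh_def\<close>)
  have "hoare B (st ((\<lambda>_. 0)(1 := int n, 2 := int m)) fresh) (Assign 3 (Arr 0 (Const 2))) 1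
      (st ((\<lambda>_. 0)(1 := int n, 2 := int m, 3 := int r)) fresh)"
    by (rule hoare_Assign_st) (use B_ge(1) root_less in \<open>auto simp: st_def fresh_def\<close>)
  then show "hoare B (st ((\<lambda>_. 0)(1 := int n, 2 := int m)) fresh) (Assign 3 (Arr 0 (Const 2))) 1
      (st ((\<lambda>_. 0)(1 := int n, 2 := int m, 3 := int r)) (ar (\<lambda>_. 0) (\<lambda>_. 0) (\<lambda>_. 0) (\<lambda>_. 0)))"
    by (rule hoare_conseq) (auto simp: st_def fresh_def)
qed

definition total_steps :: nat where
  "total_steps = (1 + (1 + 1)) + ((n * (1 + 2) + 2) + ((m * (1 + 2) + 2) +
     ((m * ((1 + (m * (3 + 1) + 1) + 1 + 1) + 2) + 2) + ((n * (1 + 1 + 2) + 2) + ((1 + (1 + 1)) +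
     ((l * ((P * (sweep_steps + 2) + 2 + 1) + 1) + 1) + ((n * (1 + 2) + 2) +
     (((n * (1 + 2) + 2) + (m * (1 + 2) + 2)) + (1 + (n * (1 + 1 + 2) + 2))))))))))"

lemma decide_prog_spec:
  "hoare B (st (\<lambda>_. 0) fresh) decide_prog total_steps (\<lambda>s. regs s 0 = of_bool (\<forall>v<n. y v + lap h v = 0))"
proof -
  let ?R = "(\<lambda>_. 0)(1 := int n, 2 := int m, 3 := int r)"
  let ?R' = "?R(6 := S, 7 := int P, 8 := int M, 9 := E\<^sub>0)"
  have R: "base ?R" "base (?R(6 := S))" "base ?R'" "base (?R'(9 := 0))" by (simp_all add: base_def)
  have "hoare B (st (\<lambda>_. 0) fresh) decide_prog total_steps
      (st (?R'(9 := 0, 0 := of_bool (\<forall>v<n. y v + lap h v = 0))) (ar y deg h (\<lambda>v. y v + lap h v)))"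
    unfolding decide_prog_def total_steps_def
    by (rule hoare_Seq[OF load_prog_spec], rule hoare_Seq[OF divisor_prog_spec[OF R(1)]],
        rule hoare_Seq[OF degree_prog_spec[OF R(1)]], rule hoare_Seq[OF turn_prog_spec[OF R(1)]],
        rule hoare_Seq[OF norm_prog_spec[OF R(1)]], simp, rule hoare_Seq[OF params_prog_spec[OF R(2)]], simp,
        rule hoare_Seq[OF iterate_prog_spec[OF R(3)]], simp, simp, simp, simp,
        rule hoare_Seq[OF round_prog_spec[OF R(4)]], simp, rule hoare_Seq[OF residue_prog_spec[OF R(4)]],
        rule answer_prog_spec[OF R(4)])
  then show ?thesis by (rule hoare_conseq) (auto simp: st_def)
qed

lemma answer_correct:
  "rotor_router_action G nxt r x T\<^sub>1 = T\<^sub>2 \<longleftrightarrow> (\<forall>v<n. y v + lap h v = 0)"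
proof -
  have "rotor_router_action G nxt r x T\<^sub>1 = T\<^sub>2 \<longleftrightarrow> (\<exists>g. g r = 0 \<and> (\<forall>u\<in>verts G. y u + lap g u = 0))"
    unfolding y_def \<rho>\<^sub>1_def \<rho>\<^sub>2_def by (rule rotor_router_action_eq_iff[OF T1 T2 x])
  also have "\<dots> \<longleftrightarrow> (\<forall>u\<in>verts G. y u + lap (\<lambda>v. (2 * sweep (int M) y ((2 * hit + 1) * l) v + int M) div (2 * int M)) u = 0)"
  proof (rule solvable_iff_rounded)
    show "\<bar>y v\<bar> \<le> S" if "v \<in> verts G" for v using y_le_S that by (simp add: verts_eq)
    show "int M = 2 * int hit + 3" by (simp add: M_def)
    have "int M * (2 * int hit) * S \<le> E\<^sub>0"
      unfolding E\<^sub>0_def using S_le by (intro mult_right_mono mult_left_mono) (auto simp: P_def)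
    then show "int M * (2 * int hit) * S < 2 ^ l" using E0_less by linarith
  qed
  also have "(\<lambda>v. (2 * sweep (int M) y ((2 * hit + 1) * l) v + int M) div (2 * int M)) = h"
    by (simp add: h_def P_def fun_eq_iff)
  finally show ?thesis by (simp add: verts_eq lessThan_def)
qed

abbreviation enc :: "int list" where "enc \<equiv> encode G nxt r T\<^sub>1 T\<^sub>2 x"

lemma enc_eq: "enc = [int n, int m, int r] @
     map (\<lambda>e. int (tail G e)) [0..<m] @ map (\<lambda>e. int (head G e)) [0..<m] @
     map (\<lambda>e. int (nxt e)) [0..<m] @ map (\<lambda>e. of_bool (e \<in> T\<^sub>1)) [0..<m] @
     map (\<lambda>e. of_bool (e \<in> T\<^sub>2)) [0..<m] @ map x [0..<n]"
  by (simp add: encode_def Let_def n_def m_def)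

lemma length_enc: "length enc = 3 + 5 * m + n"
  by (simp add: enc_eq)

lemma fresh_input: "fresh (arrs (input_state enc))"
proof -
  have get: "arrs (input_state enc) 0 (int i) = enc ! i" if "i < 3 + 5 * m + n" for i
    using that by (simp add: input_state_def length_enc)
  have idx: "arrs (input_state enc) 0 (idx (int k) e) = enc ! (3 + (k * m + e))"
    if "3 + (k * m + e) < 3 + 5 * m + n" for k e
    using get[OF that] by (simp add: idx_def)
  have "in_ok (arrs (input_state enc) 0)"
    unfolding in_ok_def
  proof (intro conjI allI impI)
    fix e assume e: "e < m"
    show "arrs (input_state enc) 0 (idx 0 e) = int (tail G e)"
      using idx[of 0 e] e by (simp add: enc_eq nth_append)
    show "arrs (input_state enc) 0 (idx 1 e) = int (head G e)"
      using idx[of 1 e] e by (simp add: enc_eq nth_append)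
    show "arrs (input_state enc) 0 (idx 2 e) = int (nxt e)"
      using idx[of 2 e] e by (simp add: enc_eq nth_append)
    show "arrs (input_state enc) 0 (idx 3 e) = of_bool (e \<in> T\<^sub>1)"
      using idx[of 3 e] e by (simp add: enc_eq nth_append)
    show "arrs (input_state enc) 0 (idx 4 e) = of_bool (e \<in> T\<^sub>2)"
      using idx[of 4 e] e by (simp add: enc_eq nth_append)
  next
    fix v assume v: "v < n"
    show "arrs (input_state enc) 0 (idx 5 v) = x v"
      using idx[of 5 v] v by (simp add: enc_eq nth_append)
  qed
  moreover have "arrs (input_state enc) 0 0 = int n" "arrs (input_state enc) 0 1 = int m"
    "arrs (input_state enc) 0 2 = int r"
    using get[of 0] get[of 1] get[of 2] by (simp_all add: enc_eq)
  ultimately show ?thesis unfolding fresh_def ar_def by (simp add: input_state_def)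
qed

lemma mem_le_input: "mem_le B (input_state enc)"
proof -
  have "\<bar>z\<bar> \<le> B" if "z \<in> set enc" for z
  proof -
    have "\<bar>of_bool b :: int\<bar> \<le> B" for b using B_ge(13) by simp
    moreover have "\<bar>x v\<bar> \<le> B" if "v < n" for v using X[of v] that B_ge(3) by (simp add: verts_eq)
    ultimately show ?thesis
      using that B_ge(1,2) root_less arc_verts nxt_less(1) unfolding enc_eq
      by (fastforce simp: less_imp_le)
  qed
  moreover have "B \<ge> 0" using B_ge(13) by simp
  ultimately show ?thesis by (auto simp: mem_le_def input_state_def)
qed

lemma decide_prog_decides:
  "decides_within decide_prog enc (total_steps * (weight decide_prog * (int_size B)\<^sup>2))
     (rotor_router_action G nxt r x T\<^sub>1 = T\<^sub>2)"
proof -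
  have "st (\<lambda>_. 0) fresh (input_state enc)" using fresh_input by (simp add: st_def input_state_def)
  then obtain t s where "exec decide_prog (input_state enc) t s"
    "t \<le> total_steps * (weight decide_prog * (int_size B)\<^sup>2)" "regs s 0 = of_bool (\<forall>v<n. y v + lap h v = 0)"
    using hoareE[OF decide_prog_spec mem_le_input] by blast
  then show ?thesis unfolding decides_within_def answer_correct of_bool_def by blast
qed

end

section \<open>Polynomial running time\<close>

lemma mult_le_power:
  fixes q :: nat shows "a \<le> q ^ i \<Longrightarrow> b \<le> q ^ j \<Longrightarrow> i + j \<le> k \<Longrightarrow> 1 \<le> q \<Longrightarrow> a * b \<le> q ^ k"
proof -
  assume a: "a \<le> q ^ i" "b \<le> q ^ j" "i + j \<le> k" "1 \<le> q"
  have "a * b \<le> q ^ i * q ^ j" using a by (intro mult_le_mono)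
  also have "\<dots> = q ^ (i + j)" by (simp add: power_add)
  also have "\<dots> \<le> q ^ k" using a by (intro power_increasing)
  finally show ?thesis .
qed

text \<open>Together with \<open>mult_le_power\<close> this reduces all size estimates to exponents
  of a single base: a product adds exponents, and a sum costs one more power, as the base is at
  least 2.\<close>

lemma add_le_power:
  fixes q :: nat shows "a \<le> q ^ i \<Longrightarrow> b \<le> q ^ j \<Longrightarrow> i < k \<Longrightarrow> j < k \<Longrightarrow> 2 \<le> q \<Longrightarrow> a + b \<le> q ^ k"
proof -
  assume a: "a \<le> q ^ i" "b \<le> q ^ j" "i < k" "j < k" "2 \<le> q"
  have "q ^ i \<le> q ^ (k - 1)" "q ^ j \<le> q ^ (k - 1)" using a by (auto intro!: power_increasing)
  then have "a + b \<le> 2 * q ^ (k - 1)" using a by linarith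
  also have "\<dots> \<le> q * q ^ (k - 1)" using a by (intro mult_le_mono1)
  also have "\<dots> = q ^ k" using a by (cases k) auto
  finally show ?thesis .
qed

lemma le_power_mono:
  fixes q :: nat shows "a \<le> q ^ i \<Longrightarrow> i \<le> k \<Longrightarrow> 1 \<le> q \<Longrightarrow> a \<le> q ^ k"
  by (erule order_trans) (rule power_increasing)

context rotor_instance
begin

text \<open>Later \<open>q\<close> is exponential in the input size, because the entries of
  \<open>x\<close> may be. Crude exponents suffice: a bounded power of \<open>q\<close> still has
  linear word length.\<close>

lemma word_bounds:
  assumes q: "8 \<le> q" and nm: "n \<le> q" "m \<le> q" "X \<le> q"
  shows "M * P * Sb \<le> q ^ 17" and "B \<le> int (q ^ 23)"
proof -
  have q1: "1 \<le> q" "2 \<le> q" using q by auto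
  have c: "1 \<le> q ^ 0" "2 \<le> q ^ 1" "3 \<le> q ^ 1" using q by auto
  have v: "n \<le> q ^ 1" "m \<le> q ^ 1" "X \<le> q ^ 1" using nm by auto
  have nn: "n\<^sup>2 \<le> q ^ 2" using nm by (intro power_mono) auto
  have hit: "hit \<le> q ^ 4" unfolding hit_def n_def[symmetric] m_def[symmetric]
    by (rule mult_le_power[OF mult_le_power[OF c(2) nn, of 3] v(2)]) (use q in auto)
  have hit2: "2 * hit \<le> q ^ 5" by (rule mult_le_power[OF c(2) hit]) (use q in auto)
  have P: "P \<le> q ^ 6" unfolding P_def by (rule add_le_power[OF hit2 c(1)]) (use q in auto)
  have M: "M \<le> q ^ 6" unfolding M_def by (rule add_le_power[OF hit2 c(3)]) (use q in auto)
  have mm: "2 * m * m \<le> q ^ 3" by (rule mult_le_power[OF mult_le_power[OF c(2) v(2), of 2] v(2)]) (use q in auto)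
  have Yb: "Yb \<le> q ^ 4" unfolding Yb_def by (rule add_le_power[OF v(3) mm]) (use q in auto)
  have Sb: "Sb \<le> q ^ 5" unfolding Sb_def by (rule mult_le_power[OF v(1) Yb]) (use q in auto)
  show MPS: "M * P * Sb \<le> q ^ 17" by (rule mult_le_power[OF mult_le_power[OF M P, of 12] Sb]) (use q in auto)
  have MS: "M * Sb \<le> q ^ 11" by (rule mult_le_power[OF M Sb]) (use q in auto)
  have Gb: "Gb \<le> q ^ 16" unfolding Gb_def
    by (rule mult_le_power[OF hit add_le_power[OF MS c(1), of 12]]) (use q in auto)
  have mG: "M * Sb + m * Gb \<le> q ^ 18"
    by (rule add_le_power[OF MS mult_le_power[OF v(2) Gb, of 17]]) (use q in auto)
  have Hb: "Hb \<le> q ^ 18" unfolding Hb_def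
    by (rule add_le_power[OF mult_le_power[OF c(2) Gb, of 17] M]) (use q in auto)
  have mH: "2 * (m * Hb) \<le> q ^ 20"
    by (rule mult_le_power[OF c(2) mult_le_power[OF v(2) Hb, of 19]]) (use q in auto)
  have YH: "Yb + 2 * (m * Hb) \<le> q ^ 21" by (rule add_le_power[OF Yb mH]) (use q in auto)
  define Bs where "Bs = [X, n, m, 1, Yb, Sb, P, M, M * P * Sb, M * Sb + m * Gb, Gb, Hb, Yb + 2 * (m * Hb)]"
  have "\<forall>b\<in>set Bs. b \<le> q ^ 21"
    unfolding Bs_def using q1(1)
    by (auto intro: le_power_mono[OF v(1)] le_power_mono[OF v(2)] le_power_mono[OF v(3)] le_power_mono[OF c(1)]
        le_power_mono[OF Yb] le_power_mono[OF Sb] le_power_mono[OF P] le_power_mono[OF M] le_power_mono[OF MPS]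
        le_power_mono[OF mG] le_power_mono[OF Gb] le_power_mono[OF Hb] le_power_mono[OF YH])
  then have "sum_list (map (\<lambda>b. b) Bs) \<le> sum_list (map (\<lambda>_. q ^ 21) Bs)" by (intro sum_list_mono) auto
  also have "\<dots> = 13 * q ^ 21" by (simp add: Bs_def)
  \<comment> \<open>The 13 summands of \<open>B\<close> are absorbed by \<open>q ^ 2\<close>, which
    is at least 64.\<close>
  also have "\<dots> \<le> q ^ 2 * q ^ 21"
  proof (rule mult_le_mono1)
    have "8 * 8 \<le> q * q" using q by (intro mult_le_mono)
    then show "13 \<le> q ^ 2" by (simp add: power2_eq_square)
  qed
  also have "\<dots> = q ^ 23" by (simp add: power_add[symmetric])
  finally show "B \<le> int (q ^ 23)" unfolding B_def of_nat_le_iff Bs_def[symmetric] by simp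
qed

text \<open>The iteration dominates: linearly many halvings, each with \<open>P\<close> sweeps,
  which is cubic, and each sweep of linear length. This gives 1692 times the fifth power; the other
  phases are at most quadratic and fit into the remainder.\<close>

lemma total_steps_le:
  assumes s: "1 \<le> s" "n \<le> s" "m \<le> s" and l: "l \<le> 18 * s"
  shows "total_steps \<le> 1800 * s ^ 5"
proof -
  have p: "s ^ i \<le> s ^ 5" if "i \<le> 5" for i using s(1) that by (intro power_increasing)
  have p': "s ^ i \<le> s ^ 4" if "i \<le> 4" for i using s(1) that by (intro power_increasing)
  have "P \<le> 5 * s ^ 3"
  proof -
    have "n * n * m \<le> s * s * s" using s by (intro mult_le_mono)
    moreover have "P = 4 * (n * n * m) + 1"
      by (simp add: P_def hit_def n_def m_def power2_eq_square)
    moreover have "s * s * s = s ^ 3" "1 \<le> s ^ 3" using s(1) by (simp_all add: power3_eq_cube)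
    ultimately show ?thesis by linarith
  qed
  moreover have "sweep_steps + 2 \<le> 18 * s" using s by simp
  ultimately have "P * (sweep_steps + 2) \<le> (5 * s ^ 3) * (18 * s)" by (rule mult_le_mono)
  also have "\<dots> = 90 * s ^ 4" using power_add[of s 3 1] by simp
  finally have "(P * (sweep_steps + 2) + 2 + 1) + 1 \<le> 94 * s ^ 4" using p'[of 0] by simp
  with l have "l * ((P * (sweep_steps + 2) + 2 + 1) + 1) \<le> (18 * s) * (94 * s ^ 4)" by (rule mult_le_mono)
  also have "\<dots> = 1692 * s ^ 5" using power_add[of s 1 4] by simp
  finally have main: "l * ((P * (sweep_steps + 2) + 2 + 1) + 1) \<le> 1692 * s ^ 5" .
  have "(1 + (m * (3 + 1) + 1) + 1 + 1) + 2 \<le> 10 * s" using s by simp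
  with s(3) have "m * ((1 + (m * (3 + 1) + 1) + 1 + 1) + 2) \<le> s * (10 * s)" by (rule mult_le_mono)
  also have "\<dots> = 10 * s ^ 2" by (simp add: power2_eq_square)
  also have "\<dots> \<le> 10 * s ^ 5" using p[of 2] by simp
  finally have "m * ((1 + (m * (3 + 1) + 1) + 1 + 1) + 2) \<le> 10 * s ^ 5" .
  moreover have "n \<le> s ^ 5" "m \<le> s ^ 5" "1 \<le> s ^ 5" using p[of 1] p[of 0] s by auto
  moreover define a where "a = m * ((1 + (m * (3 + 1) + 1) + 1 + 1) + 2)"
  moreover define b where "b = l * ((P * (sweep_steps + 2) + 2 + 1) + 1)"
  ultimately have "a \<le> 10 * s ^ 5" "b \<le> 1692 * s ^ 5" "n \<le> s ^ 5" "m \<le> s ^ 5" "1 \<le> s ^ 5"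
    using main by blast+
  then show ?thesis unfolding total_steps_def a_def[symmetric] b_def[symmetric] by simp
qed

end

lemma sum_list_ge_length: "(\<And>z. z \<in> set xs \<Longrightarrow> 1 \<le> f z) \<Longrightarrow> length xs \<le> sum_list (map f xs :: nat list)"
  by (induction xs) (auto simp: Suc_le_eq add_less_le_mono intro!: Suc_leI, fastforce)

text \<open>Each listed number costs at least 1, so \<open>n\<close> and \<open>m\<close> are at
  most the input size, while the entries of \<open>x\<close> are bounded only by an exponential in
  it.\<close>

lemma input_size_encode:
  fixes G :: "(nat, nat) pre_digraph"
  shows "3 + 5 * card (arcs G) + card (verts G) \<le> input_size (encode G nxt r T\<^sub>1 T\<^sub>2 x)"
    and "v < card (verts G) \<Longrightarrow> \<bar>x v\<bar> \<le> 2 ^ input_size (encode G nxt r T\<^sub>1 T\<^sub>2 x)"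
proof -
  let ?e = "encode G nxt r T\<^sub>1 T\<^sub>2 x"
  have "length ?e \<le> input_size ?e" unfolding input_size_def
    by (rule sum_list_ge_length) (rule int_size_pos)
  then show "3 + 5 * card (arcs G) + card (verts G) \<le> input_size ?e" by (simp add: encode_def Let_def)
  assume "v < card (verts G)"
  then have "x v \<in> set ?e" by (simp add: encode_def Let_def)
  then have "int_size (x v) \<le> input_size ?e" unfolding input_size_def by (intro member_le_sum_list) auto
  then have "(2::int) ^ (int_size (x v) - 1) \<le> 2 ^ input_size ?e" by (intro power_increasing) auto
  then show "\<bar>x v\<bar> \<le> 2 ^ input_size ?e" using abs_less_two_power_int_size[of "x v"] by linarith
qed

theorem theorem3p20:
  shows "\<exists>(c :: com) (p :: nat poly).
    \<forall>(G :: (nat, nat) pre_digraph) nxt r T\<^sub>1 T\<^sub>2 x.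
      fin_digraph G \<and> loopfree_digraph G \<and> strongly_connected G \<and> eulerian_digraph G \<and>
      numbered G \<and> ribbon_structure G nxt \<and> r \<in> verts G \<and>
      T\<^sub>1 \<in> Arb G r \<and> T\<^sub>2 \<in> Arb G r \<and> x \<in> divisors0 G \<longrightarrow>
      decides_within c (encode G nxt r T\<^sub>1 T\<^sub>2 x)
        (poly p (input_size (encode G nxt r T\<^sub>1 T\<^sub>2 x)))
        (rotor_router_action G nxt r x T\<^sub>1 = T\<^sub>2)"
proof (intro exI[of _ decide_prog] exI[of _ "monom (1800 * 576 * weight decide_prog) 7"] allI impI)
  fix G :: "(nat, nat) pre_digraph" and nxt r T\<^sub>1 T\<^sub>2 and x :: "nat \<Rightarrow> int"
  let ?e = "encode G nxt r T\<^sub>1 T\<^sub>2 x"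
  define s where "s = input_size ?e"
  assume A: "fin_digraph G \<and> loopfree_digraph G \<and> strongly_connected G \<and> eulerian_digraph G \<and>
      numbered G \<and> ribbon_structure G nxt \<and> r \<in> verts G \<and>
      T\<^sub>1 \<in> Arb G r \<and> T\<^sub>2 \<in> Arb G r \<and> x \<in> divisors0 G"
  then interpret fin_digraph G by blast
  interpret loopfree_digraph G using A by blast
  interpret rotor_instance G r nxt T\<^sub>1 T\<^sub>2 x "2 ^ s"
  proof unfold_locales
    fix v assume "v \<in> verts G"
    moreover have "verts G = {..<card (verts G)}" using A by (simp add: numbered_def)
    ultimately have "v < card (verts G)" by blast
    then show "\<bar>x v\<bar> \<le> int (2 ^ s)" unfolding s_def using input_size_encode(2)[of v G x] by simp
  qed (use A in blast)+
  have sz: "3 + 5 * m + n \<le> s" unfolding s_def m_def n_def by (rule input_size_encode(1))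
  let ?q = "2 ^ s :: nat"
  have "2 ^ 3 \<le> ?q" using sz by (intro power_increasing) auto
  then have q: "8 \<le> ?q" by simp
  have "s < ?q" by simp
  then have nm: "n \<le> ?q" "m \<le> ?q" using sz by linarith+
  note wb = word_bounds[OF q nm order_refl]
  have "E\<^sub>0 \<le> int (?q ^ 17)" using E0_le(2) wb(1) by (meson of_nat_le_iff order_trans)
  then have "nat E\<^sub>0 \<le> ?q ^ 17" by (simp only: nat_le_iff)
  also have "\<dots> = 2 ^ (17 * s)" by (simp add: power_mult[symmetric] mult.commute)
  also have "\<dots> < 2 ^ (18 * s)" using sz by (intro power_strict_increasing) auto
  \<comment> \<open>Only here does the exponential size of the numbers turn into a linear number of
    halving rounds.\<close>
  finally have l: "l \<le> 18 * s" unfolding l_def by (intro floorlog_leI) auto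
  have T: "total_steps \<le> 1800 * s ^ 5" by (rule total_steps_le) (use sz l in auto)
  have "B < 2 ^ (24 * s - 1)"
  proof -
    have "B \<le> int (2 ^ (23 * s))" using wb(2) by (simp add: power_mult[symmetric] mult.commute)
    also have "\<dots> < int (2 ^ (24 * s - 1))"
      unfolding of_nat_less_iff using sz by (intro power_strict_increasing) auto
    finally show ?thesis by simp
  qed
  moreover have "0 \<le> B" using B_ge(13) by simp
  ultimately have "int_size B \<le> Suc (24 * s - 1)" unfolding int_size_le_iff by simp
  then have "int_size B \<le> 24 * s" using sz by simp
  then have \<beta>: "(int_size B)\<^sup>2 \<le> (24 * s)\<^sup>2" by (intro power_mono) auto
  \<comment> \<open>The degree 7 is 5 for the executed instructions plus 2 for the squared word
    length, and 576 is the square of 24.\<close>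
  have "total_steps * (weight decide_prog * (int_size B)\<^sup>2) \<le> (1800 * s ^ 5) * (weight decide_prog * (24 * s)\<^sup>2)"
    by (intro mult_le_mono T \<beta> order_refl)
  also have "\<dots> = poly (monom (1800 * 576 * weight decide_prog) 7) s"
    using power_add[of s 5 2] by (simp add: poly_monom power_mult_distrib)
  finally show "decides_within decide_prog ?e (poly (monom (1800 * 576 * weight decide_prog) 7) (input_size ?e))
      (rotor_router_action G nxt r x T\<^sub>1 = T\<^sub>2)"
    using decide_prog_decides unfolding decides_within_def s_def[symmetric] by (meson order_trans)
qed

end
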